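(* Let $\mathcal{M}$ be an $n$-dimensional paracompact smooth manifold with a linear symmetric (torsion-free) connection $\Gamma$, let $\gamma$ be a symplectic connection on $(\mathcal{T}^*\mathcal{M},\omega)$ compatible with $\Gamma$, and let $*$ be the Fedosov star product generated by $\gamma$, with Moyal bracket $\{a_0,b_0\}_M:=a_0*b_0-b_0*a_0$. Then the canonical variables $q^1,\dots,q^n,p_1,\dots,p_n$ of a proper Darboux chart fulfill the following commutation relations (consistent with the Dirac quantization rules), for all $1\le\alpha,\beta\le n$: $$\{q^\alpha,q^\beta\}_M=0,\qquad \{q^\alpha,p_\beta\}_M=-i\hbar\,\delta^\alpha_\beta,\qquad \{p_\alpha,p_\beta\}_M=0 ,$$ where the sign in the second relation is a consequence of the Fedosov sign convention. These commutation relations are invariant under the point transformations $Q^k=Q^k(q^i)$, $P_i=\frac{\partial q^l}{\partial Q^i}p_l$.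
   Context: All objects are smooth; repeated indices are summed. Local coordinates $q^1,\dots,q^n$ on $\mathcal{M}$ induce coordinates $(q^1,\dots,q^n,p_1,\dots,p_n)=(x^1,\dots,x^{2n})$ on $\mathcal{W}=\mathcal{T}^*\mathcal{M}$, where a covector is $p_i dq^i$; such a chart is called a proper Darboux chart. The symplectic form is $\omega=dq^i\wedge dp_i=\tfrac12\omega_{ij}dx^i\wedge dx^j$, and $\omega^{ij}$ is defined by $\omega_{kl}\omega^{lj}=\delta^j_k$. Greek indices run over $1,\dots,n$, capital Latin indices over $n+1,\dots,2n$, lower case Latin over $1,\dots,2n$ (except in the formulas for $\omega=dq^i\wedge dp_i$, $p_idq^i$ and the point transformations, where they run over $1,\dots,n$). A symplectic connection $\gamma$ is a torsion-free linear connection on $\mathcal{W}$ with $\nabla\omega=0$; put $\gamma_{ijk}:=\omega_{il}\gamma^l_{jk}$ (totally symmetric in Darboux coordinates). $\gamma$ is compatible with $\Gamma$ if in every proper Darboux chart: $\gamma_{IJK}=0$; $\gamma_{IJ\alpha}=0$; $\gamma_{I\alpha\beta}(q,p)=-\Gamma^{I-n}_{\alpha\beta}(q)$; and $\gamma_{\alpha\beta\delta}(q,p)=p_\varepsilon f^{\varepsilon}_{\alpha\beta\delta}(q)$ with smooth $f^\varepsilon_{\alpha\beta\delta}$ depending on $q$ only. Fedosov formalism. The Weyl bundle has as sections formal series $a=\sum_{k,l\ge0}\hbar^k a_{k,j_1\dots j_l}y^{j_1}\cdots y^{j_l}$, where $a_{k,j_1\dots j_l}$ are components of smooth totally symmetric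 covariant tensor fields on $\mathcal{W}$ and $y^1,\dots,y^{2n}$ are formal commuting variables (components of a tangent vector). A term $\hbar^k$ times a monomial with $l$ factors $y$ has degree $2k+l$. The product is $$a\circ b=\sum_{t\ge0}\frac1{t!}\Big(-\frac{i\hbar}2\Big)^t\omega^{i_1j_1}\cdots\omega^{i_tj_t}\frac{\partial^ta}{\partial y^{i_1}\cdots\partial y^{i_t}}\frac{\partial^tb}{\partial y^{j_1}\cdots\partial y^{j_t}},$$ extended to differential forms with values in the Weyl bundle using the wedge product of forms; $[a,b]=a\circ b-(-1)^{m_1m_2}b\circ a$ for an $m_1$-form $a$ and $m_2$-form $b$. Put $\delta a=dx^k\wedge\frac{\partial a}{\partial y^k}$; on an $m$-form homogeneous of degree $l$ in the $y$'s, $\delta^{-1}a=\frac1{l+m}y^k\,\frac{\partial}{\partial x^k}\rfloor a$ if $l+m>0$ and $\delta^{-1}a=0$ if $l+m=0$. In a Darboux chart $\gamma$ also denotes the $1$-form $\frac12\gamma_{ijk}y^iy^jdx^k$; $\partial_\gamma a=da+\frac i\hbar[\gamma,a]$ and $R_\gamma=d\gamma+\frac i\hbar\gamma\circ\gamma$. The Abelian connection series $r$ generated by $\gamma$ is the unique $1$-form with values in the Weyl bundle satisfying $\delta r=R_\gamma+\partial_\gamma r+\frac i\hbar r\circ r$, $\delta^{-1}r=0$ and having only terms of degree $\ge3$. The Abelian connection is $\tilde\gamma=\omega_{ij}y^idx^j+\gamma+r$, and a section $a$ of the Weyl bundle is flat if $\partial_{\tilde\gamma}a=da+\frac i\hbar[\tilde\gamma,a]=0$.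 For every smooth function $a_0$ there is a unique flat section $a=:\sigma^{-1}(a_0)$ with $\sigma(a):=a|_{y=0}=a_0$; it is found by iterating $a=a_0+\delta^{-1}\big(\partial_\gamma a+\frac i\hbar[r,a]\big)$. The Fedosov star product generated by $\gamma$ is $a_0*b_0:=\sigma\big(\sigma^{-1}(a_0)\circ\sigma^{-1}(b_0)\big)$.
   Formalization: The second relation is proved as {q^α,p_β}_M = +iħδ^α_β: with ω = dq^i∧dp_i, ω_{kl}ω^{lj} = δ and the factor −iħ/2 in the product, the printed sign −iħ fails already for M = R^n with Γ = γ = 0. *)

theory Defs
  imports "HOL-Analysis.Analysis" "HOL-Library.Multiset" "HOL-Library.Function_Algebras"
    "HOL-Computational_Algebra.Formal_Power_Series"
begin

section \<open>Smooth maps and smooth manifolds\<close>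

primrec Ck_on :: "nat \<Rightarrow> 'a::real_normed_vector set \<Rightarrow> ('a \<Rightarrow> 'b::real_normed_vector) \<Rightarrow> bool" where
  "Ck_on 0 S f \<longleftrightarrow> continuous_on S f"
| "Ck_on (Suc k) S f \<longleftrightarrow> (\<forall>x\<in>S. f differentiable (at x)) \<and>
     (\<forall>v. Ck_on k S (\<lambda>x. frechet_derivative f (at x) v))"

text \<open>Only used for open \<open>S\<close>.\<close>

definition smooth_on :: "'a::real_normed_vector set \<Rightarrow> ('a \<Rightarrow> 'b::real_normed_vector) \<Rightarrow> bool" where
  "smooth_on S f \<longleftrightarrow> (\<forall>k. Ck_on k S f)"

definition partial :: "'k::finite \<Rightarrow> (real^'k \<Rightarrow> 'b::real_normed_vector) \<Rightarrow> real^'k \<Rightarrow> 'b" where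
  "partial i f x = frechet_derivative f (at x) (axis i 1)"

definition diffeo :: "(real^'k::finite) set \<Rightarrow> (real^'k) set \<Rightarrow> (real^'k \<Rightarrow> real^'k) \<Rightarrow>
    (real^'k \<Rightarrow> real^'k) \<Rightarrow> bool" where
  "diffeo V V' Q R \<longleftrightarrow> open V \<and> open V' \<and> smooth_on V Q \<and> smooth_on V' R \<and>
     Q ` V = V' \<and> R ` V' = V \<and> (\<forall>x\<in>V. R (Q x) = x) \<and> (\<forall>y\<in>V'. Q (R y) = y)"

text \<open>A chart is a pair of a domain and a coordinate map; the values of the coordinate map
  outside the domain are irrelevant.\<close>

type_synonym ('m, 'n) chart = "'m set \<times> ('m \<Rightarrow> real^'n)"

definition chart_inv :: "('m, 'n) chart \<Rightarrow> real^'n \<Rightarrow> 'm" where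
  "chart_inv c = inv_into (fst c) (snd c)"

definition is_chart :: "('m::topological_space, 'n::finite) chart \<Rightarrow> bool" where
  "is_chart c \<longleftrightarrow> open (fst c) \<and> open (snd c ` fst c) \<and>
     homeomorphism (fst c) (snd c ` fst c) (snd c) (chart_inv c)"

definition overlap :: "('m, 'n) chart \<Rightarrow> ('m, 'n) chart \<Rightarrow> (real^'n) set" where
  "overlap c c' = snd c ` (fst c \<inter> fst c')"

definition trans_map :: "('m, 'n) chart \<Rightarrow> ('m, 'n) chart \<Rightarrow> real^'n \<Rightarrow> real^'n" where
  "trans_map c c' = snd c' \<circ> chart_inv c"

definition charts_compatible :: "('m, 'n::finite) chart \<Rightarrow> ('m, 'n) chart \<Rightarrow> bool" where
  "charts_compatible c c' \<longleftrightarrow>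
     smooth_on (overlap c c') (trans_map c c') \<and> smooth_on (overlap c' c) (trans_map c' c)"

definition smooth_structure :: "('m::topological_space, 'n::finite) chart set \<Rightarrow> bool" where
  "smooth_structure \<A> \<longleftrightarrow> (\<forall>c\<in>\<A>. is_chart c) \<and> (\<Union>c\<in>\<A>. fst c) = UNIV \<and>
     (\<forall>c\<in>\<A>. \<forall>c'\<in>\<A>. charts_compatible c c') \<and>
     (\<forall>c. is_chart c \<and> (\<forall>c'\<in>\<A>. charts_compatible c c' \<and> charts_compatible c' c) \<longrightarrow> c \<in> \<A>)"

definition paracompact_space :: "'m topology \<Rightarrow> bool" where
  "paracompact_space X \<longleftrightarrow>
     (\<forall>\<U>. (\<forall>U\<in>\<U>. openin X U) \<and> \<Union>\<U> = topspace X \<longrightarrow>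
        (\<exists>\<V>. (\<forall>V\<in>\<V>. openin X V) \<and> \<Union>\<V> = topspace X \<and>
             (\<forall>V\<in>\<V>. \<exists>U\<in>\<U>. V \<subseteq> U) \<and> locally_finite_in X \<V>))"

text \<open>The Hausdorff property is supplied by the type class.\<close>

definition smooth_manifold :: "('m::t2_space, 'n::finite) chart set \<Rightarrow> bool" where
  "smooth_manifold \<A> \<longleftrightarrow> smooth_structure \<A> \<and> paracompact_space (euclidean :: 'm topology)"


section \<open>Linear connections\<close>

text \<open>A linear connection is given by its components in all charts of an atlas.  The atlas is
  described by an index set \<open>\<A>\<close>, the coordinate images \<open>Ov c c'\<close> under \<open>c\<close> of the overlaps, and
  the transition maps \<open>T c c'\<close>.  The value \<open>G c x i j k\<close> is the component with upper index \<open>i\<close>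
  and lower indices \<open>j, k\<close> in the chart \<open>c\<close> at the coordinate point \<open>x\<close>.\<close>

definition linear_connection ::
  "'c set \<Rightarrow> ('c \<Rightarrow> 'c \<Rightarrow> (real^'k::finite) set) \<Rightarrow> ('c \<Rightarrow> 'c \<Rightarrow> real^'k \<Rightarrow> real^'k) \<Rightarrow>
   ('c \<Rightarrow> real^'k \<Rightarrow> 'k \<Rightarrow> 'k \<Rightarrow> 'k \<Rightarrow> real) \<Rightarrow> bool" where
  "linear_connection \<A> Ov T G \<longleftrightarrow>
     (\<forall>c\<in>\<A>. \<forall>i j k. smooth_on (Ov c c) (\<lambda>x. G c x i j k)) \<and>
     (\<forall>c\<in>\<A>. \<forall>c'\<in>\<A>. \<forall>x\<in>Ov c c'. \<forall>i j k. let y = T c c' x; S = T c' c in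
        G c' y i j k =
          (\<Sum>l\<in>UNIV. partial l (\<lambda>z. T c c' z $ i) x *
             ((\<Sum>a\<in>UNIV. \<Sum>b\<in>UNIV.
                 partial j (\<lambda>z. S z $ a) y * partial k (\<lambda>z. S z $ b) y * G c x l a b) +
              partial j (\<lambda>w. partial k (\<lambda>z. S z $ l) w) y)))"

definition torsion_free ::
  "'c set \<Rightarrow> ('c \<Rightarrow> 'c \<Rightarrow> (real^'k::finite) set) \<Rightarrow>
   ('c \<Rightarrow> real^'k \<Rightarrow> 'k \<Rightarrow> 'k \<Rightarrow> 'k \<Rightarrow> real) \<Rightarrow> bool" where
  "torsion_free \<A> Ov G \<longleftrightarrow> (\<forall>c\<in>\<A>. \<forall>x\<in>Ov c c. \<forall>i j k. G c x i j k = G c x i k j)"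

definition symmetric_connection_on ::
  "('m, 'n::finite) chart set \<Rightarrow> (('m, 'n) chart \<Rightarrow> real^'n \<Rightarrow> 'n \<Rightarrow> 'n \<Rightarrow> 'n \<Rightarrow> real) \<Rightarrow> bool" where
  "symmetric_connection_on \<A> \<Gamma> \<longleftrightarrow>
     linear_connection \<A> overlap trans_map \<Gamma> \<and> torsion_free \<A> overlap \<Gamma>"


section \<open>The cotangent bundle in proper Darboux charts\<close>

text \<open>Coordinates on the cotangent bundle are indexed by \<open>'n + 'n\<close>: \<open>Inl \<alpha>\<close> stands for the index
  \<open>\<alpha>\<close> of \<open>q\<^sup>\<alpha>\<close>, and \<open>Inr \<alpha>\<close> for the index \<open>n + \<alpha>\<close> of \<open>p\<^sub>\<alpha>\<close>.  A chart of the base and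
  the proper Darboux chart induced by it are denoted by the same \<open>c\<close>.\<close>

type_synonym 'n phase = "real^('n + 'n)"

definition qpart :: "'n::finite phase \<Rightarrow> real^'n" where
  "qpart x = (\<chi> \<alpha>. x $ Inl \<alpha>)"

definition darboux_dom :: "('m, 'n::finite) chart \<Rightarrow> 'n phase set" where
  "darboux_dom c = {x. qpart x \<in> snd c ` fst c}"

text \<open>The point transformation given by \<open>Q\<close> with inverse \<open>R\<close>: new positions \<open>Q(q)\<close> and new
  momenta \<open>P\<^sub>\<beta> = (\<partial>q\<^sup>l/\<partial>Q\<^sup>\<beta>) p\<^sub>l\<close>.\<close>

definition point_transf :: "(real^'n::finite \<Rightarrow> real^'n) \<Rightarrow> (real^'n \<Rightarrow> real^'n) \<Rightarrow>
    'n phase \<Rightarrow> 'n phase" where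
  "point_transf Q R x = (\<chi> i. case i of
      Inl \<alpha> \<Rightarrow> Q (qpart x) $ \<alpha>
    | Inr \<beta> \<Rightarrow> (\<Sum>l\<in>UNIV. partial \<beta> (\<lambda>z. R z $ l) (Q (qpart x)) * x $ Inr l))"

definition darboux_overlap :: "('m, 'n::finite) chart \<Rightarrow> ('m, 'n) chart \<Rightarrow> 'n phase set" where
  "darboux_overlap c c' = {x. qpart x \<in> overlap c c'}"

definition darboux_trans :: "('m, 'n::finite) chart \<Rightarrow> ('m, 'n) chart \<Rightarrow> 'n phase \<Rightarrow> 'n phase" where
  "darboux_trans c c' = point_transf (trans_map c c') (trans_map c' c)"

text \<open>Components of \<open>\<omega> = dq\<^sup>\<alpha> \<and> dp\<^sub>\<alpha> = 1/2 \<omega>\<^sub>i\<^sub>j dx\<^sup>i \<and> dx\<^sup>j\<close>.\<close>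

fun omega :: "'n + 'n \<Rightarrow> 'n + 'n \<Rightarrow> real" where
  "omega (Inl \<alpha>) (Inr \<beta>) = (if \<alpha> = \<beta> then 1 else 0)"
| "omega (Inr \<alpha>) (Inl \<beta>) = (if \<alpha> = \<beta> then - 1 else 0)"
| "omega (Inl \<alpha>) (Inl \<beta>) = 0"
| "omega (Inr \<alpha>) (Inr \<beta>) = 0"

text \<open>The inverse \<open>\<omega>\<^sup>i\<^sup>j\<close> is fixed by \<open>\<omega>\<^sub>k\<^sub>l \<omega>\<^sup>l\<^sup>j = \<delta>\<^sub>k\<^sup>j\<close>; hence the component with upper
  indices \<open>q\<^sup>\<alpha>, p\<^sub>\<alpha>\<close> is \<open>-1\<close>.  This sign, together with the factor \<open>-i\<hbar>/2\<close> in the product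
  of the Weyl bundle, gives \<open>-i\<hbar> \<cdot> (-1) = +i\<hbar>\<close> for the bracket of \<open>q\<^sup>\<alpha>\<close> and \<open>p\<^sub>\<alpha>\<close>; the
  value \<open>-i\<hbar>\<close> is incompatible with these conventions.\<close>

definition omega_inv :: "'n + 'n \<Rightarrow> 'n + 'n \<Rightarrow> real" where
  "omega_inv i j = - omega i j"

lemma omega_omega_inv:
  fixes k j :: "'n::finite + 'n"
  shows "(\<Sum>l\<in>UNIV. omega k l * omega_inv l j) = (if k = j then 1 else 0)"
proof -
  have split: "(\<Sum>l\<in>UNIV. omega k l * omega_inv l j) =
      (\<Sum>l\<in>UNIV. omega k (Inl l) * omega_inv (Inl l) j) +
      (\<Sum>l\<in>UNIV. omega k (Inr l) * omega_inv (Inr l) j)"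
    unfolding UNIV_Plus_UNIV[symmetric] by (subst sum.Plus) (simp_all add: comp_def)
  have delta: "(\<Sum>l\<in>UNIV. (if a = l then 1 else 0) * (if l = b then 1 else 0)) =
      (if a = b then 1 else (0::real))" for a b :: 'n
  proof -
    have "(\<Sum>l\<in>UNIV. (if a = l then 1 else 0) * (if l = b then 1 else 0)) =
        (\<Sum>l\<in>UNIV. if a = l then (if a = b then 1 else (0::real)) else 0)"
      by (rule sum.cong) auto
    then show ?thesis by simp
  qed
  have neg: "(if P then - 1 else 0) = - (if P then 1 else (0::real))" for P
    by simp
  show ?thesis
    unfolding split
    by (cases k; cases j)
      (simp_all only: omega_inv_def omega.simps neg minus_minus mult_minus_left mult_minus_right
        mult_zero_left mult_zero_right sum.neutral_const delta minus_zero add_0_left add_0_right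
        sum.inject simp_thms sum.distinct if_False)
qed

text \<open>\<open>\<gamma>\<^sub>i\<^sub>j\<^sub>k = \<omega>\<^sub>i\<^sub>l \<gamma>\<^sup>l\<^sub>j\<^sub>k\<close>\<close>

definition lower :: "('n::finite phase \<Rightarrow> 'n + 'n \<Rightarrow> 'n + 'n \<Rightarrow> 'n + 'n \<Rightarrow> real) \<Rightarrow>
    'n phase \<Rightarrow> 'n + 'n \<Rightarrow> 'n + 'n \<Rightarrow> 'n + 'n \<Rightarrow> real" where
  "lower G x i j k = (\<Sum>l\<in>UNIV. omega i l * G x l j k)"

text \<open>The last conjunct is \<open>\<nabla>\<^sub>k \<omega>\<^sub>i\<^sub>j = 0\<close>.\<close>

definition symplectic_connection ::
  "('m, 'n::finite) chart set \<Rightarrow>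
   (('m, 'n) chart \<Rightarrow> 'n phase \<Rightarrow> 'n + 'n \<Rightarrow> 'n + 'n \<Rightarrow> 'n + 'n \<Rightarrow> real) \<Rightarrow> bool" where
  "symplectic_connection \<A> \<gamma> \<longleftrightarrow>
     linear_connection \<A> darboux_overlap darboux_trans \<gamma> \<and>
     torsion_free \<A> darboux_overlap \<gamma> \<and>
     (\<forall>c\<in>\<A>. \<forall>x\<in>darboux_dom c. \<forall>i j k.
        partial k (\<lambda>z. omega i j) x - (\<Sum>l\<in>UNIV. \<gamma> c x l i k * omega l j)
          - (\<Sum>l\<in>UNIV. \<gamma> c x l j k * omega i l) = 0)"

definition compatible_connection ::
  "('m, 'n::finite) chart set \<Rightarrow> (('m, 'n) chart \<Rightarrow> real^'n \<Rightarrow> 'n \<Rightarrow> 'n \<Rightarrow> 'n \<Rightarrow> real) \<Rightarrow>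
   (('m, 'n) chart \<Rightarrow> 'n phase \<Rightarrow> 'n + 'n \<Rightarrow> 'n + 'n \<Rightarrow> 'n + 'n \<Rightarrow> real) \<Rightarrow> bool" where
  "compatible_connection \<A> \<Gamma> \<gamma> \<longleftrightarrow> (\<forall>c\<in>\<A>.
     (\<forall>x\<in>darboux_dom c. \<forall>\<mu> \<nu> \<kappa>. lower (\<gamma> c) x (Inr \<mu>) (Inr \<nu>) (Inr \<kappa>) = 0) \<and>
     (\<forall>x\<in>darboux_dom c. \<forall>\<mu> \<nu> \<alpha>. lower (\<gamma> c) x (Inr \<mu>) (Inr \<nu>) (Inl \<alpha>) = 0) \<and>
     (\<forall>x\<in>darboux_dom c. \<forall>\<mu> \<alpha> \<beta>.
        lower (\<gamma> c) x (Inr \<mu>) (Inl \<alpha>) (Inl \<beta>) = - \<Gamma> c (qpart x) \<mu> \<alpha> \<beta>) \<and>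
     (\<exists>f. (\<forall>\<epsilon> \<alpha> \<beta> \<delta>. smooth_on (snd c ` fst c) (\<lambda>q. f q \<epsilon> \<alpha> \<beta> \<delta>)) \<and>
          (\<forall>x\<in>darboux_dom c. \<forall>\<alpha> \<beta> \<delta>.
             lower (\<gamma> c) x (Inl \<alpha>) (Inl \<beta>) (Inl \<delta>) =
               (\<Sum>\<epsilon>\<in>UNIV. x $ Inr \<epsilon> * f (qpart x) \<epsilon> \<alpha> \<beta> \<delta>))))"


section \<open>The Weyl bundle over a proper Darboux chart\<close>

text \<open>A formal series is represented by its coefficients: \<open>a k J x\<close> is the coefficient, at the
  point \<open>x\<close>, of \<open>\<hbar>\<^sup>k\<close> times the monomial \<open>y\<^sup>J\<close>, the product of the \<open>y\<^sup>j\<close> over the multiset \<open>J\<close>.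
  It equals the tensor component \<open>a\<^sub>k\<^sub>,\<^sub>J\<close> times the number of distinct orderings of \<open>J\<close>.\<close>

type_synonym 'n weyl = "nat \<Rightarrow> ('n + 'n) multiset \<Rightarrow> 'n phase \<Rightarrow> complex"

text \<open>A 1-form \<open>A\<^sub>k dx\<^sup>k\<close> is the family \<open>A k\<close>, a 2-form \<open>1/2 B\<^sub>k\<^sub>l dx\<^sup>k \<and> dx\<^sup>l\<close> is the
  antisymmetric family \<open>B k l\<close>.\<close>

type_synonym 'n weyl1 = "'n + 'n \<Rightarrow> 'n weyl"
type_synonym 'n weyl2 = "'n + 'n \<Rightarrow> 'n + 'n \<Rightarrow> 'n weyl"

text \<open>Sections over \<open>D\<close> are set to 0 outside \<open>D\<close> to make them unique as functions.\<close>

definition weyl_section :: "'n::finite phase set \<Rightarrow> 'n weyl \<Rightarrow> bool" where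
  "weyl_section D a \<longleftrightarrow> (\<forall>k J. smooth_on D (a k J) \<and> (\<forall>x. x \<notin> D \<longrightarrow> a k J x = 0))"

definition weyl_eq_on :: "'n phase set \<Rightarrow> 'n weyl \<Rightarrow> 'n weyl \<Rightarrow> bool" where
  "weyl_eq_on D a b \<longleftrightarrow> (\<forall>k J. \<forall>x\<in>D. a k J x = b k J x)"

definition deriv_y :: "'n + 'n \<Rightarrow> 'n weyl \<Rightarrow> 'n weyl" where
  "deriv_y i a = (\<lambda>k J x. of_nat (Suc (count J i)) * a k (add_mset i J) x)"

definition deriv_x :: "'n::finite + 'n \<Rightarrow> 'n weyl \<Rightarrow> 'n weyl" where
  "deriv_x i a = (\<lambda>k J. partial i (a k J))"

definition mult_y :: "'n + 'n \<Rightarrow> 'n weyl \<Rightarrow> 'n weyl" where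
  "mult_y i a = (\<lambda>k J x. if i \<in># J then a k (J - {#i#}) x else 0)"

definition pointwise_mult :: "'n weyl \<Rightarrow> 'n weyl \<Rightarrow> 'n weyl" where
  "pointwise_mult a b =
     (\<lambda>k J x. \<Sum>m\<le>k. \<Sum>L\<in>{L. L \<subseteq># J}. a m L x * b (k - m) (J - L) x)"

text \<open>\<open>bidiff t a b\<close> is \<open>\<omega>\<^sup>i\<^sup>1\<^sup>j\<^sup>1 \<dots> \<omega>\<^sup>i\<^sup>t\<^sup>j\<^sup>t\<close> times the product of the \<open>t\<close>-fold
  derivatives of \<open>a\<close> and \<open>b\<close>, summed over all indices.\<close>

primrec bidiff :: "nat \<Rightarrow> 'n::finite weyl \<Rightarrow> 'n weyl \<Rightarrow> 'n weyl" where
  "bidiff 0 a b = pointwise_mult a b"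
| "bidiff (Suc t) a b = (\<lambda>k J x. \<Sum>i\<in>UNIV. \<Sum>j\<in>UNIV.
     complex_of_real (omega_inv i j) * bidiff t (deriv_y i a) (deriv_y j b) k J x)"

definition weyl_prod :: "'n::finite weyl \<Rightarrow> 'n weyl \<Rightarrow> 'n weyl" where
  "weyl_prod a b =
     (\<lambda>k J x. \<Sum>t\<le>k. (- \<i> / 2) ^ t / fact t * bidiff t a b (k - t) J x)"

text \<open>Multiplication by \<open>i/\<hbar>\<close>; applied only to series without \<open>\<hbar>\<^sup>0\<close> term.\<close>

definition i_over_hbar :: "'n weyl \<Rightarrow> 'n weyl" where
  "i_over_hbar a = (\<lambda>k J x. \<i> * a (Suc k) J x)"

text \<open>Product of two 1-forms, graded commutator of two 1-forms, and commutator of a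
  1-form with a 0-form.\<close>

definition prod11 :: "'n::finite weyl1 \<Rightarrow> 'n weyl1 \<Rightarrow> 'n weyl2" where
  "prod11 A B = (\<lambda>k l. weyl_prod (A k) (B l) - weyl_prod (A l) (B k))"

definition comm11 :: "'n::finite weyl1 \<Rightarrow> 'n weyl1 \<Rightarrow> 'n weyl2" where
  "comm11 A B = (\<lambda>k l. prod11 A B k l + prod11 B A k l)"

definition comm10 :: "'n::finite weyl1 \<Rightarrow> 'n weyl \<Rightarrow> 'n weyl1" where
  "comm10 A a = (\<lambda>k. weyl_prod (A k) a - weyl_prod a (A k))"

definition ext_d0 :: "'n::finite weyl \<Rightarrow> 'n weyl1" where
  "ext_d0 a = (\<lambda>k. deriv_x k a)"

definition ext_d1 :: "'n::finite weyl1 \<Rightarrow> 'n weyl2" where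
  "ext_d1 A = (\<lambda>k l. deriv_x k (A l) - deriv_x l (A k))"

definition delta1 :: "'n weyl1 \<Rightarrow> 'n weyl2" where
  "delta1 A = (\<lambda>k l. deriv_y k (A l) - deriv_y l (A k))"

text \<open>\<open>\<delta>\<^sup>-\<^sup>1\<close> on 1-forms: a part of degree \<open>l\<close> in \<open>y\<close> is contracted with \<open>y\<^sup>k\<close> and divided by
  \<open>l + 1\<close>, which is the degree of the result.\<close>

definition delta_inv1 :: "'n::finite weyl1 \<Rightarrow> 'n weyl" where
  "delta_inv1 A = (\<lambda>k J x. (\<Sum>i\<in>UNIV. mult_y i (A i) k J x) / of_nat (size J))"

text \<open>The 1-form \<open>1/2 \<gamma>\<^sub>i\<^sub>j\<^sub>k y\<^sup>i y\<^sup>j dx\<^sup>k\<close>.\<close>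

definition gamma_form :: "('n::finite phase \<Rightarrow> 'n + 'n \<Rightarrow> 'n + 'n \<Rightarrow> 'n + 'n \<Rightarrow> real) \<Rightarrow>
    'n weyl1" where
  "gamma_form G = (\<lambda>l k J x. if k = 0 then
     (\<Sum>i\<in>UNIV. \<Sum>j\<in>UNIV. if J = {#i, j#} then complex_of_real (lower G x i j l / 2) else 0)
     else 0)"

text \<open>The 1-form \<open>\<omega>\<^sub>i\<^sub>j y\<^sup>i dx\<^sup>j\<close>.\<close>

definition omega_form :: "'n::finite weyl1" where
  "omega_form = (\<lambda>j k J x. if k = 0 then
     (\<Sum>i\<in>UNIV. if J = {#i#} then complex_of_real (omega i j) else 0) else 0)"


section \<open>Fedosov's construction\<close>

text \<open>In this section \<open>G\<close> are the components of the symplectic connection in a fixed proper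
  Darboux chart and \<open>D\<close> is its coordinate domain.\<close>

definition curvature_form :: "('n::finite phase \<Rightarrow> 'n + 'n \<Rightarrow> 'n + 'n \<Rightarrow> 'n + 'n \<Rightarrow> real) \<Rightarrow>
    'n weyl2" where
  "curvature_form G = (\<lambda>k l. ext_d1 (gamma_form G) k l +
     i_over_hbar (prod11 (gamma_form G) (gamma_form G) k l))"

definition cov_d1 :: "('n::finite phase \<Rightarrow> 'n + 'n \<Rightarrow> 'n + 'n \<Rightarrow> 'n + 'n \<Rightarrow> real) \<Rightarrow>
    'n weyl1 \<Rightarrow> 'n weyl2" where
  "cov_d1 G A = (\<lambda>k l. ext_d1 A k l + i_over_hbar (comm11 (gamma_form G) A k l))"

definition is_abelian_series :: "'n::finite phase set \<Rightarrow>
    ('n phase \<Rightarrow> 'n + 'n \<Rightarrow> 'n + 'n \<Rightarrow> 'n + 'n \<Rightarrow> real) \<Rightarrow> 'n weyl1 \<Rightarrow> bool" where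
  "is_abelian_series D G r \<longleftrightarrow>
     (\<forall>k. weyl_section D (r k)) \<and>
     (\<forall>k l. weyl_eq_on D (delta1 r k l)
        (curvature_form G k l + cov_d1 G r k l + i_over_hbar (prod11 r r k l))) \<and>
     weyl_eq_on D (delta_inv1 r) 0 \<and>
     (\<forall>l k J. 2 * k + size J < 3 \<longrightarrow> (\<forall>x\<in>D. r l k J x = 0))"

definition abelian_series :: "'n::finite phase set \<Rightarrow>
    ('n phase \<Rightarrow> 'n + 'n \<Rightarrow> 'n + 'n \<Rightarrow> 'n + 'n \<Rightarrow> real) \<Rightarrow> 'n weyl1" where
  "abelian_series D G = (THE r. is_abelian_series D G r)"

definition abelian_connection :: "'n::finite phase set \<Rightarrow>
    ('n phase \<Rightarrow> 'n + 'n \<Rightarrow> 'n + 'n \<Rightarrow> 'n + 'n \<Rightarrow> real) \<Rightarrow> 'n weyl1" where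
  "abelian_connection D G = (\<lambda>k. omega_form k + gamma_form G k + abelian_series D G k)"

definition flat_section :: "'n::finite phase set \<Rightarrow>
    ('n phase \<Rightarrow> 'n + 'n \<Rightarrow> 'n + 'n \<Rightarrow> 'n + 'n \<Rightarrow> real) \<Rightarrow> 'n weyl \<Rightarrow> bool" where
  "flat_section D G a \<longleftrightarrow> weyl_section D a \<and>
     (\<forall>k. weyl_eq_on D (ext_d0 a k + i_over_hbar (comm10 (abelian_connection D G) a k)) 0)"

text \<open>\<open>\<sigma>(a)\<close>, the value at \<open>y = 0\<close>, as a formal power series in \<open>\<hbar>\<close>.\<close>

definition weyl_symbol :: "'n weyl \<Rightarrow> 'n phase \<Rightarrow> complex fps" where
  "weyl_symbol a x = Abs_fps (\<lambda>k. a k {#} x)"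

definition flat_lift :: "'n::finite phase set \<Rightarrow>
    ('n phase \<Rightarrow> 'n + 'n \<Rightarrow> 'n + 'n \<Rightarrow> 'n + 'n \<Rightarrow> real) \<Rightarrow> ('n phase \<Rightarrow> complex) \<Rightarrow> 'n weyl" where
  "flat_lift D G f = (THE a. flat_section D G a \<and> (\<forall>x\<in>D. weyl_symbol a x = fps_const (f x)))"

definition fedosov_star :: "'n::finite phase set \<Rightarrow>
    ('n phase \<Rightarrow> 'n + 'n \<Rightarrow> 'n + 'n \<Rightarrow> 'n + 'n \<Rightarrow> real) \<Rightarrow>
    ('n phase \<Rightarrow> complex) \<Rightarrow> ('n phase \<Rightarrow> complex) \<Rightarrow> 'n phase \<Rightarrow> complex fps" where
  "fedosov_star D G f g = weyl_symbol (weyl_prod (flat_lift D G f) (flat_lift D G g))"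

definition moyal_bracket :: "'n::finite phase set \<Rightarrow>
    ('n phase \<Rightarrow> 'n + 'n \<Rightarrow> 'n + 'n \<Rightarrow> 'n + 'n \<Rightarrow> real) \<Rightarrow>
    ('n phase \<Rightarrow> complex) \<Rightarrow> ('n phase \<Rightarrow> complex) \<Rightarrow> 'n phase \<Rightarrow> complex fps" where
  "moyal_bracket D G f g = (\<lambda>x. fedosov_star D G f g x - fedosov_star D G g f x)"

abbreviation hbar :: "complex fps" where
  "hbar \<equiv> fps_X"

text \<open>The canonical variables determined by a map \<open>X\<close> into phase space; for \<open>X = id\<close> these are the
  coordinates \<open>q\<^sup>\<alpha>\<close> and \<open>p\<^sub>\<alpha>\<close> themselves.\<close>

definition pos_var :: "('n::finite phase \<Rightarrow> 'n phase) \<Rightarrow> 'n \<Rightarrow> 'n phase \<Rightarrow> complex" where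
  "pos_var X \<alpha> = (\<lambda>x. complex_of_real (X x $ Inl \<alpha>))"

definition mom_var :: "('n::finite phase \<Rightarrow> 'n phase) \<Rightarrow> 'n \<Rightarrow> 'n phase \<Rightarrow> complex" where
  "mom_var X \<alpha> = (\<lambda>x. complex_of_real (X x $ Inr \<alpha>))"

end

(*
  For a compatible connection, gamma and all that is built from it have degree at most one in the
  momenta p and their fibre counterparts together. On elements of degree at most one the bracket
  (i/hbar)[a,b] is the fibrewise Poisson bracket: even orders of the Weyl product are symmetric, and
  orders from three on differentiate one of the factors twice in momentum directions. Hence the
  Abelian connection series and the lifts of q and p solve the classical (Poisson) form of Fedosov's
  equations; they contain no hbar. The classical equations are solved by recursion on the degree in
  y; that the solution of the recursion has zero curvature follows from the Bianchi identity and
  delta delta^-1 + delta^-1 delta = id on the lowest homogeneous part. The Moyal bracket of two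
  functions of degree at most one is then i hbar times their Poisson bracket, and point
  transformations preserve both the degree and the Poisson bracket.
*)
theory Submission
  imports Defs
begin

section \<open>Smooth maps\<close>

text \<open>Compatibility has to be used component by component. If all components of the connection
  form were only known to be affine in the momenta, the contraction with y^k in Fedosov's recursion
  would create quadratic terms as soon as y^k is a momentum coordinate. The conditions give more: a
  component whose form index is a momentum index is free of momenta. A curvature component with
  indices k, l then has degree below \<open>wt k + wt l\<close>, and contraction with y^k restores
  exactly the bound for the index l. So the recursion stays in the class on which the commutator is
  a Poisson bracket. \<open>abelian_series\<close> and \<open>flat_lift\<close> are definite
  descriptions, so a classical solution is their value only after uniqueness among all series in
  hbar. That induction runs on 2k + l, whose lower bounds survive (i/hbar)[a, .] once a has degree
  at least two. At y = 0 the bracket of two lifts involves only their linear parts, and these are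
  the differentials of the two functions.\<close>

lemma Ck_on_Suc_derivative:
  "Ck_on (Suc k) S f \<Longrightarrow> x \<in> S \<Longrightarrow> (f has_derivative frechet_derivative f (at x)) (at x)"
  by (simp add: frechet_derivative_works[symmetric])

lemma Ck_on_cong:
  "open S \<Longrightarrow> (\<And>x. x \<in> S \<Longrightarrow> f x = g x) \<Longrightarrow> Ck_on k S f \<Longrightarrow> Ck_on k S g"
proof (induction k arbitrary: f g)
  case 0
  then show ?case by (simp cong: continuous_on_cong)
next
  case (Suc k)
  have d: "(g has_derivative frechet_derivative f (at x)) (at x)" if "x \<in> S" for x
    using has_derivative_transform_within_open[OF Ck_on_Suc_derivative[OF Suc.prems(3) that]
      Suc.prems(1) that] Suc.prems(2) by blast
  have "Ck_on k S (\<lambda>x. frechet_derivative g (at x) v)" for v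
  proof (rule Suc.IH[OF Suc.prems(1)])
    show "Ck_on k S (\<lambda>x. frechet_derivative f (at x) v)"
      using Suc.prems(3) by simp
  qed (simp add: frechet_derivative_at[OF d])
  with d show ?case by (auto simp: differentiable_def)
qed

text \<open>Differentiation rules produce an explicit derivative \<open>F x\<close>, whereas
  \<open>Ck_on\<close> speaks of \<open>frechet_derivative\<close>; uniqueness of the derivative
  identifies them on \<open>S\<close>. The closure proofs below all pass through this rule.\<close>

lemma Ck_on_SucI:
  assumes "open S" "\<And>x. x \<in> S \<Longrightarrow> (f has_derivative F x) (at x)"
    and "\<And>v. Ck_on k S (\<lambda>x. F x v)"
  shows "Ck_on (Suc k) S f"
proof -
  have "Ck_on k S (\<lambda>x. frechet_derivative f (at x) v)" for v
    by (rule Ck_on_cong[OF assms(1) _ assms(3)[of v]]) (simp add: frechet_derivative_at[OF assms(2)])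
  then show ?thesis using assms(2) by (auto simp: differentiable_def)
qed

lemma Ck_on_Suc_imp: "Ck_on (Suc k) S f \<Longrightarrow> Ck_on k S f"
proof (induction k arbitrary: f)
  case 0
  then show ?case
    by (auto intro!: continuous_at_imp_continuous_on differentiable_imp_continuous_within)
next
  case (Suc k)
  have "\<forall>x\<in>S. f differentiable (at x)" "Ck_on (Suc k) S (\<lambda>x. frechet_derivative f (at x) v)" for v
    using Suc.prems by (auto simp only: Ck_on.simps(2)[of "Suc k"])
  with Suc.IH show ?case by (subst Ck_on.simps(2)) blast
qed

lemma Ck_on_const: "open S \<Longrightarrow> Ck_on k S (\<lambda>x. c)"
proof (induction k arbitrary: c)
  case (Suc k)
  then show ?case by (intro Ck_on_SucI[where F = "\<lambda>x v. 0"]) auto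
qed simp

lemma Ck_on_add: "open S \<Longrightarrow> Ck_on k S f \<Longrightarrow> Ck_on k S g \<Longrightarrow> Ck_on k S (\<lambda>x. f x + g x)"
proof (induction k arbitrary: f g)
  case 0
  then show ?case by (simp add: continuous_on_add)
next
  case (Suc k)
  show ?case
  proof (rule Ck_on_SucI[OF Suc.prems(1)])
    show "((\<lambda>x. f x + g x) has_derivative
        (\<lambda>v. frechet_derivative f (at x) v + frechet_derivative g (at x) v)) (at x)"
      if "x \<in> S" for x
      by (intro has_derivative_add Ck_on_Suc_derivative[OF Suc.prems(2) that]
          Ck_on_Suc_derivative[OF Suc.prems(3) that])
    show "Ck_on k S (\<lambda>x. frechet_derivative f (at x) v + frechet_derivative g (at x) v)" for v
      using Suc by simp
  qed
qed

lemma Ck_on_linear: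
  assumes "bounded_linear h"
  shows "open S \<Longrightarrow> Ck_on k S f \<Longrightarrow> Ck_on k S (\<lambda>x. h (f x))"
proof (induction k arbitrary: f)
  case 0
  then show ?case
    by (simp add: bounded_linear.continuous_on[OF assms])
next
  case (Suc k)
  show ?case
  proof (rule Ck_on_SucI[OF Suc.prems(1)])
    show "((\<lambda>x. h (f x)) has_derivative (\<lambda>v. h (frechet_derivative f (at x) v))) (at x)"
      if "x \<in> S" for x
      by (intro bounded_linear.has_derivative[OF assms] Ck_on_Suc_derivative[OF Suc.prems(2) that])
    show "Ck_on k S (\<lambda>x. h (frechet_derivative f (at x) v))" for v
      using Suc by simp
  qed
qed

lemma Ck_on_bilinear:
  assumes "bounded_bilinear B"
  shows "open S \<Longrightarrow> Ck_on k S f \<Longrightarrow> Ck_on k S g \<Longrightarrow> Ck_on k S (\<lambda>x. B (f x) (g x))"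
proof (induction k arbitrary: f g)
  case 0
  then show ?case
    by (simp add: bounded_bilinear.continuous_on[OF assms])
next
  case (Suc k)
  show ?case
  proof (rule Ck_on_SucI[OF Suc.prems(1)])
    show "((\<lambda>x. B (f x) (g x)) has_derivative
        (\<lambda>v. B (f x) (frechet_derivative g (at x) v) + B (frechet_derivative f (at x) v) (g x))) (at x)"
      if "x \<in> S" for x
      by (intro bounded_bilinear.FDERIV[OF assms] Ck_on_Suc_derivative[OF Suc.prems(2) that]
          Ck_on_Suc_derivative[OF Suc.prems(3) that])
    show "Ck_on k S (\<lambda>x. B (f x) (frechet_derivative g (at x) v) +
        B (frechet_derivative f (at x) v) (g x))" for v
      using Suc.prems by (intro Ck_on_add Suc.IH Suc.prems(1) Ck_on_Suc_imp[OF Suc.prems(2)]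
          Ck_on_Suc_imp[OF Suc.prems(3)]) auto
  qed
qed

lemma Ck_on_sum:
  "open S \<Longrightarrow> (\<And>i. i \<in> I \<Longrightarrow> Ck_on k S (f i)) \<Longrightarrow> Ck_on k S (\<lambda>x. \<Sum>i\<in>I. f i x)"
  by (induction I rule: infinite_finite_induct) (auto intro!: Ck_on_const Ck_on_add)

text \<open>The inner derivative is \<open>L\<close> everywhere, so the derivative in direction
  \<open>v\<close> is again a function composed with \<open>L\<close>, namely the derivative of
  \<open>f\<close> in the fixed direction \<open>L v\<close>. The induction closes without a basis
  expansion.\<close>

lemma Ck_on_compose_linear:
  assumes "bounded_linear L"
  shows "open V \<Longrightarrow> Ck_on k V f \<Longrightarrow> Ck_on k (L -` V) (\<lambda>x. f (L x))"
proof (induction k arbitrary: f)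
  case 0
  show ?case
    using 0 by (auto intro!: continuous_on_compose2[OF _ linear_continuous_on[OF assms]])
next
  case (Suc k)
  have op: "open (L -` V)"
    by (rule open_vimage[OF Suc.prems(1) linear_continuous_on[OF assms]])
  show ?case
  proof (rule Ck_on_SucI[OF op])
    show "((\<lambda>x. f (L x)) has_derivative (\<lambda>v. frechet_derivative f (at (L x)) (L v))) (at x)"
      if "x \<in> L -` V" for x
      using that
      by (intro has_derivative_compose[OF bounded_linear_imp_has_derivative[OF assms]]
          Ck_on_Suc_derivative[OF Suc.prems(2)]) auto
    show "Ck_on k (L -` V) (\<lambda>x. frechet_derivative f (at (L x)) (L v))" for v
      using Suc by auto
  qed
qed

text \<open>The direction in which \<open>f\<close> is differentiated moves with \<open>x\<close>.
  Expanding it in a basis leaves derivatives of \<open>f\<close> in fixed directions, to which the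
  induction hypothesis applies, times components of the derivative of \<open>Q\<close>.\<close>

lemma Ck_on_compose:
  fixes Q :: "'a::real_normed_vector \<Rightarrow> 'b::euclidean_space"
    and f :: "'b \<Rightarrow> 'c::real_normed_vector"
  shows "open V \<Longrightarrow> open S \<Longrightarrow> Q ` S \<subseteq> V \<Longrightarrow> Ck_on k S Q \<Longrightarrow> Ck_on k V f \<Longrightarrow>
    Ck_on k S (\<lambda>x. f (Q x))"
proof (induction k arbitrary: f)
  case 0
  then show ?case by (auto intro: continuous_on_compose2)
next
  case (Suc k)
  let ?F = "\<lambda>x v. \<Sum>b\<in>Basis. (frechet_derivative Q (at x) v \<bullet> b) *\<^sub>R frechet_derivative f (at (Q x)) b"
  show ?case
  proof (rule Ck_on_SucI[OF Suc.prems(2), where F = ?F])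
    fix x assume x: "x \<in> S"
    then have Qx: "Q x \<in> V" using Suc.prems(3) by auto
    let ?f = "frechet_derivative f (at (Q x))" and ?q = "frechet_derivative Q (at x)"
    have lin: "linear ?f"
      using Suc.prems(5) Qx by (auto intro: linear_frechet_derivative)
    have "?f (?q v) = ?F x v" for v
    proof -
      have "?f (?q v) = ?f (\<Sum>b\<in>Basis. (?q v \<bullet> b) *\<^sub>R b)" by (simp add: euclidean_representation)
      also have "\<dots> = ?F x v" by (simp add: linear_sum[OF lin] linear_scale[OF lin])
      finally show ?thesis .
    qed
    moreover have "((\<lambda>x. f (Q x)) has_derivative (\<lambda>v. ?f (?q v))) (at x)"
      by (rule has_derivative_compose[OF Ck_on_Suc_derivative[OF Suc.prems(4) x]
          Ck_on_Suc_derivative[OF Suc.prems(5) Qx]])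
    ultimately show "((\<lambda>x. f (Q x)) has_derivative ?F x) (at x)" by simp
  next
    fix v
    show "Ck_on k S (\<lambda>x. ?F x v)"
      using Suc.prems
      by (intro Ck_on_sum Ck_on_bilinear[OF bounded_bilinear_scaleR] Suc.IH
          Ck_on_linear[OF bounded_linear_inner_left] Ck_on_Suc_imp[OF Suc.prems(4)]) auto
  qed
qed

section \<open>Smooth functions on an open set\<close>

lemma smooth_on_cong: "open S \<Longrightarrow> (\<And>x. x \<in> S \<Longrightarrow> f x = g x) \<Longrightarrow> smooth_on S f \<Longrightarrow> smooth_on S g"
  unfolding smooth_on_def using Ck_on_cong by blast

lemma smooth_on_const: "open S \<Longrightarrow> smooth_on S (\<lambda>x. c)"
  by (simp add: smooth_on_def Ck_on_const)

lemma smooth_on_add: "open S \<Longrightarrow> smooth_on S f \<Longrightarrow> smooth_on S g \<Longrightarrow> smooth_on S (\<lambda>x. f x + g x)"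
  by (simp add: smooth_on_def Ck_on_add)

lemma smooth_on_linear:
  "bounded_linear h \<Longrightarrow> open S \<Longrightarrow> smooth_on S f \<Longrightarrow> smooth_on S (\<lambda>x. h (f x))"
  by (simp add: smooth_on_def Ck_on_linear)

lemma smooth_on_mult:
  fixes f g :: "'a::real_normed_vector \<Rightarrow> 'b::real_normed_algebra"
  shows "open S \<Longrightarrow> smooth_on S f \<Longrightarrow> smooth_on S g \<Longrightarrow> smooth_on S (\<lambda>x. f x * g x)"
  by (simp add: smooth_on_def Ck_on_bilinear[OF bounded_bilinear_mult])

lemma smooth_on_sum:
  "open S \<Longrightarrow> (\<And>i. i \<in> I \<Longrightarrow> smooth_on S (f i)) \<Longrightarrow> smooth_on S (\<lambda>x. \<Sum>i\<in>I. f i x)"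
  by (simp add: smooth_on_def Ck_on_sum)

lemma smooth_on_linear_map:
  assumes "bounded_linear L" "open S" shows "smooth_on S L"
  unfolding smooth_on_def
proof
  fix k
  have "Ck_on k S (\<lambda>x. x)" for k :: nat
  proof (cases k)
    case (Suc m)
    show ?thesis unfolding Suc
      by (rule Ck_on_SucI[OF assms(2), where F = "\<lambda>x v. v"]) (auto intro!: Ck_on_const assms)
  qed simp
  then show "Ck_on k S L" by (rule Ck_on_linear[OF assms])
qed

lemma smooth_on_compose_linear:
  "bounded_linear L \<Longrightarrow> open V \<Longrightarrow> smooth_on V f \<Longrightarrow> smooth_on (L -` V) (\<lambda>x. f (L x))"
  by (simp add: smooth_on_def Ck_on_compose_linear)

lemma smooth_on_compose:
  fixes Q :: "'a::real_normed_vector \<Rightarrow> 'b::euclidean_space"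
  shows "open V \<Longrightarrow> open S \<Longrightarrow> Q ` S \<subseteq> V \<Longrightarrow> smooth_on S Q \<Longrightarrow> smooth_on V f \<Longrightarrow>
    smooth_on S (\<lambda>x. f (Q x))"
  by (simp add: smooth_on_def Ck_on_compose)

lemma smooth_on_has_derivative:
  "smooth_on S f \<Longrightarrow> x \<in> S \<Longrightarrow> (f has_derivative frechet_derivative f (at x)) (at x)"
  unfolding smooth_on_def using Ck_on_Suc_derivative by blast

lemma smooth_on_frechet_derivative:
  "smooth_on S f \<Longrightarrow> smooth_on S (\<lambda>x. frechet_derivative f (at x) v)"
  unfolding smooth_on_def by (metis Ck_on.simps(2))

lemma smooth_on_partial: "smooth_on S f \<Longrightarrow> smooth_on S (partial i f)"
  unfolding partial_def[abs_def] by (rule smooth_on_frechet_derivative)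

lemma smooth_on_continuous: "smooth_on S f \<Longrightarrow> continuous_on S f"
  unfolding smooth_on_def by (metis Ck_on.simps(1))

subsection \<open>Symmetry of second derivatives\<close>

text \<open>The mean value theorem applied twice, along \<open>u\<close> to the difference in
  direction \<open>v\<close> and then along \<open>v\<close> to the derivative in direction
  \<open>u\<close>. The second difference itself is symmetric in \<open>u\<close> and
  \<open>v\<close>, which gives the symmetry of the mixed derivatives.\<close>

lemma second_difference_mvt:
  fixes f :: "'a::real_normed_vector \<Rightarrow> real"
  assumes f: "smooth_on S f" and h: "0 < h"
    and seg: "\<And>s t. 0 \<le> s \<Longrightarrow> s \<le> h \<Longrightarrow> 0 \<le> t \<Longrightarrow> t \<le> h \<Longrightarrow> x + s *\<^sub>R u + t *\<^sub>R v \<in> S"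
  shows "\<exists>s t. 0 < s \<and> s < h \<and> 0 < t \<and> t < h \<and>
    f (x + h *\<^sub>R u + h *\<^sub>R v) - f (x + h *\<^sub>R u) - f (x + h *\<^sub>R v) + f x =
    h * h * frechet_derivative (\<lambda>z. frechet_derivative f (at z) u) (at (x + s *\<^sub>R u + t *\<^sub>R v)) v"
proof -
  let ?g = "\<lambda>z. frechet_derivative f (at z) u"
  have lin: "linear (frechet_derivative f (at z))" if "z \<in> S" for z
    using smooth_on_has_derivative[OF f that] has_derivative_linear by blast
  have lin2: "linear (frechet_derivative ?g (at z))" if "z \<in> S" for z
    using smooth_on_has_derivative[OF smooth_on_frechet_derivative[OF f] that] has_derivative_linear by blast
  have d1: "((\<lambda>s. f (x + s *\<^sub>R u + t *\<^sub>R v)) has_real_derivative ?g (x + s *\<^sub>R u + t *\<^sub>R v)) (at s)"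
    if "0 \<le> s" "s \<le> h" "0 \<le> t" "t \<le> h" for s t
  proof -
    have "((\<lambda>s. f (x + s *\<^sub>R u + t *\<^sub>R v)) has_derivative
        (\<lambda>a. frechet_derivative f (at (x + s *\<^sub>R u + t *\<^sub>R v)) (a *\<^sub>R u))) (at s)"
      by (rule has_derivative_compose[where f = "\<lambda>s. x + s *\<^sub>R u + t *\<^sub>R v" and g = f])
        (auto intro!: derivative_eq_intros smooth_on_has_derivative[OF f] seg that)
    then show ?thesis
      by (simp add: has_field_derivative_def linear_scale[OF lin[OF seg[OF that]]] mult_commute_abs)
  qed
  have d2: "((\<lambda>t. ?g (x + s *\<^sub>R u + t *\<^sub>R v)) has_real_derivative
      frechet_derivative ?g (at (x + s *\<^sub>R u + t *\<^sub>R v)) v) (at t)"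
    if "0 \<le> s" "s \<le> h" "0 \<le> t" "t \<le> h" for s t
  proof -
    have "((\<lambda>t. ?g (x + s *\<^sub>R u + t *\<^sub>R v)) has_derivative
        (\<lambda>a. frechet_derivative ?g (at (x + s *\<^sub>R u + t *\<^sub>R v)) (a *\<^sub>R v))) (at t)"
      by (rule has_derivative_compose[where f = "\<lambda>t. x + s *\<^sub>R u + t *\<^sub>R v" and g = ?g])
        (auto intro!: derivative_eq_intros smooth_on_has_derivative[OF smooth_on_frechet_derivative[OF f]]
          seg that)
    then show ?thesis
      by (simp add: has_field_derivative_def linear_scale[OF lin2[OF seg[OF that]]] mult_commute_abs)
  qed
  have "\<exists>s>0. s < h \<and> (f (x + h *\<^sub>R u + h *\<^sub>R v) - f (x + h *\<^sub>R u + 0 *\<^sub>R v)) -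
      (f (x + 0 *\<^sub>R u + h *\<^sub>R v) - f (x + 0 *\<^sub>R u + 0 *\<^sub>R v)) =
      (h - 0) * (?g (x + s *\<^sub>R u + h *\<^sub>R v) - ?g (x + s *\<^sub>R u + 0 *\<^sub>R v))"
    by (rule MVT2[where f = "\<lambda>s. f (x + s *\<^sub>R u + h *\<^sub>R v) - f (x + s *\<^sub>R u + 0 *\<^sub>R v)", OF h])
      (use h in \<open>auto intro!: DERIV_diff d1[of _ h] d1[of _ 0, simplified]\<close>)
  then obtain s where s: "0 < s" "s < h" and
    eq: "f (x + h *\<^sub>R u + h *\<^sub>R v) - f (x + h *\<^sub>R u) - f (x + h *\<^sub>R v) + f x =
      h * (?g (x + s *\<^sub>R u + h *\<^sub>R v) - ?g (x + s *\<^sub>R u + 0 *\<^sub>R v))"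
    by (auto simp: algebra_simps)
  have "\<exists>t>0. t < h \<and> ?g (x + s *\<^sub>R u + h *\<^sub>R v) - ?g (x + s *\<^sub>R u + 0 *\<^sub>R v) =
      (h - 0) * frechet_derivative ?g (at (x + s *\<^sub>R u + t *\<^sub>R v)) v"
    by (rule MVT2[OF h]) (use s in \<open>auto intro!: d2\<close>)
  then obtain t where t: "0 < t" "t < h" "?g (x + s *\<^sub>R u + h *\<^sub>R v) - ?g (x + s *\<^sub>R u + 0 *\<^sub>R v) =
      h * frechet_derivative ?g (at (x + s *\<^sub>R u + t *\<^sub>R v)) v"
    by auto
  show ?thesis
    using s t(1,2) unfolding eq t(3) mult.assoc by blast
qed

lemma second_derivative_symmetric_real:
  fixes f :: "'a::real_normed_vector \<Rightarrow> real"
  assumes S: "open S" and f: "smooth_on S f" and x: "x \<in> S"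
  shows "frechet_derivative (\<lambda>z. frechet_derivative f (at z) u) (at x) v =
    frechet_derivative (\<lambda>z. frechet_derivative f (at z) v) (at x) u"
proof (rule ccontr)
  let ?H = "\<lambda>u v z. frechet_derivative (\<lambda>z. frechet_derivative f (at z) u) (at z) v"
  assume ne: "\<not> ?thesis"
  \<comment> \<open>Half the gap: no number lies within less than \<open>e\<close> of both mixed
    derivatives, yet the second difference yields a value that does.\<close>
  define e where "e = \<bar>?H u v x - ?H v u x\<bar> / 2"
  have e: "e > 0" using ne by (auto simp: e_def)
  have cont: "isCont (?H u v) x" for u v
    using smooth_on_continuous[OF smooth_on_frechet_derivative[OF smooth_on_frechet_derivative[OF f]]]
      S x continuous_on_eq_continuous_at by blast
  obtain d0 where d0: "d0 > 0" "ball x d0 \<subseteq> S" using S x open_contains_ball by blast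
  obtain d1 where d1: "d1 > 0" "\<And>z. dist z x < d1 \<Longrightarrow> dist (?H u v z) (?H u v x) < e"
    using cont[of u v] e unfolding continuous_at_eps_delta by (metis (no_types, lifting))
  obtain d2 where d2: "d2 > 0" "\<And>z. dist z x < d2 \<Longrightarrow> dist (?H v u z) (?H v u x) < e"
    using cont[of v u] e unfolding continuous_at_eps_delta by (metis (no_types, lifting))
  define d where "d = min d0 (min d1 d2)"
  \<comment> \<open>The parallelogram with sides \<open>h *\<^sub>R u\<close> and
    \<open>h *\<^sub>R v\<close> stays within distance \<open>d\<close> of \<open>x\<close>; the
    \<open>+ 1\<close> keeps the denominator positive when both vectors vanish.\<close>
  define h where "h = d / (2 * (norm u + norm v + 1))"
  have n: "norm u + norm v + 1 > 0" by (smt (verit) norm_ge_zero)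
  have d: "d > 0" using d0 d1 d2 by (simp add: d_def)
  have h: "h > 0" using d n by (simp add: h_def)
  have near: "dist (x + s *\<^sub>R u + t *\<^sub>R v) x < d" if "0 \<le> s" "s \<le> h" "0 \<le> t" "t \<le> h" for s t
  proof -
    have "dist (x + s *\<^sub>R u + t *\<^sub>R v) x = norm (s *\<^sub>R u + t *\<^sub>R v)"
      by (simp add: dist_norm)
    also have "\<dots> \<le> norm (s *\<^sub>R u) + norm (t *\<^sub>R v)" by (rule norm_triangle_ineq)
    also have "\<dots> \<le> h * norm u + h * norm v"
      using that by (intro add_mono) (auto intro: mult_right_mono)
    also have "\<dots> < 2 * (h * (norm u + norm v + 1))" using h
      by (simp add: algebra_simps add_nonneg_pos)
    also have "\<dots> = d" unfolding h_def using n by (simp add: field_simps)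
    finally show ?thesis .
  qed
  have sw: "x + t *\<^sub>R v + s *\<^sub>R u = x + s *\<^sub>R u + t *\<^sub>R v" for s t by simp
  have seg: "x + s *\<^sub>R u + t *\<^sub>R v \<in> S" if "0 \<le> s" "s \<le> h" "0 \<le> t" "t \<le> h" for s t
    using near[OF that] d0 by (auto simp: d_def dist_commute)
  obtain s t where st: "0 < s" "s < h" "0 < t" "t < h"
    "f (x + h *\<^sub>R u + h *\<^sub>R v) - f (x + h *\<^sub>R u) - f (x + h *\<^sub>R v) + f x =
      h * h * ?H u v (x + s *\<^sub>R u + t *\<^sub>R v)"
    using second_difference_mvt[OF f h seg] by auto
  obtain s' t' where st': "0 < s'" "s' < h" "0 < t'" "t' < h"
    "f (x + h *\<^sub>R v + h *\<^sub>R u) - f (x + h *\<^sub>R v) - f (x + h *\<^sub>R u) + f x =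
      h * h * ?H v u (x + s' *\<^sub>R v + t' *\<^sub>R u)"
    using second_difference_mvt[OF f h, of x v u] seg by (auto simp: sw)
  have "h * h * ?H u v (x + s *\<^sub>R u + t *\<^sub>R v) = h * h * ?H v u (x + t' *\<^sub>R u + s' *\<^sub>R v)"
    using st(5) st'(5) by (simp add: sw algebra_simps)
  then have "?H u v (x + s *\<^sub>R u + t *\<^sub>R v) = ?H v u (x + t' *\<^sub>R u + s' *\<^sub>R v)"
    using h by simp
  moreover have "dist (?H u v (x + s *\<^sub>R u + t *\<^sub>R v)) (?H u v x) < e"
    using d1(2)[of "x + s *\<^sub>R u + t *\<^sub>R v"] near[of s t] st by (auto simp: d_def)
  moreover have "dist (?H v u (x + t' *\<^sub>R u + s' *\<^sub>R v)) (?H v u x) < e"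
    using d2(2)[of "x + t' *\<^sub>R u + s' *\<^sub>R v"] near[of t' s'] st' by (auto simp: d_def)
  moreover have "\<bar>a - b\<bar> / 2 \<le> \<bar>c - a\<bar> \<or> \<bar>a - b\<bar> / 2 \<le> \<bar>c - b\<bar>" for a b c :: real
    by (smt (verit) field_sum_of_halves)
  ultimately show False
    unfolding e_def dist_real_def by (metis not_less)
qed

lemma frechet_derivative_linear_comp:
  assumes "bounded_linear h" "f differentiable (at x)"
  shows "frechet_derivative (\<lambda>x. h (f x)) (at x) v = h (frechet_derivative f (at x) v)"
  using frechet_derivative_at[OF bounded_linear.has_derivative[OF assms(1)
      assms(2)[unfolded frechet_derivative_works]]] by metis

lemma frechet_derivative_cong_open:
  assumes "open S" "x \<in> S" "\<And>z. z \<in> S \<Longrightarrow> f z = g z"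
  shows "frechet_derivative f (at x) = frechet_derivative g (at x)"
proof -
  have "(f has_derivative F) (at x) \<longleftrightarrow> (g has_derivative F) (at x)" for F
    using assms has_derivative_transform_within_open[of f F x UNIV S g]
      has_derivative_transform_within_open[of g F x UNIV S f] by auto
  then show ?thesis by (simp add: frechet_derivative_def)
qed

lemma second_derivative_symmetric:
  fixes f :: "'a::real_normed_vector \<Rightarrow> 'b::euclidean_space"
  assumes S: "open S" and f: "smooth_on S f" and x: "x \<in> S"
  shows "frechet_derivative (\<lambda>z. frechet_derivative f (at z) u) (at x) v =
    frechet_derivative (\<lambda>z. frechet_derivative f (at z) v) (at x) u"
proof (rule euclidean_eqI)
  fix b :: 'b assume "b \<in> Basis"
  let ?fb = "\<lambda>z. f z \<bullet> b"
  have bl: "bounded_linear (\<lambda>z::'b. z \<bullet> b)" by (rule bounded_linear_inner_left)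
  have fb: "smooth_on S ?fb" by (rule smooth_on_linear[OF bl S f])
  have dif: "g differentiable (at z)" if "smooth_on S g" "z \<in> S" for g :: "'a \<Rightarrow> 'b" and z
    using smooth_on_has_derivative[OF that] by (rule differentiableI)
  have 1: "frechet_derivative ?fb (at z) u = frechet_derivative f (at z) u \<bullet> b" if "z \<in> S" for z u
    by (rule frechet_derivative_linear_comp[OF bl dif[OF f that]])
  have 2: "frechet_derivative (\<lambda>z. frechet_derivative ?fb (at z) u) (at x) v =
      frechet_derivative (\<lambda>z. frechet_derivative f (at z) u) (at x) v \<bullet> b" for u v
    using frechet_derivative_linear_comp[OF bl dif[OF smooth_on_frechet_derivative[OF f] x], of u v]
    by (simp add: frechet_derivative_cong_open[OF S x 1])
  show "frechet_derivative (\<lambda>z. frechet_derivative f (at z) u) (at x) v \<bullet> b =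
    frechet_derivative (\<lambda>z. frechet_derivative f (at z) v) (at x) u \<bullet> b"
    using second_derivative_symmetric_real[OF S fb x] 2 by metis
qed

section \<open>Formal power series in the fibre coordinates\<close>

text \<open>The coefficient convention is that of \<open>weyl\<close> at a fixed power of hbar. A
  type of its own makes these series a commutative ring, so that identities can be proved by ring
  normalisation.\<close>

typedef ('i, 'a) mfps = "UNIV :: ('i multiset \<Rightarrow> 'a) set"
  morphisms coef Mfps ..

lemma mfps_eqI: "(\<And>J. coef a J = coef b J) \<Longrightarrow> a = b"
  by (simp add: coef_inject[symmetric] fun_eq_iff)

lemma coef_Mfps [simp]: "coef (Mfps f) = f"
  by (simp add: Mfps_inverse)

section \<open>Sums over the factorisations of a monomial\<close>

lemma finite_submultisets [simp]: "finite {L. L \<subseteq># J}"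
proof (rule finite_subset)
  show "{L. L \<subseteq># J} \<subseteq> {L. set_mset L \<subseteq> set_mset J \<and> size L \<le> size J}"
    by (auto dest: mset_subset_eqD size_mset_mono)
  have "{L. set_mset L \<subseteq> set_mset J \<and> size L \<le> size J} \<subseteq>
      mset ` {xs. set xs \<subseteq> set_mset J \<and> length xs \<le> size J}"
  proof
    fix L assume L: "L \<in> {L. set_mset L \<subseteq> set_mset J \<and> size L \<le> size J}"
    obtain xs where "mset xs = L" using ex_mset by blast
    with L show "L \<in> mset ` {xs. set xs \<subseteq> set_mset J \<and> length xs \<le> size J}" by force
  qed
  then show "finite {L. set_mset L \<subseteq> set_mset J \<and> size L \<le> size J}"
    by (rule finite_subset) (simp add: finite_lists_length_le)
qed

lemma sum_submultisets_complement:
  "(\<Sum>L | L \<subseteq># J. F L (J - L)) = (\<Sum>L | L \<subseteq># J. F (J - L) L)"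
  by (rule sum.reindex_bij_witness[where i = "\<lambda>L. J - L" and j = "\<lambda>L. J - L"])
    (auto simp: subset_mset.diff_diff_right)

text \<open>Both sides run over the splittings of \<open>J\<close> into three parts;
  \<open>L\<close> corresponds to \<open>K + M\<close>.\<close>

lemma sum_submultisets_assoc:
  fixes a b c :: "'i multiset \<Rightarrow> 'a::comm_ring_1"
  shows "(\<Sum>L | L \<subseteq># J. (\<Sum>K | K \<subseteq># L. a K * b (L - K)) * c (J - L)) =
    (\<Sum>K | K \<subseteq># J. a K * (\<Sum>M | M \<subseteq># J - K. b M * c (J - K - M)))"
proof -
  have "(\<Sum>L | L \<subseteq># J. (\<Sum>K | K \<subseteq># L. a K * b (L - K)) * c (J - L)) =
      (\<Sum>(L, K)\<in>Sigma {L. L \<subseteq># J} (\<lambda>L. {K. K \<subseteq># L}). a K * b (L - K) * c (J - L))"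
    by (simp add: sum_distrib_right sum.Sigma)
  also have "\<dots> = (\<Sum>(K, M)\<in>Sigma {K. K \<subseteq># J} (\<lambda>K. {M. M \<subseteq># J - K}). a K * (b M * c (J - K - M)))"
  proof (rule sum.reindex_bij_witness[where i = "\<lambda>(K, M). (K + M, K)" and j = "\<lambda>(L, K). (K, L - K)"],
      goal_cases)
    case (2 p)
    then show ?case
      by (auto simp: subseteq_mset_def intro!: diff_le_mono intro: order_trans)
  next
    case (4 p)
    then show ?case
      by (auto simp: subset_mset.le_diff_conv2 add.commute)
  next
    case (5 p)
    have "J - K - (L - K) = J - L" if "K \<subseteq># L" for K L
      using mset_subset_eq_count[OF that] by (intro multiset_eqI) simp
    with 5 show ?case by (auto simp: mult.assoc)
  qed auto
  also have "\<dots> = (\<Sum>K | K \<subseteq># J. a K * (\<Sum>M | M \<subseteq># J - K. b M * c (J - K - M)))"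
    by (simp add: sum_distrib_left sum.Sigma)
  finally show ?thesis .
qed

instantiation mfps :: (type, comm_ring_1) comm_ring_1
begin

definition "0 = Mfps (\<lambda>J. 0)"
definition "1 = Mfps (\<lambda>J. if J = {#} then 1 else 0)"
definition "a + b = Mfps (\<lambda>J. coef a J + coef b J)"
definition "a - b = Mfps (\<lambda>J. coef a J - coef b J)"
definition "- a = Mfps (\<lambda>J. - coef a J)"
definition "a * b = Mfps (\<lambda>J. \<Sum>L | L \<subseteq># J. coef a L * coef b (J - L))"

instance
proof
  fix a b c :: "('a, 'b) mfps"
  show "a * b * c = a * (b * c)"
    by (rule mfps_eqI) (simp add: times_mfps_def sum_submultisets_assoc)
  show "a * b = b * a"
    by (rule mfps_eqI) (simp add: times_mfps_def
        sum_submultisets_complement[of "\<lambda>L M. coef a L * coef b M"] mult.commute)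
  show "1 * a = a"
  proof (rule mfps_eqI)
    fix J
    have "coef (1 * a) J = (\<Sum>L | L \<subseteq># J. if L = {#} then coef a J else 0)"
      unfolding times_mfps_def one_mfps_def coef_Mfps by (rule sum.cong) auto
    then show "coef (1 * a) J = coef a J" by (simp add: sum.delta)
  qed
  show "(0::('a, 'b) mfps) \<noteq> 1"
    by (auto simp: zero_mfps_def one_mfps_def coef_inject[symmetric] fun_eq_iff)
qed (auto simp: coef_inject[symmetric] plus_mfps_def zero_mfps_def minus_mfps_def uminus_mfps_def
    times_mfps_def fun_eq_iff algebra_simps sum.distrib)

end

lemma coef_zero [simp]: "coef 0 J = 0"
  and coef_add [simp]: "coef (a + b) J = coef a J + coef b J"
  and coef_diff [simp]: "coef (a - b) J = coef a J - coef b J"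
  and coef_minus [simp]: "coef (- a) J = - coef a J"
  by (simp_all add: plus_mfps_def zero_mfps_def minus_mfps_def uminus_mfps_def)

lemma coef_mult: "coef (a * b) J = (\<Sum>L | L \<subseteq># J. coef a L * coef b (J - L))"
  by (simp add: times_mfps_def)

lemma coef_sum [simp]: "coef (\<Sum>i\<in>I. f i) J = (\<Sum>i\<in>I. coef (f i) J)"
  by (induction I rule: infinite_finite_induct) auto

section \<open>Fibre derivatives and the Euler operator\<close>

definition dy :: "'i \<Rightarrow> ('i, 'a::comm_ring_1) mfps \<Rightarrow> ('i, 'a) mfps" where
  "dy i a = Mfps (\<lambda>J. of_nat (Suc (count J i)) * coef a (add_mset i J))"

definition var :: "'i \<Rightarrow> ('i, 'a::comm_ring_1) mfps" where
  "var i = Mfps (\<lambda>J. if J = {#i#} then 1 else 0)"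

text \<open>The Euler field y^i d/dy^i, which multiplies the part of degree l in y by l. It replaces
  the degree-dependent denominators of \<delta>^-1.\<close>

definition eul :: "('i::finite, 'a::comm_ring_1) mfps \<Rightarrow> ('i, 'a) mfps" where
  "eul a = (\<Sum>i\<in>UNIV. var i * dy i a)"

lemma coef_dy: "coef (dy i a) J = of_nat (Suc (count J i)) * coef a (add_mset i J)"
  by (simp add: dy_def)

lemma dy_add: "dy i (a + b) = dy i a + dy i b"
  and dy_diff: "dy i (a - b) = dy i a - dy i b"
  and dy_zero [simp]: "dy i 0 = 0"
  by (rule mfps_eqI, simp add: coef_dy distrib_left right_diff_distrib del: of_nat_Suc)+

lemma dy_sum: "dy i (\<Sum>k\<in>K. f k) = (\<Sum>k\<in>K. dy i (f k))"
  by (induction K rule: infinite_finite_induct) (auto simp: dy_add)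

lemma dy_commute: "dy i (dy j a) = dy j (dy i a)"
  by (rule mfps_eqI) (simp add: coef_dy add_mset_commute mult.left_commute)

text \<open>In a product monomial the exponent of \<open>i\<close> is the sum of the exponents in
  the two factors. This is the share of \<open>a\<close> in the Leibniz rule; exchanging the factors
  gives the share of \<open>b\<close>. Submultisets without \<open>i\<close> have weight
  zero.\<close>

lemma dy_mult_aux:
  fixes a b :: "('i, 'a::comm_ring_1) mfps"
  shows "(\<Sum>L | L \<subseteq># add_mset i J. of_nat (count L i) * (coef a L * coef b (add_mset i J - L))) =
    coef (dy i a * b) J"
proof -
  have "coef (dy i a * b) J =
      (\<Sum>L\<in>{L. L \<subseteq># add_mset i J \<and> i \<in># L}. of_nat (count L i) * (coef a L * coef b (add_mset i J - L)))"
    unfolding coef_mult coef_dy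
    by (rule sum.reindex_bij_witness[where i = "\<lambda>L. L - {#i#}" and j = "add_mset i"])
      (auto simp: mult.assoc insert_subset_eq_iff subset_eq_diff_conv)
  also have "\<dots> = (\<Sum>L | L \<subseteq># add_mset i J. of_nat (count L i) * (coef a L * coef b (add_mset i J - L)))"
    by (rule sum.mono_neutral_left) (auto simp: not_in_iff)
  finally show ?thesis by simp
qed

lemma dy_mult: "dy i (a * b) = dy i a * b + a * dy i b"
proof (rule mfps_eqI)
  fix J
  let ?J = "add_mset i J"
  have "coef (dy i (a * b)) J = (\<Sum>L | L \<subseteq># ?J. of_nat (count ?J i) * (coef a L * coef b (?J - L)))"
    by (simp add: coef_dy coef_mult sum_distrib_left)
  also have "\<dots> = (\<Sum>L | L \<subseteq># ?J. of_nat (count L i) * (coef a L * coef b (?J - L)) +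
      of_nat (count (?J - L) i) * (coef a L * coef b (?J - L)))"
  proof (rule sum.cong[OF refl])
    fix L assume "L \<in> {L. L \<subseteq># ?J}"
    then have "count L i \<le> count ?J i" by (metis mem_Collect_eq mset_subset_eq_count)
    then have "count ?J i = count L i + count (?J - L) i" by simp
    then have "(of_nat (count ?J i) :: 'b) = of_nat (count L i) + of_nat (count (?J - L) i)"
      by (metis of_nat_add)
    then show "of_nat (count ?J i) * (coef a L * coef b (?J - L)) =
        of_nat (count L i) * (coef a L * coef b (?J - L)) +
        of_nat (count (?J - L) i) * (coef a L * coef b (?J - L))"
      by (simp only: distrib_right)
  qed
  also have "\<dots> = coef (dy i a * b) J +
      (\<Sum>L | L \<subseteq># ?J. of_nat (count (?J - L) i) * (coef a L * coef b (?J - L)))"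
    by (simp add: sum.distrib dy_mult_aux)
  also have "(\<Sum>L | L \<subseteq># ?J. of_nat (count (?J - L) i) * (coef a L * coef b (?J - L))) =
      coef (dy i b * a) J"
    unfolding dy_mult_aux[symmetric]
    by (subst sum_submultisets_complement[of "\<lambda>L M. of_nat (count M i) * (coef a L * coef b M)"])
      (simp add: mult.commute)
  finally show "coef (dy i (a * b)) J = coef (dy i a * b + a * dy i b) J"
    by (simp add: mult.commute)
qed

lemma coef_var_mult: "coef (var i * a) J = (if i \<in># J then coef a (J - {#i#}) else 0)"
proof -
  have "coef (var i * a) J = (\<Sum>L | L \<subseteq># J. if L = {#i#} then coef a (J - {#i#}) else 0)"
    unfolding coef_mult var_def coef_Mfps by (rule sum.cong) auto
  then show ?thesis by (simp add: sum.delta)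
qed

lemma dy_var: "dy i (var j) = (if i = j then 1 else 0)"
  by (rule mfps_eqI) (auto simp: coef_dy var_def one_mfps_def)

lemma coef_eul: "coef (eul a) J = of_nat (size J) * coef a (J :: 'i::finite multiset)"
proof -
  have "coef (eul a) J = (\<Sum>i\<in>UNIV. of_nat (count J i) * coef a J)"
    unfolding eul_def coef_sum coef_var_mult
    by (rule sum.cong) (auto simp: coef_dy not_in_iff)
  also have "\<dots> = of_nat (\<Sum>i\<in>UNIV. count J i) * coef a J"
    by (simp add: sum_distrib_right)
  also have "(\<Sum>i\<in>UNIV. count J i) = size J"
    unfolding size_multiset_overloaded_eq
    by (rule sum.mono_neutral_right) (auto simp: not_in_iff)
  finally show ?thesis .
qed

text \<open>The Leibniz rule for y^k f_k. Subtracted from the Euler operator it gives \<delta>^-1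
  \<delta> + \<delta> \<delta>^-1 = id on 1-forms before division by the degree.\<close>

lemma contract_dy:
  "(\<Sum>k\<in>UNIV. var k * dy l (f k)) = dy l (\<Sum>k\<in>UNIV. var k * f k) - f l"
  for f :: "'i::finite \<Rightarrow> ('i, 'a::comm_ring_1) mfps"
proof -
  have "dy l (\<Sum>k\<in>UNIV. var k * f k) = (\<Sum>k\<in>UNIV. (if l = k then f k else 0) + var k * dy l (f k))"
    unfolding dy_sum by (rule sum.cong) (auto simp: dy_mult dy_var)
  then show ?thesis by (simp add: sum.distrib)
qed

subsection \<open>The Poisson bracket\<close>

text \<open>The contraction of the two differentials with \<open>omega_inv\<close>, whose entry at
  (\<open>Inr \<alpha>\<close>, \<open>Inl \<alpha>\<close>) is +1. Hence a position coordinate with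
  its conjugate momentum has bracket -1.\<close>

definition poisson :: "('n::finite + 'n, 'a::comm_ring_1) mfps \<Rightarrow> ('n + 'n, 'a) mfps \<Rightarrow> ('n + 'n, 'a) mfps"
  where "poisson a b =
    (\<Sum>\<alpha>\<in>UNIV. dy (Inr \<alpha>) a * dy (Inl \<alpha>) b - dy (Inl \<alpha>) a * dy (Inr \<alpha>) b)"

lemma poisson_add_left: "poisson (a + b) c = poisson a c + poisson b c"
  and poisson_diff_left: "poisson (a - b) c = poisson a c - poisson b c"
  and poisson_add_right: "poisson a (b + c) = poisson a b + poisson a c"
  and poisson_diff_right: "poisson a (b - c) = poisson a b - poisson a c"
  and poisson_zero_left [simp]: "poisson 0 a = 0"
  and poisson_zero_right [simp]: "poisson a 0 = 0"
  by (simp_all add: poisson_def dy_add dy_diff algebra_simps sum.distrib sum_subtractf)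

lemma poisson_antisym: "poisson a b = - poisson b a"
  unfolding poisson_def sum_negf[symmetric] by (rule sum.cong) (auto simp: mult.commute)

lemma dy_poisson: "dy i (poisson a b) = poisson (dy i a) b + poisson a (dy i b)"
  unfolding poisson_def dy_sum sum.distrib[symmetric]
  by (rule sum.cong) (auto simp: dy_mult dy_diff dy_commute[of i] algebra_simps)

lemma poisson_jacobi: "poisson a (poisson b c) = poisson (poisson a b) c + poisson b (poisson a c)"
proof -
  let ?X = "\<lambda>\<alpha>. dy (Inl \<alpha>)" and ?Y = "\<lambda>\<alpha>. dy (Inr \<alpha>)"
  \<comment> \<open>\<open>t\<close> collects the terms with second derivatives of \<open>c\<close>.
    Those with second derivatives of \<open>a\<close> or \<open>b\<close> cancel for each fixed pair
    of indices, because \<open>expand'\<close> has its two sums exchanged.\<close>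
  define t where "t \<alpha> \<beta> =
      ?Y \<alpha> a * (?Y \<beta> b * ?X \<alpha> (?X \<beta> c)) - ?Y \<alpha> a * (?X \<beta> b * ?X \<alpha> (?Y \<beta> c))
      - ?X \<alpha> a * (?Y \<beta> b * ?Y \<alpha> (?X \<beta> c)) + ?X \<alpha> a * (?X \<beta> b * ?Y \<alpha> (?Y \<beta> c))" for \<alpha> \<beta>
  have expand: "poisson u (poisson v w) = (\<Sum>\<alpha>\<in>UNIV. \<Sum>\<beta>\<in>UNIV.
      ?Y \<alpha> u * ?X \<alpha> (?Y \<beta> v * ?X \<beta> w - ?X \<beta> v * ?Y \<beta> w) -
      ?X \<alpha> u * ?Y \<alpha> (?Y \<beta> v * ?X \<beta> w - ?X \<beta> v * ?Y \<beta> w))" for u v w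
    unfolding poisson_def[of u] unfolding poisson_def dy_sum
    by (simp add: sum_distrib_left sum_subtractf)
  have expand': "poisson (poisson u v) w = (\<Sum>\<alpha>\<in>UNIV. \<Sum>\<beta>\<in>UNIV.
      ?Y \<beta> (?Y \<alpha> u * ?X \<alpha> v - ?X \<alpha> u * ?Y \<alpha> v) * ?X \<beta> w -
      ?X \<beta> (?Y \<alpha> u * ?X \<alpha> v - ?X \<alpha> u * ?Y \<alpha> v) * ?Y \<beta> w)" for u v w
    unfolding poisson_def[of "poisson u v"] unfolding poisson_def dy_sum
    by (subst sum.swap) (simp add: sum_distrib_right sum_subtractf)
  have "poisson a (poisson b c) - poisson (poisson a b) c - poisson b (poisson a c) =
      (\<Sum>\<alpha>\<in>UNIV. \<Sum>\<beta>\<in>UNIV. t \<alpha> \<beta> - t \<beta> \<alpha>)"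
    unfolding expand expand' sum_subtractf[symmetric] t_def
    by (intro sum.cong refl) (simp add: dy_mult dy_diff algebra_simps dy_commute)
  also have "\<dots> = 0"
    unfolding sum_subtractf by (subst (2) sum.swap) simp
  finally show ?thesis
    by (simp add: algebra_simps)
qed

subsection \<open>Order in the fibre coordinates\<close>

text \<open>The ring of functions has zero divisors, but a positive integer is invertible at every
  point.\<close>

lemma coef_zero_of_nat_mult:
  "of_nat (Suc n) * f = 0 \<Longrightarrow> f = 0" for f :: "'x \<Rightarrow> complex"
  by (simp add: fun_eq_iff del: of_nat_Suc)

definition lowdeg :: "nat \<Rightarrow> ('i, 'a::comm_ring_1) mfps \<Rightarrow> bool" where
  "lowdeg d a \<longleftrightarrow> (\<forall>J. size J < d \<longrightarrow> coef a J = 0)"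

lemma lowdegD: "lowdeg d a \<Longrightarrow> size J < d \<Longrightarrow> coef a J = 0"
  by (simp add: lowdeg_def)

lemma lowdeg_zero [simp]: "lowdeg d 0"
  and lowdeg_0 [simp]: "lowdeg 0 a"
  and lowdeg_mono: "lowdeg e a \<Longrightarrow> d \<le> e \<Longrightarrow> lowdeg d a"
  and lowdeg_add: "lowdeg d a \<Longrightarrow> lowdeg d b \<Longrightarrow> lowdeg d (a + b)"
  and lowdeg_diff: "lowdeg d a \<Longrightarrow> lowdeg d b \<Longrightarrow> lowdeg d (a - b)"
  and lowdeg_minus: "lowdeg d a \<Longrightarrow> lowdeg d (- a)"
  and lowdeg_sum: "(\<And>k. k \<in> K \<Longrightarrow> lowdeg d (f k)) \<Longrightarrow> lowdeg d (\<Sum>k\<in>K. f k)"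
  by (auto simp: lowdeg_def intro!: sum.neutral)

lemma lowdeg_all_imp_zero: "(\<And>d. lowdeg d a) \<Longrightarrow> a = 0"
  by (rule mfps_eqI) (metis coef_zero lessI lowdegD)

lemma lowdeg_mult:
  fixes a b :: "('i, 'a::comm_ring_1) mfps"
  assumes "lowdeg d a" "lowdeg e b" shows "lowdeg (d + e) (a * b)"
  unfolding lowdeg_def coef_mult
proof (intro allI impI sum.neutral ballI)
  fix J L :: "'i multiset" assume J: "size J < d + e" and L: "L \<in> {L. L \<subseteq># J}"
  then have "size J = size L + size (J - L)"
    by (metis mem_Collect_eq size_union subset_mset.add_diff_inverse)
  with J have "size L < d \<or> size (J - L) < e" by linarith
  then show "coef a L * coef b (J - L) = 0"
    using assms by (auto simp: lowdegD)
qed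

lemma lowdeg_dy: "lowdeg (Suc d) a \<Longrightarrow> lowdeg d (dy i a)"
  by (auto simp: lowdeg_def coef_dy)

lemma lowdeg_var_mult: "lowdeg d a \<Longrightarrow> lowdeg (Suc d) (var i * a)"
  by (auto simp: lowdeg_def coef_var_mult) (metis Suc_less_eq size_Suc_Diff1)

lemma lowdeg_poisson:
  assumes "lowdeg (Suc d) a" "lowdeg (Suc e) b" shows "lowdeg (d + e) (poisson a b)"
  unfolding poisson_def
  using assms by (intro lowdeg_sum lowdeg_diff lowdeg_mult lowdeg_dy)

text \<open>The bracket costs each factor one order in y; a factor of order two pays for both
  derivatives. This makes the recursions contracting once the contraction with y^k has added an
  order.\<close>

lemma lowdeg_poisson_2:
  assumes "lowdeg 2 a" "lowdeg d b" shows "lowdeg d (poisson a b)"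
proof (cases d)
  case (Suc e)
  then show ?thesis using lowdeg_poisson[of 1 a e b] assms by (simp add: numeral_2_eq_2)
qed simp

lemma lowdeg_poisson_2': "lowdeg d a \<Longrightarrow> lowdeg 2 b \<Longrightarrow> lowdeg d (poisson a b)"
  by (subst poisson_antisym) (intro lowdeg_minus lowdeg_poisson_2)

text \<open>Banach's fixed point theorem in the y-adic topology: each iteration settles one more
  order. \<open>closed\<close> says that \<open>Inv\<close> passes to y-adic limits.\<close>

lemma mfps_fixpoint:
  fixes \<Psi> :: "('k \<Rightarrow> ('i, 'a::comm_ring_1) mfps) \<Rightarrow> 'k \<Rightarrow> ('i, 'a) mfps"
  assumes start: "Inv u0"
    and step: "\<And>u. Inv u \<Longrightarrow> Inv (\<Psi> u)"
    and contr: "\<And>d u v k. Inv u \<Longrightarrow> Inv v \<Longrightarrow> (\<And>k. lowdeg d (u k - v k)) \<Longrightarrow>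
      lowdeg (Suc d) (\<Psi> u k - \<Psi> v k)"
    and closed: "\<And>u. (\<And>d. \<exists>v. Inv v \<and> (\<forall>k. lowdeg d (u k - v k))) \<Longrightarrow> Inv u"
  obtains u where "Inv u" "\<Psi> u = u"
proof -
  define v where "v n = (\<Psi> ^^ n) u0" for n
  have vS: "v (Suc n) = \<Psi> (v n)" for n by (simp add: v_def)
  have Iv: "Inv (v n)" for n by (induction n) (use start step in \<open>auto simp: v_def\<close>)
  have cau: "lowdeg n (v (n + m) k - v n k)" for n m k
  proof (induction n arbitrary: k)
    case (Suc n)
    show ?case using contr[OF Iv Iv Suc] by (simp add: vS)
  qed simp
  \<comment> \<open>The iterate with number \<open>Suc (size J)\<close> already has the final
    coefficient at \<open>J\<close>.\<close>
  define u where "u k = Mfps (\<lambda>J. coef (v (Suc (size J)) k) J)" for k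
  have uv: "lowdeg n (u k - v n k)" for n k
    unfolding lowdeg_def
  proof (intro allI impI)
    fix J :: "'i multiset" assume "size J < n"
    then obtain m where "n = Suc (size J) + m" by (metis Suc_leI le_Suc_ex)
    then show "coef (u k - v n k) J = 0"
      using lowdegD[OF cau[of "Suc (size J)" m k], of J] by (simp add: u_def)
  qed
  have Iu: "Inv u" by (rule closed) (use Iv uv in blast)
  have "lowdeg (Suc n) (\<Psi> u k - u k)" for n k
  proof -
    have "lowdeg (Suc n) ((\<Psi> u k - \<Psi> (v n) k) - (u k - v (Suc n) k))"
      by (intro lowdeg_diff contr Iu Iv uv)
    then show ?thesis by (simp add: vS)
  qed
  then have "\<Psi> u k - u k = 0" for k
    by (intro lowdeg_all_imp_zero) (meson lowdeg_mono le_SucI order_refl)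
  then show ?thesis using Iu by (intro that[of u]) auto
qed

section \<open>Connections in the classical limit\<close>

subsection \<open>Smooth coefficients\<close>

text \<open>Coefficients are cut off outside \<open>D\<close>, so that equations on \<open>D\<close> are equations in the ring
  of functions.\<close>

locale phase_domain =
  fixes D :: "'n::finite phase set"
  assumes open_D: "open D"
begin

definition csec :: "('n phase \<Rightarrow> complex) set" where
  "csec = {f. smooth_on D f \<and> (\<forall>x. x \<notin> D \<longrightarrow> f x = 0)}"

definition cpart :: "'n + 'n \<Rightarrow> ('n phase \<Rightarrow> complex) \<Rightarrow> 'n phase \<Rightarrow> complex" where
  "cpart i f = (\<lambda>x. if x \<in> D then partial i f x else 0)"

lemma csec_smooth: "f \<in> csec \<Longrightarrow> smooth_on D f"
  and csec_outside: "f \<in> csec \<Longrightarrow> x \<notin> D \<Longrightarrow> f x = 0"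
  by (auto simp: csec_def)

lemma csec_zero [simp]: "0 \<in> csec"
  using smooth_on_const[OF open_D, of "0::complex"] by (simp add: csec_def zero_fun_def)

lemma csec_add: "f \<in> csec \<Longrightarrow> g \<in> csec \<Longrightarrow> f + g \<in> csec"
  by (simp add: csec_def plus_fun_def smooth_on_add open_D)

lemma csec_mult: "f \<in> csec \<Longrightarrow> g \<in> csec \<Longrightarrow> f * g \<in> csec"
  by (simp add: csec_def times_fun_def smooth_on_mult open_D)

lemma csec_scale: "f \<in> csec \<Longrightarrow> (\<lambda>x. c * f x) \<in> csec"
  by (simp add: csec_def smooth_on_linear[OF bounded_linear_mult_right] open_D)

lemma csec_divide: "f \<in> csec \<Longrightarrow> (\<lambda>x. f x / c) \<in> csec"
  using csec_scale[of f "inverse c"] by (simp add: field_simps)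

lemma csec_of_nat: "f \<in> csec \<Longrightarrow> of_nat n * f \<in> csec"
  using csec_scale[of f "of_nat n"] by (simp add: times_fun_def)

lemma csec_minus: "f \<in> csec \<Longrightarrow> - f \<in> csec"
  using csec_scale[of f "-1"] by (simp add: fun_Compl_def)

lemma csec_diff: "f \<in> csec \<Longrightarrow> g \<in> csec \<Longrightarrow> f - g \<in> csec"
  using csec_add[OF _ csec_minus, of f g] by simp

lemma csec_sum: "(\<And>i. i \<in> I \<Longrightarrow> f i \<in> csec) \<Longrightarrow> (\<Sum>i\<in>I. f i) \<in> csec"
  by (induction I rule: infinite_finite_induct) (auto intro: csec_add)

lemma csec_cpart: "f \<in> csec \<Longrightarrow> cpart i f \<in> csec"
  unfolding csec_def cpart_def
  by (auto intro: smooth_on_cong[OF open_D _ smooth_on_partial[of D f i]])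

lemma cpart_zero [simp]: "cpart i 0 = 0"
  by (auto simp: cpart_def partial_def zero_fun_def)

lemma csec_deriv: "f \<in> csec \<Longrightarrow> x \<in> D \<Longrightarrow> (f has_derivative frechet_derivative f (at x)) (at x)"
  by (rule smooth_on_has_derivative) (rule csec_smooth)

lemma cpart_eqI:
  assumes "\<And>x. x \<in> D \<Longrightarrow> (f has_derivative F x) (at x)" "\<And>x. x \<in> D \<Longrightarrow> F x (axis i 1) = g x"
    "\<And>x. x \<notin> D \<Longrightarrow> g x = 0"
  shows "cpart i f = g"
proof
  fix x
  show "cpart i f x = g x"
    using assms frechet_derivative_at[OF assms(1)] by (cases "x \<in> D") (auto simp: cpart_def partial_def)
qed

lemma cpart_add: "f \<in> csec \<Longrightarrow> g \<in> csec \<Longrightarrow> cpart i (f + g) = cpart i f + cpart i g"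
  by (rule cpart_eqI, unfold plus_fun_def, rule has_derivative_add[OF csec_deriv csec_deriv])
    (auto simp: cpart_def partial_def)

lemma cpart_scale: "f \<in> csec \<Longrightarrow> cpart i (\<lambda>x. c * f x) = (\<lambda>x. c * cpart i f x)"
  by (rule cpart_eqI, rule has_derivative_mult_right[OF csec_deriv])
    (auto simp: cpart_def partial_def)

lemma cpart_divide: "f \<in> csec \<Longrightarrow> cpart i (\<lambda>x. f x / c) = (\<lambda>x. cpart i f x / c)"
  using cpart_scale[of f i "inverse c"] by (simp add: field_simps)

lemma cpart_of_nat: "f \<in> csec \<Longrightarrow> cpart i (of_nat n * f) = of_nat n * cpart i f"
  using cpart_scale[of f i "of_nat n"] by (simp add: times_fun_def)

lemma cpart_minus: "f \<in> csec \<Longrightarrow> cpart i (- f) = - cpart i f"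
  using cpart_scale[of f i "-1"] by (simp add: fun_Compl_def)

lemma cpart_diff: "f \<in> csec \<Longrightarrow> g \<in> csec \<Longrightarrow> cpart i (f - g) = cpart i f - cpart i g"
  using cpart_add[OF _ csec_minus, of f g] by (simp add: cpart_minus)

lemma cpart_sum: "(\<And>k. k \<in> K \<Longrightarrow> f k \<in> csec) \<Longrightarrow> cpart i (\<Sum>k\<in>K. f k) = (\<Sum>k\<in>K. cpart i (f k))"
  by (induction K rule: infinite_finite_induct) (auto simp: cpart_add csec_sum)

lemma cpart_mult:
  "f \<in> csec \<Longrightarrow> g \<in> csec \<Longrightarrow> cpart i (f * g) = cpart i f * g + f * cpart i g"
  by (rule cpart_eqI, unfold times_fun_def, rule has_derivative_mult[OF csec_deriv csec_deriv])
    (auto simp: cpart_def partial_def)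

lemma cpart_commute:
  assumes "f \<in> csec" shows "cpart i (cpart j f) = cpart j (cpart i f)"
proof -
  have D: "cpart i (cpart j f) x =
      frechet_derivative (\<lambda>z. frechet_derivative f (at z) (axis j 1)) (at x) (axis i 1)"
    if "x \<in> D" for x i j
    using frechet_derivative_cong_open[OF open_D that, of "cpart j f"
        "\<lambda>z. frechet_derivative f (at z) (axis j 1)"] that
    by (simp add: cpart_def partial_def)
  show ?thesis
  proof
    fix x
    show "cpart i (cpart j f) x = cpart j (cpart i f) x"
    proof (cases "x \<in> D")
      case True
      show ?thesis
        unfolding D[OF True] by (rule second_derivative_symmetric[OF open_D csec_smooth[OF assms] True])
    qed (simp add: cpart_def)
  qed
qed

section \<open>Series with smooth coefficients and their derivatives along phase space\<close>

definition SP :: "('n + 'n, 'n phase \<Rightarrow> complex) mfps \<Rightarrow> bool" where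
  "SP a \<longleftrightarrow> (\<forall>J. coef a J \<in> csec)"

definition dx :: "'n + 'n \<Rightarrow> ('n + 'n, 'n phase \<Rightarrow> complex) mfps \<Rightarrow> ('n + 'n, 'n phase \<Rightarrow> complex) mfps"
  where "dx i a = Mfps (\<lambda>J. cpart i (coef a J))"

lemma coef_dx [simp]: "coef (dx i a) J = cpart i (coef a J)"
  by (simp add: dx_def)

lemma SP_coef: "SP a \<Longrightarrow> coef a J \<in> csec"
  by (simp add: SP_def)

lemma SP_zero [simp]: "SP 0"
  and SP_add: "SP a \<Longrightarrow> SP b \<Longrightarrow> SP (a + b)"
  and SP_diff: "SP a \<Longrightarrow> SP b \<Longrightarrow> SP (a - b)"
  and SP_minus: "SP a \<Longrightarrow> SP (- a)"
  and SP_mult: "SP a \<Longrightarrow> SP b \<Longrightarrow> SP (a * b)"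
  and SP_dy: "SP a \<Longrightarrow> SP (dy i a)"
  and SP_dx: "SP a \<Longrightarrow> SP (dx i a)"
  by (auto simp: SP_def coef_mult coef_dy simp del: of_nat_Suc
      intro!: csec_add csec_diff csec_minus csec_sum csec_mult csec_of_nat csec_cpart)

lemma SP_var_mult: "SP a \<Longrightarrow> SP (var i * a)"
  by (simp add: SP_def coef_var_mult)

lemma SP_sum: "(\<And>k. k \<in> K \<Longrightarrow> SP (f k)) \<Longrightarrow> SP (\<Sum>k\<in>K. f k)"
  by (induction K rule: infinite_finite_induct) (auto intro: SP_add)

lemma SP_poisson: "SP a \<Longrightarrow> SP b \<Longrightarrow> SP (poisson a b)"
  unfolding poisson_def by (intro SP_sum SP_diff SP_mult SP_dy)

lemmas SP_intros = SP_zero SP_add SP_diff SP_minus SP_mult SP_dy SP_dx SP_var_mult SP_sum SP_poisson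

lemma dx_zero [simp]: "dx i 0 = 0"
  by (rule mfps_eqI) simp

lemma dx_add: "SP a \<Longrightarrow> SP b \<Longrightarrow> dx i (a + b) = dx i a + dx i b"
  and dx_diff: "SP a \<Longrightarrow> SP b \<Longrightarrow> dx i (a - b) = dx i a - dx i b"
  by (rule mfps_eqI, simp add: cpart_add cpart_diff SP_coef)+

lemma dx_sum: "(\<And>k. k \<in> K \<Longrightarrow> SP (f k)) \<Longrightarrow> dx i (\<Sum>k\<in>K. f k) = (\<Sum>k\<in>K. dx i (f k))"
  by (induction K rule: infinite_finite_induct) (auto simp: dx_add SP_sum)

lemma dx_mult: "SP a \<Longrightarrow> SP b \<Longrightarrow> dx i (a * b) = dx i a * b + a * dx i b"
  by (rule mfps_eqI) (simp add: coef_mult cpart_sum cpart_mult csec_mult SP_coef sum.distrib)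

lemma dx_dy: "SP a \<Longrightarrow> dx i (dy j a) = dy j (dx i a)"
  by (rule mfps_eqI) (simp add: coef_dy cpart_of_nat SP_coef del: of_nat_Suc)

lemma dx_commute: "SP a \<Longrightarrow> dx i (dx j a) = dx j (dx i a)"
  by (rule mfps_eqI) (simp add: cpart_commute SP_coef)

lemma dx_var_mult: "dx i (var k * a) = var k * dx i a"
  by (rule mfps_eqI) (simp add: coef_var_mult)

lemma dx_poisson:
  assumes "SP a" "SP b" shows "dx i (poisson a b) = poisson (dx i a) b + poisson a (dx i b)"
  unfolding poisson_def sum.distrib[symmetric]
  by (subst dx_sum) (auto intro!: SP_intros assms sum.cong
      simp: dx_diff dx_mult dx_dy SP_intros assms algebra_simps)

lemma lowdeg_dx: "lowdeg d a \<Longrightarrow> lowdeg d (dx i a)"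
  by (simp add: lowdeg_def)

subsection \<open>Connections and their curvature\<close>

text \<open>The operator d - \<delta>. The term \<open>- dy k\<close> is the commutator with the
  symplectic part of the Abelian connection, see \<open>weyl_comm_omega_form\<close>.\<close>

definition nab :: "'n + 'n \<Rightarrow> ('n + 'n, 'n phase \<Rightarrow> complex) mfps \<Rightarrow> ('n + 'n, 'n phase \<Rightarrow> complex) mfps"
  where "nab k a = dx k a - dy k a"

lemma SP_nab: "SP a \<Longrightarrow> SP (nab k a)"
  by (simp add: nab_def SP_intros)

lemma nab_add: "SP a \<Longrightarrow> SP b \<Longrightarrow> nab k (a + b) = nab k a + nab k b"
  and nab_diff: "SP a \<Longrightarrow> SP b \<Longrightarrow> nab k (a - b) = nab k a - nab k b"
  by (simp_all add: nab_def dx_add dx_diff dy_add dy_diff)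

lemma nab_commute: "SP a \<Longrightarrow> nab k (nab l a) = nab l (nab k a)"
  by (simp add: nab_def dx_diff dy_diff dx_dy dx_commute[of a k l] dy_commute[of k l] SP_intros)

lemma nab_poisson:
  "SP a \<Longrightarrow> SP b \<Longrightarrow> nab k (poisson a b) = poisson (nab k a) b + poisson a (nab k b)"
  by (simp add: nab_def dx_poisson dy_poisson poisson_diff_left poisson_diff_right)

end

locale weyl_connection = phase_domain D for D :: "'n::finite phase set" +
  fixes A :: "'n + 'n \<Rightarrow> ('n + 'n, 'n phase \<Rightarrow> complex) mfps"
  assumes SP_A: "SP (A k)" and lowdeg_A: "lowdeg 2 (A k)"
begin

text \<open>Classical curvature of the symplectic term plus \<open>A\<close>, up to the central
  2-form contributed by the symplectic term alone. The bracket stands for (i/hbar) \<open>A\<close>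
  o \<open>A\<close>.\<close>

definition curv where
  "curv k l = nab k (A l) - nab l (A k) + poisson (A k) (A l)"

definition cov where
  "cov k a = nab k a + poisson (A k) a"

lemma curv_antisym: "curv k l = - curv l k"
  using poisson_antisym[of "A k" "A l"] by (simp add: curv_def)

lemma cov_commutator:
  assumes a: "SP a" shows "cov k (cov l a) - cov l (cov k a) = poisson (curv k l) a"
proof -
  have "cov k (cov l a) = nab k (nab l a) + poisson (nab k (A l)) a + poisson (A l) (nab k a)
      + poisson (A k) (nab l a) + poisson (A k) (poisson (A l) a)" for k l
    by (simp add: cov_def nab_add nab_poisson poisson_add_right SP_intros SP_nab SP_A a)
  then show ?thesis
    by (simp add: curv_def poisson_add_left poisson_diff_left nab_commute[OF a, of k l]
        poisson_jacobi[of "A k" "A l" a])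
qed

text \<open>Since \<open>nab\<close> is a derivation of the bracket and its components commute, the
  terms linear and quadratic in \<open>A\<close> cancel cyclically; the triple brackets cancel by
  the Jacobi identity.\<close>

lemma bianchi: "cov k (curv l m) + cov l (curv m k) + cov m (curv k l) = 0"
proof -
  have exp: "cov k (curv l m) = nab k (nab l (A m)) - nab k (nab m (A l)) +
      poisson (nab k (A l)) (A m) - poisson (nab k (A m)) (A l)
      - poisson (nab l (A m)) (A k) + poisson (nab m (A l)) (A k) + poisson (A k) (poisson (A l) (A m))"
    for k l m
    using poisson_antisym[of "A l" "nab k (A m)"] poisson_antisym[of "A k" "nab l (A m)"]
      poisson_antisym[of "A k" "nab m (A l)"]
    by (simp add: cov_def curv_def nab_add nab_diff nab_poisson poisson_add_right poisson_diff_right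
        SP_intros SP_nab SP_A)
  have jac: "poisson (A k) (poisson (A l) (A m)) + poisson (A l) (poisson (A m) (A k)) +
      poisson (A m) (poisson (A k) (A l)) = 0"
    using poisson_jacobi[of "A k" "A l" "A m"] poisson_antisym[of "A m" "poisson (A k) (A l)"]
      poisson_antisym[of "A m" "A k"] poisson_zero_right[of "A l"]
      poisson_diff_right[of "A l" 0 "poisson (A k) (A m)"]
    by simp
  show ?thesis
    using jac nab_commute[OF SP_A, of k l m] nab_commute[OF SP_A, of k m l]
      nab_commute[OF SP_A, of l m k]
    unfolding exp by (simp add: algebra_simps)
qed

text \<open>The lowest homogeneous part \<open>F\<close> of the curvature satisfies \<open>\<delta>F = 0\<close> by the Bianchi
  identity, and \<open>\<delta>\<^sup>-\<^sup>1 F = 0\<close>; so it vanishes by the Poincare lemma for \<open>\<delta>\<close>.\<close>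

lemma curv_zero_if_contraction:
  assumes y: "\<And>l. (\<Sum>k\<in>UNIV. var k * curv k l) = 0"
  shows "curv k l = 0"
proof -
  have "\<forall>k l. lowdeg d (curv k l)" for d
  proof (induction d)
    case (Suc d)
    show ?case
    proof (intro allI)
      fix l m
      \<comment> \<open>\<open>G\<close> is the cyclic sum representing \<delta>F. By the Bianchi
        identity it equals terms without \<open>dy\<close> on the curvature, none of which lowers
        the order.\<close>
      define G where "G k = dy k (curv l m) + dy l (curv m k) + dy m (curv k l)" for k
      have "G k = (dx k (curv l m) + poisson (A k) (curv l m)) +
          (dx l (curv m k) + poisson (A l) (curv m k)) +
          (dx m (curv k l) + poisson (A m) (curv k l))" for k
        using bianchi[of k l m] by (simp add: G_def cov_def nab_def algebra_simps)
      then have "lowdeg d (G k)" for k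
        using Suc by (simp add: lowdeg_add lowdeg_dx lowdeg_poisson_2 lowdeg_A)
      then have lG: "lowdeg (Suc d) (\<Sum>k\<in>UNIV. var k * G k)"
        by (intro lowdeg_sum lowdeg_var_mult)
      have y': "(\<Sum>k\<in>UNIV. var k * curv m k) = 0" for m
        using y[of m] by (subst curv_antisym) (simp add: sum_negf)
      \<comment> \<open>The contraction multiplies the part of degree l in y by l + 2, fibre degree
        plus form degree. This factor is positive, so the order of the curvature rises by
        one.\<close>
      have "(\<Sum>k\<in>UNIV. var k * G k) = eul (curv l m) + (dy l (\<Sum>k\<in>UNIV. var k * curv m k) - curv m l)
          + (dy m (\<Sum>k\<in>UNIV. var k * curv k l) - curv m l)"
        unfolding G_def distrib_left sum.distrib eul_def
        by (simp add: contract_dy[of l "curv m"] contract_dy[of m "\<lambda>k. curv k l"])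
      also have "\<dots> = eul (curv l m) + curv l m + curv l m"
        using curv_antisym[of m l] by (simp add: y y')
      finally have "coef (eul (curv l m) + curv l m + curv l m) J = 0" if "size J \<le> d" for J
        using lowdegD[OF lG, of J] that by simp
      moreover have "of_nat (Suc (Suc (size J))) * coef (curv l m) J =
          coef (eul (curv l m) + curv l m + curv l m) J" for J
        unfolding coef_add coef_eul by (simp add: algebra_simps)
      ultimately have "of_nat (Suc (Suc (size J))) * coef (curv l m) J = 0" if "size J \<le> d" for J
        using that by metis
      then show "lowdeg (Suc d) (curv l m)"
        unfolding lowdeg_def by (metis coef_zero_of_nat_mult less_Suc_eq_le)
    qed
  qed simp
  then show ?thesis by (intro lowdeg_all_imp_zero) blast
qed

text \<open>The same homotopy argument in form degree one: without curvature the covariant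
  derivatives commute, so \<delta> of the lowest part of \<open>cov a\<close> vanishes, and the
  factor is l + 1.\<close>

lemma cov_zero_if_contraction:
  assumes F: "\<And>k l. curv k l = 0" and a: "SP a"
    and y: "(\<Sum>k\<in>UNIV. var k * cov k a) = 0"
  shows "cov k a = 0"
proof -
  have "\<forall>k. lowdeg d (cov k a)" for d
  proof (induction d)
    case (Suc d)
    show ?case
    proof (intro allI)
      fix l
      define G where "G k = dy k (cov l a) - dy l (cov k a)" for k
      have "G k = (dx k (cov l a) + poisson (A k) (cov l a)) - (dx l (cov k a) + poisson (A l) (cov k a))"
        for k
        using cov_commutator[OF a, of k l] F[of k l]
        by (simp add: G_def cov_def[of _ "cov _ a"] nab_def algebra_simps)
      then have "lowdeg d (G k)" for k
        using Suc by (simp add: lowdeg_add lowdeg_diff lowdeg_dx lowdeg_poisson_2 lowdeg_A)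
      then have lG: "lowdeg (Suc d) (\<Sum>k\<in>UNIV. var k * G k)"
        by (intro lowdeg_sum lowdeg_var_mult)
      have "(\<Sum>k\<in>UNIV. var k * G k) = eul (cov l a) - (dy l (\<Sum>k\<in>UNIV. var k * cov k a) - cov l a)"
        unfolding G_def right_diff_distrib sum_subtractf eul_def
        by (simp add: contract_dy[of l "\<lambda>k. cov k a"])
      also have "\<dots> = eul (cov l a) + cov l a"
        by (simp add: y)
      finally have "coef (eul (cov l a) + cov l a) J = 0" if "size J \<le> d" for J
        using lowdegD[OF lG, of J] that by simp
      then have "of_nat (Suc (size J)) * coef (cov l a) J = 0" if "size J \<le> d" for J
        using that by (simp add: coef_eul algebra_simps)
      then show "lowdeg (Suc d) (cov l a)"
        unfolding lowdeg_def by (metis coef_zero_of_nat_mult less_Suc_eq_le)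
    qed
  qed simp
  then show ?thesis by (intro lowdeg_all_imp_zero) blast
qed

end

subsection \<open>Inverting the Euler operator\<close>

text \<open>The momentum degree allowed in the connection component with form index
  \<open>k\<close>. Together with the momentum degree of the coordinate y^k it always makes
  one.\<close>

primrec wt :: "'n + 'n \<Rightarrow> nat" where
  "wt (Inl \<alpha>) = 1"
| "wt (Inr \<alpha>) = 0"

text \<open>The right inverse of \<open>eul + c\<close>; for \<open>c = 0\<close> the coefficient of degree 0 is set to 0
  by \<open>x / 0 = 0\<close>.\<close>

definition euinv :: "nat \<Rightarrow> ('i, 'x \<Rightarrow> complex) mfps \<Rightarrow> ('i, 'x \<Rightarrow> complex) mfps" where
  "euinv c a = Mfps (\<lambda>J x. coef a J x / of_nat (c + size J))"

definition const :: "'a \<Rightarrow> ('i, 'a::comm_ring_1) mfps" where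
  "const f = Mfps (\<lambda>J. if J = {#} then f else 0)"

lemma coef_euinv: "coef (euinv c a) J = (\<lambda>x. coef a J x / of_nat (c + size J))"
  by (simp add: euinv_def)

lemma coef_const: "coef (const f) J = (if J = {#} then f else 0)"
  by (simp add: const_def)

lemma euinv_zero [simp]: "euinv c 0 = 0"
  by (rule mfps_eqI) (simp add: coef_euinv zero_fun_def)

lemma lowdeg_euinv: "lowdeg d a \<Longrightarrow> lowdeg d (euinv c a)"
  by (simp add: lowdeg_def coef_euinv zero_fun_def)

lemma euinv_diff: "euinv c a - euinv c b = euinv c (a - b)"
  by (rule mfps_eqI) (simp add: coef_euinv fun_eq_iff diff_divide_distrib)

lemma eul_euinv_1:
  fixes a :: "('i::finite, 'x \<Rightarrow> complex) mfps"
  shows "eul (euinv 1 a) + euinv 1 a = a"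
proof (rule mfps_eqI, rule ext)
  fix J :: "'i multiset" and x
  have "coef (eul (euinv 1 a) + euinv 1 a) J x = of_nat (Suc (size J)) * (coef a J x / of_nat (Suc (size J)))"
    by (simp add: coef_eul coef_euinv distrib_right add_divide_distrib)
  then show "coef (eul (euinv 1 a) + euinv 1 a) J x = coef a J x"
    by (simp del: of_nat_Suc)
qed

lemma eul_euinv_0: "lowdeg 1 a \<Longrightarrow> eul (euinv 0 a) = a"
  by (rule mfps_eqI, rule ext) (auto simp: coef_eul coef_euinv lowdeg_def nonempty_has_size)

text \<open>A derivative lowers the degree in y, so the shift grows. Inductions over
  \<open>fil\<close> differentiate repeatedly and therefore need an arbitrary shift
  \<open>c\<close>.\<close>

lemma dy_euinv: "dy i (euinv c a) = euinv (Suc c) (dy i a)"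
  by (rule mfps_eqI, rule ext) (simp add: coef_dy coef_euinv)

lemma dy_const [simp]: "dy i (const f) = 0"
  by (rule mfps_eqI) (simp add: coef_dy coef_const)

lemma eul_add: "eul (a + b) = eul a + eul b"
  and eul_const [simp]: "eul (const f) = 0"
  and eul_zero [simp]: "eul 0 = 0"
  by (simp_all add: eul_def dy_add dy_diff distrib_left right_diff_distrib sum.distrib sum_subtractf)

lemma eul_sum: "eul (\<Sum>k\<in>K. f k) = (\<Sum>k\<in>K. eul (f k))"
  by (induction K rule: infinite_finite_induct) (auto simp: eul_add)

lemma eul_var_mult: "eul (var k * a) = var k * a + var k * eul a"
proof -
  have "eul (var k * a) = (\<Sum>i\<in>UNIV. (if i = k then var i * a else 0) + var k * (var i * dy i a))"
    unfolding eul_def by (rule sum.cong) (auto simp: dy_mult dy_var algebra_simps)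
  then show ?thesis by (simp add: sum.distrib eul_def sum_distrib_left)
qed

lemma eul_inj:
  assumes "eul a = eul b" "lowdeg 1 a" "lowdeg 1 b"
  shows "a = (b :: ('i::finite, 'x \<Rightarrow> complex) mfps)"
proof (rule mfps_eqI)
  fix J
  show "coef a J = coef b J"
  proof (cases "size J")
    case 0 then show ?thesis using assms(2,3) by (simp add: lowdeg_def)
  next
    case (Suc n)
    have "of_nat (size J) * (coef a J - coef b J) = 0"
      using assms(1) by (simp add: right_diff_distrib coef_eul[symmetric])
    then show ?thesis unfolding Suc using coef_zero_of_nat_mult by (metis eq_iff_diff_eq_0)
  qed
qed

context phase_domain
begin

lemma SP_euinv: "SP a \<Longrightarrow> SP (euinv c a)"
  by (simp add: SP_def coef_euinv csec_divide)

lemma SP_const: "f \<in> csec \<Longrightarrow> SP (const f)"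
  by (simp add: SP_def coef_const)

lemma dx_euinv: "SP a \<Longrightarrow> dx i (euinv c a) = euinv c (dx i a)"
  by (rule mfps_eqI) (simp add: coef_euinv cpart_divide SP_coef)

lemma dx_const: "dx i (const f) = const (cpart i f)"
  by (rule mfps_eqI) (simp add: coef_const)

subsection \<open>Filtration by the order in the momenta\<close>

text \<open>\<open>fil n a\<close>: \<open>a\<close> is polynomial of degree less than \<open>n\<close> in the momenta and the fibre
  coordinates \<open>y\<close> of momentum directions together. The Poisson bracket lowers the degree by one, and a connection form
  has components of degree \<open>wt k\<close>.\<close>

fun fil :: "nat \<Rightarrow> ('n + 'n, 'n phase \<Rightarrow> complex) mfps \<Rightarrow> bool" where
  "fil 0 a \<longleftrightarrow> a = 0"
| "fil (Suc n) a \<longleftrightarrow> (\<forall>\<alpha>. fil n (dy (Inr \<alpha>) a) \<and> fil n (dx (Inr \<alpha>) a))"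

lemma fil_zero [simp]: "fil n 0"
  by (induction n) auto

lemma fil_Suc: "fil n a \<Longrightarrow> fil (Suc n) a"
  by (induction n arbitrary: a) auto

lemma fil_add: "SP a \<Longrightarrow> SP b \<Longrightarrow> fil n a \<Longrightarrow> fil n b \<Longrightarrow> fil n (a + b)"
  by (induction n arbitrary: a b) (auto simp: dy_add dx_add SP_intros)

lemma fil_diff: "SP a \<Longrightarrow> SP b \<Longrightarrow> fil n a \<Longrightarrow> fil n b \<Longrightarrow> fil n (a - b)"
  by (induction n arbitrary: a b) (auto simp: dy_diff dx_diff SP_intros)

lemma fil_sum: "(\<And>k. k \<in> K \<Longrightarrow> SP (f k) \<and> fil n (f k)) \<Longrightarrow> fil n (\<Sum>k\<in>K. f k)"
  by (induction K rule: infinite_finite_induct) (auto simp: fil_add SP_sum)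

lemma fil_dy: "SP a \<Longrightarrow> fil n a \<Longrightarrow> fil n (dy i a)"
proof (induction n arbitrary: a)
  case (Suc n)
  then show ?case by (simp add: dx_dy SP_intros) (metis dy_commute SP_dy)
qed simp

lemma fil_dx: "SP a \<Longrightarrow> fil n a \<Longrightarrow> fil n (dx i a)"
proof (induction n arbitrary: a)
  case (Suc n)
  then show ?case by (simp add: dx_dy[symmetric] SP_intros) (metis dx_commute SP_dx)
qed simp

lemma fil_euinv: "SP a \<Longrightarrow> fil n a \<Longrightarrow> fil n (euinv c a)"
  by (induction n arbitrary: a c) (auto simp: dy_euinv dx_euinv SP_intros)

text \<open>\<open>fil (Suc m)\<close> means degree at most \<open>m\<close>. The Leibniz rule
  differentiates one factor and lowers \<open>m + n\<close>; a factor of degree zero has derivative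
  in \<open>fil 0\<close>, that is, zero.\<close>

lemma fil_mult:
  "SP a \<Longrightarrow> SP b \<Longrightarrow> fil (Suc m) a \<Longrightarrow> fil (Suc n) b \<Longrightarrow> fil (Suc (m + n)) (a * b)"
proof (induction "m + n" arbitrary: m n a b rule: less_induct)
  case less
  have 1: "fil (m + n) (a' * b)" if "fil m a'" "SP a'" for a'
  proof (cases m)
    case (Suc m')
    then show ?thesis using less.hyps[of m' n a' b] less.prems that by auto
  qed (use that in simp)
  have 2: "fil (m + n) (a * b')" if "fil n b'" "SP b'" for b'
  proof (cases n)
    case (Suc n')
    then show ?thesis using less.hyps[of m n' a b'] less.prems that by auto
  qed (use that in simp)
  show ?case
    using less.prems by (auto simp: dy_mult dx_mult intro!: fil_add 1 2 SP_intros)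
qed

lemma fil_poisson:
  assumes "SP a" "SP b" "fil (Suc m) a" "fil (Suc n) b"
  shows "fil (m + n) (poisson a b)"
proof -
  have 1: "fil (m + n) (a' * b')" if "fil m a'" "SP a'" "fil (Suc n) b'" "SP b'" for a' b'
    using that fil_mult[of a' b' "m - 1" n] by (cases m) auto
  have 2: "fil (m + n) (a' * b')" if "fil (Suc m) a'" "SP a'" "fil n b'" "SP b'" for a' b'
    using that fil_mult[of a' b' m "n - 1"] by (cases n) auto
  show ?thesis
    unfolding poisson_def
    using assms(1,2) assms(3,4)[unfolded fil.simps(2)] fil_dy[OF assms(1,3)] fil_dy[OF assms(2,4)]
    by (intro fil_sum conjI fil_diff SP_intros 1[where a' = "dy (Inr _) a"] 2[where a' = "dy (Inl _) a"])
      (simp_all del: fil.simps add: SP_intros)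
qed

text \<open>A position coordinate keeps the degree and a momentum coordinate raises it by one;
  \<open>wt k\<close> puts both cases into one formula.\<close>

lemma fil_var_mult:
  assumes "SP b" "fil (n + wt k) b"
  shows "fil (Suc n) (var k * b)"
proof (cases k)
  case (Inl \<alpha>)
  have "SP b \<Longrightarrow> fil m b \<Longrightarrow> fil m (var (Inl \<alpha>) * b)" for m b
    by (induction m arbitrary: b) (auto simp: dy_mult dy_var dx_var_mult SP_intros)
  with assms Inl show ?thesis by (simp del: fil.simps)
next
  case (Inr \<alpha>)
  have "SP b \<Longrightarrow> fil m b \<Longrightarrow> fil (Suc m) (var (Inr \<alpha>) * b)" for m b
  proof (induction m arbitrary: b)
    case (Suc m)
    have "fil (Suc m) (dx (Inr \<beta>) (var (Inr \<alpha>) * b))" for \<beta>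
      using Suc by (simp only: dx_var_mult) (simp add: SP_intros)
    moreover have "fil (Suc m) (dy (Inr \<beta>) (var (Inr \<alpha>) * b))" for \<beta>
      unfolding dy_mult
    proof (rule fil_add)
      show "fil (Suc m) (var (Inr \<alpha>) * dy (Inr \<beta>) b)"
        using Suc by (simp only: fil.simps(2)[of m b]) (simp add: SP_intros)
    qed (use Suc in \<open>auto simp: dy_var SP_intros simp del: fil.simps\<close>)
    ultimately show ?case by (subst fil.simps(2)) blast
  qed simp
  with assms Inr show ?thesis by (simp del: fil.simps)
qed

text \<open>The bound is a vanishing condition on derivatives, and these are y-adically continuous.
  Each \<open>dy\<close> costs one order of approximation.\<close>

lemma fil_closed:
  "(\<And>d. \<exists>v. fil n v \<and> lowdeg d (u - v)) \<Longrightarrow> fil n u"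
proof (induction n arbitrary: u)
  case 0
  then show ?case by (auto intro: lowdeg_all_imp_zero)
next
  case (Suc n)
  have "\<exists>v. fil n v \<and> lowdeg d (dy (Inr \<alpha>) u - v)" for d \<alpha>
  proof -
    obtain v where "fil (Suc n) v" "lowdeg (Suc d) (u - v)" using Suc.prems by blast
    then show ?thesis by (intro exI[of _ "dy (Inr \<alpha>) v"]) (simp add: dy_diff[symmetric] lowdeg_dy)
  qed
  moreover have "\<exists>v. fil n v \<and> lowdeg d (dx (Inr \<alpha>) u - v)" for d \<alpha>
  proof -
    obtain v where "fil (Suc n) v" "lowdeg d (u - v)" using Suc.prems by blast
    then show ?thesis by (intro exI[of _ "dx (Inr \<alpha>) v"]) (auto simp: lowdeg_def)
  qed
  ultimately show ?case using Suc.IH by simp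
qed

lemma SP_closed: "(\<And>d. \<exists>v. SP v \<and> lowdeg d (u - v)) \<Longrightarrow> SP u"
  unfolding SP_def by (metis coef_diff eq_iff_diff_eq_0 lessI lowdegD)

lemma lowdeg_closed: "(\<And>d. \<exists>v. lowdeg e v \<and> lowdeg d (u - v)) \<Longrightarrow> lowdeg e u"
  unfolding lowdeg_def by (metis coef_diff eq_iff_diff_eq_0 lessI)

subsection \<open>Existence of flat connections and flat sections\<close>

text \<open>\<open>hom\<close> and \<open>sym\<close> say that \<open>g\<close> is quadratic in y
  and \<delta>-closed, as for a totally symmetric \<gamma>. With r = A - g, the last two conclusions
  are the degree condition and the normalisation \<delta>^-1 r = 0 of the Abelian series.\<close>

lemma flat_connection_exists:
  assumes SPg: "\<And>l. SP (g l)" and hom: "\<And>l. eul (g l) = g l + g l"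
    and sym: "\<And>k l. dy l (g k) = dy k (g l)" and filg: "\<And>l. fil (Suc (wt l)) (g l)"
    and lowg: "\<And>l. lowdeg 2 (g l)"
  obtains A where "weyl_connection D A" "\<And>k l. weyl_connection.curv D A k l = 0"
    "\<And>l. fil (Suc (wt l)) (A l)" "\<And>l. lowdeg 3 (A l - g l)"
    "(\<Sum>l\<in>UNIV. var l * (A l - g l)) = 0"
proof -
  define T where "T A k l = dx k (A l) - dx l (A k) + poisson (A k) (A l)" for A k l
  \<comment> \<open>Contracting zero curvature with y^k gives \<open>eul (A l) + A l\<close> =
    d/dy^l of y^k A_k, plus the contraction of \<open>T\<close>. The normalisation replaces y^k A_k
    by the cubic y^k g_k, whose derivative is \<open>g l + eul (g l)\<close>, three times
    \<open>g l\<close>.\<close>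
  define \<Psi> where "\<Psi> A l = euinv 1 (g l + g l + g l + (\<Sum>k\<in>UNIV. var k * T A k l))" for A l
  define Inv where "Inv A \<longleftrightarrow> (\<forall>l. SP (A l) \<and> lowdeg 2 (A l) \<and> fil (Suc (wt l)) (A l))"
    for A :: "'n + 'n \<Rightarrow> ('n + 'n, 'n phase \<Rightarrow> complex) mfps"
  have SPT: "SP (T A k l)" if "Inv A" for A k l
    using that by (simp add: Inv_def T_def SP_intros)
  have lowT: "lowdeg 2 (T A k l)" if "Inv A" for A k l
    using that by (simp add: Inv_def T_def lowdeg_add lowdeg_diff lowdeg_dx lowdeg_poisson_2)
  \<comment> \<open>A derivative in a momentum direction lowers the degree, where
    \<open>wt k\<close> is 0; in a position direction it does not, where \<open>wt k\<close> is
    1.\<close>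
  have fil_dx': "fil (wt l + wt k) (dx k a)" if "SP a" "fil (Suc (wt l)) a" for a and k l :: "'n + 'n"
    using that fil_dx[of a "Suc (wt l)" k] by (cases k) auto
  have filT: "fil (wt l + wt k) (T A k l)" if "Inv A" for A k l
    unfolding T_def using that fil_poisson[of "A k" "A l" "wt k" "wt l"] fil_dx'[of "A l" l k]
      fil_dx'[of "A k" k l]
    by (intro fil_add fil_diff SP_intros) (auto simp: Inv_def add.commute)
  obtain A where A: "Inv A" "\<Psi> A = A"
  proof (rule mfps_fixpoint[of Inv "\<lambda>_. 0" \<Psi>])
    show "Inv (\<lambda>_. 0)" by (simp add: Inv_def)
  next
    fix A assume A: "Inv A"
    have "lowdeg 2 (\<Sum>k\<in>UNIV. var k * T A k l)" for l
      by (rule lowdeg_mono[of 3], unfold numeral_3_eq_3)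
        (use lowT[OF A] in \<open>auto simp: numeral_2_eq_2 intro!: lowdeg_sum lowdeg_var_mult\<close>)
    moreover have "fil (Suc (wt l)) (\<Sum>k\<in>UNIV. var k * T A k l)" for l
      using filT[OF A] SPT[OF A]
      by (intro fil_sum conjI fil_var_mult SP_intros) auto
    ultimately show "Inv (\<Psi> A)"
      using SPT[OF A] unfolding Inv_def \<Psi>_def
      by (intro allI conjI SP_euinv lowdeg_euinv fil_euinv lowdeg_add fil_add SP_intros SPg filg lowg) auto
  next
    fix d A B l
    assume A: "Inv A" and B: "Inv B" and AB: "\<And>k. lowdeg d (A k - B k)"
    have "T A k l - T B k l = dx k (A l - B l) - dx l (A k - B k) + poisson (A k - B k) (A l) +
        poisson (B k) (A l - B l)" for k
      using A B by (simp add: T_def Inv_def dx_diff poisson_diff_left poisson_diff_right)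
    then have "lowdeg d (T A k l - T B k l)" for k
      using A B AB by (simp add: Inv_def lowdeg_add lowdeg_diff lowdeg_dx lowdeg_poisson_2 lowdeg_poisson_2')
    then have "lowdeg (Suc d) (\<Sum>k\<in>UNIV. var k * (T A k l - T B k l))"
      by (intro lowdeg_sum lowdeg_var_mult)
    then show "lowdeg (Suc d) (\<Psi> A l - \<Psi> B l)"
      by (simp add: \<Psi>_def euinv_diff lowdeg_euinv right_diff_distrib sum_subtractf)
  next
    fix A assume *: "\<And>d. \<exists>v. Inv v \<and> (\<forall>k. lowdeg d (A k - v k))"
    have "\<exists>v. (SP v \<and> lowdeg 2 v \<and> fil (Suc (wt l)) v) \<and> lowdeg d (A l - v)" for d l
      using *[of d] unfolding Inv_def by blast
    then show "Inv A"
      unfolding Inv_def by (intro allI conjI SP_closed lowdeg_closed fil_closed) meson+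
  qed
  interpret W: weyl_connection D A
    by unfold_locales (use A(1) in \<open>auto simp: Inv_def\<close>)
  let ?Y = "\<lambda>l. \<Sum>k\<in>UNIV. var k * T A k l"
  have eq: "eul (A l) + A l = g l + g l + g l + ?Y l" for l
    using eul_euinv_1[of "g l + g l + g l + ?Y l"] fun_cong[OF A(2), of l] by (simp add: \<Psi>_def)
  have Tanti: "T A l k = - T A k l" for k l
    using poisson_antisym[of "A l" "A k"] by (simp add: T_def)
  \<comment> \<open>y^k y^l is symmetric and \<open>T\<close> antisymmetric, so the double
    contraction is its own negative; the coefficients are complex-valued, so it vanishes.\<close>
  have YY: "(\<Sum>l\<in>UNIV. var l * ?Y l) = 0"
  proof -
    define s where "s = (\<Sum>l\<in>UNIV. var l * ?Y l)"
    have e: "s = (\<Sum>l\<in>UNIV. \<Sum>k\<in>UNIV. var l * (var k * T A k l))"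
      by (simp add: s_def sum_distrib_left)
    also have "\<dots> = (\<Sum>k\<in>UNIV. \<Sum>l\<in>UNIV. var l * (var k * T A k l))"
      by (rule sum.swap)
    also have "\<dots> = - s"
      unfolding e sum_negf[symmetric]
      by (intro sum.cong refl) (subst Tanti, simp add: mult.left_commute)
    finally have "s = - s" .
    then have "coef s J x + coef s J x = 0" for J x
      by (metis (no_types) add.right_inverse coef_minus uminus_apply)
    then have "s = 0" by (intro mfps_eqI ext) simp
    then show ?thesis by (simp add: s_def)
  qed
  \<comment> \<open>The normalisation is not built into \<open>\<Psi>\<close>. It follows from the
    contracted fixed point equation: \<open>eul SA\<close> and \<open>eul Sg\<close> are both three
    times \<open>Sg\<close>, and \<open>eul\<close> is injective on series without constant
    term.\<close>
  define SA Sg where "SA = (\<Sum>l\<in>UNIV. var l * A l)" and "Sg = (\<Sum>l\<in>UNIV. var l * g l)"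
  have "eul SA = (\<Sum>l\<in>UNIV. var l * (eul (A l) + A l))"
    unfolding SA_def eul_sum eul_var_mult by (simp add: algebra_simps)
  also have "\<dots> = Sg + Sg + Sg"
    unfolding eq distrib_left sum.distrib YY Sg_def by simp
  also have "\<dots> = eul Sg"
    unfolding Sg_def eul_sum eul_var_mult hom
    by (simp only: distrib_left sum.distrib add.assoc)
  finally have "SA = Sg"
    by (rule eul_inj) (use A(1) lowg in \<open>auto simp: SA_def Sg_def Inv_def
        intro!: lowdeg_sum lowdeg_mono[OF lowdeg_var_mult]\<close>)
  then have S: "(\<Sum>k\<in>UNIV. var k * A k) = (\<Sum>k\<in>UNIV. var k * g k)"
    by (simp add: SA_def Sg_def)
  have "(\<Sum>k\<in>UNIV. var k * W.curv k l) = 0" for l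
  proof -
    have "W.curv k l = T A k l - dy k (A l) + dy l (A k)" for k
      by (simp add: W.curv_def nab_def T_def)
    then have "(\<Sum>k\<in>UNIV. var k * W.curv k l) =
        ?Y l - eul (A l) + (dy l (\<Sum>k\<in>UNIV. var k * A k) - A l)"
      by (simp add: distrib_left right_diff_distrib sum.distrib sum_subtractf eul_def contract_dy[of l A])
    also have "dy l (\<Sum>k\<in>UNIV. var k * A k) = g l + eul (g l)"
      unfolding S using contract_dy[of l g] by (simp add: sym[of l] eul_def)
    finally have "(\<Sum>k\<in>UNIV. var k * W.curv k l) =
        (g l + g l + g l + ?Y l) - (eul (A l) + A l)"
      by (simp add: hom algebra_simps)
    then show ?thesis by (simp only: eq diff_self)
  qed
  then have F: "W.curv k l = 0" for k l
    by (rule W.curv_zero_if_contraction)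
  have "lowdeg 3 (A l - g l)" for l
  proof -
    \<comment> \<open>Homogeneity of degree two turns \<open>eul + 1\<close> into multiplication by
      3. So \<open>A l - g l\<close> comes from the contraction term only, which has order
      three.\<close>
    have gl: "g l = euinv 1 (g l + g l + g l)"
    proof (rule mfps_eqI, rule ext)
      fix J x
      have "of_nat (Suc (size J)) * coef (g l) J x = coef (eul (g l)) J x + coef (g l) J x"
        by (simp add: coef_eul distrib_right)
      also have "\<dots> = coef (g l + g l + g l) J x"
        unfolding hom by (simp only: coef_add plus_fun_apply)
      finally have "of_nat (Suc (size J)) * coef (g l) J x = coef (g l + g l + g l) J x" .
      then show "coef (g l) J x = coef (euinv 1 (g l + g l + g l)) J x"
        by (simp add: coef_euinv nonzero_eq_divide_eq mult.commute del: of_nat_Suc coef_add)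
    qed
    have "A l - g l = euinv 1 (?Y l)"
      by (subst gl, subst A(2)[symmetric]) (simp add: \<Psi>_def euinv_diff)
    moreover have "lowdeg 3 (?Y l)"
      unfolding numeral_3_eq_3
      using lowT[OF A(1)] by (auto simp: numeral_2_eq_2 intro!: lowdeg_sum lowdeg_var_mult)
    ultimately show ?thesis by (simp add: lowdeg_euinv)
  qed
  then show thesis
    using A(1) S F by (intro that[of A] W.weyl_connection_axioms)
      (auto simp: Inv_def right_diff_distrib sum_subtractf)
qed

end

context weyl_connection
begin

text \<open>Contracting \<open>cov k a = 0\<close> with y^k gives an equation for
  \<open>eul a\<close>, which leaves the constant term free for \<open>f\<close>. Its solution is
  flat because the curvature vanishes.\<close>

lemma flat_section_exists:
  assumes F: "\<And>k l. curv k l = 0" and filA: "\<And>l. fil (Suc (wt l)) (A l)"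
    and f: "f \<in> csec" "fil (Suc n) (const f)"
  obtains a where "SP a" "fil (Suc n) a" "coef a {#} = f" "\<And>k. cov k a = 0"
proof -
  define T where "T k a = dx k a + poisson (A k) a" for k a
  \<comment> \<open>\<open>mfps_fixpoint\<close> treats families, so the single series is a family
    over \<open>unit\<close>. Division by zero makes \<open>euinv 0\<close> drop degree
    zero.\<close>
  define \<Psi> where "\<Psi> u l = const f + euinv 0 (\<Sum>k\<in>UNIV. var k * T k (u l))" for u and l :: unit
  define Inv where "Inv u \<longleftrightarrow> (\<forall>l. SP (u l) \<and> fil (Suc n) (u l))"
    for u :: "unit \<Rightarrow> ('n + 'n, 'n phase \<Rightarrow> complex) mfps"
  have SPT: "SP (T k a)" if "SP a" for a k
    using that by (simp add: T_def SP_intros SP_A)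
  have filT: "fil (n + wt k) (T k a)" if "SP a" "fil (Suc n) a" for a k
    unfolding T_def
  proof (rule fil_add)
    show "fil (n + wt k) (dx k a)"
      using that fil_dx[of a "Suc n" k] by (cases k) auto
    show "fil (n + wt k) (poisson (A k) a)"
      using fil_poisson[OF SP_A that(1) filA that(2)] by (simp add: add.commute)
  qed (use that in \<open>auto intro!: SP_intros SP_A\<close>)
  obtain u where u: "Inv u" "\<Psi> u = u"
  proof (rule mfps_fixpoint[of Inv "\<lambda>_. 0" \<Psi>])
    show "Inv (\<lambda>_. 0)" by (simp add: Inv_def)
  next
    fix u assume "Inv u"
    then show "Inv (\<Psi> u)"
      unfolding Inv_def \<Psi>_def using SPT filT
      by (intro allI conjI SP_intros SP_const SP_euinv fil_add fil_euinv f fil_sum fil_var_mult) auto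
  next
    fix d u v l
    assume u: "Inv u" and v: "Inv v" and uv: "\<And>k. lowdeg d (u k - v k)"
    have "T k (u l) - T k (v l) = dx k (u l - v l) + poisson (A k) (u l - v l)" for k
      using u v by (simp add: T_def Inv_def dx_diff poisson_diff_right)
    then have "lowdeg d (T k (u l) - T k (v l))" for k
      by (simp add: lowdeg_add lowdeg_dx lowdeg_poisson_2 lowdeg_A uv)
    then have "lowdeg (Suc d) (\<Sum>k\<in>UNIV. var k * (T k (u l) - T k (v l)))"
      by (intro lowdeg_sum lowdeg_var_mult)
    then show "lowdeg (Suc d) (\<Psi> u l - \<Psi> v l)"
      by (simp add: \<Psi>_def euinv_diff lowdeg_euinv right_diff_distrib sum_subtractf)
  next
    fix u assume *: "\<And>d. \<exists>v. Inv v \<and> (\<forall>k. lowdeg d (u k - v k))"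
    have "\<exists>v. (SP v \<and> fil (Suc n) v) \<and> lowdeg d (u l - v)" for d l
      using *[of d] unfolding Inv_def by blast
    then show "Inv u"
      unfolding Inv_def by (intro allI conjI SP_closed fil_closed) meson+
  qed
  define a where "a = u ()"
  have a: "SP a" "fil (Suc n) a" using u(1) by (auto simp: a_def Inv_def)
  have aeq: "a = const f + euinv 0 (\<Sum>k\<in>UNIV. var k * T k a)"
    using fun_cong[OF u(2), of "()"] by (simp add: a_def \<Psi>_def)
  have low: "lowdeg 1 (\<Sum>k\<in>UNIV. var k * T k a)"
    unfolding One_nat_def by (intro lowdeg_sum lowdeg_var_mult) simp
  have "eul a = (\<Sum>k\<in>UNIV. var k * T k a)"
    by (subst aeq) (simp add: eul_add eul_euinv_0[OF low])
  then have "(\<Sum>k\<in>UNIV. var k * cov k a) = 0"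
    by (simp add: cov_def nab_def T_def eul_def algebra_simps sum.distrib sum_subtractf)
  then have "cov k a = 0" for k
    by (rule cov_zero_if_contraction[OF F a(1)])
  moreover have "coef a {#} = f"
    by (subst aeq) (simp add: coef_const coef_euinv fun_eq_iff)
  ultimately show thesis using that a by blast
qed

end

section \<open>The Weyl bundle\<close>

lemma sum_fun_apply: "(\<Sum>i\<in>I. f i) x = (\<Sum>i\<in>I. f i x)"
  by (induction I rule: infinite_finite_induct) auto

lemma sum_sum_type:
  "(\<Sum>i\<in>UNIV. f i) = (\<Sum>\<alpha>\<in>UNIV. f (Inl \<alpha>)) + (\<Sum>\<alpha>\<in>UNIV. f (Inr \<alpha>))"
  for f :: "'a::finite + 'b::finite \<Rightarrow> 'c::comm_monoid_add"
  unfolding UNIV_Plus_UNIV[symmetric] by (subst sum.Plus) (simp_all add: comp_def)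

lemma sum_omega_inv:
  fixes f :: "'n::finite + 'n \<Rightarrow> 'n + 'n \<Rightarrow> complex"
  shows "(\<Sum>i\<in>UNIV. \<Sum>j\<in>UNIV. complex_of_real (omega_inv i j) * f i j) =
    (\<Sum>\<alpha>\<in>UNIV. f (Inr \<alpha>) (Inl \<alpha>) - f (Inl \<alpha>) (Inr \<alpha>))"
  by (simp add: sum_sum_type omega_inv_def sum.distrib sum_subtractf if_distrib[of uminus]
      if_distrib[of complex_of_real] if_distrib[of "\<lambda>x. x * _"] sum.delta' sum_negf
      cong: if_cong)

lemma omega_inv_antisym: "omega_inv i j = - omega_inv j i"
  by (cases i; cases j) (auto simp: omega_inv_def)

subsection \<open>The Weyl product\<close>

lemma pointwise_mult_commute: "pointwise_mult a b = pointwise_mult b a"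
proof (intro ext)
  fix k J x
  have "pointwise_mult a b k J x = (\<Sum>m\<le>k. \<Sum>L | L \<subseteq># J. a (k - m) L x * b m (J - L) x)"
    unfolding pointwise_mult_def
    by (rule sum.reindex_bij_witness[where i = "\<lambda>m. k - m" and j = "\<lambda>m. k - m"]) auto
  also have "\<dots> = pointwise_mult b a k J x"
    unfolding pointwise_mult_def
    by (rule sum.cong[OF refl],
        subst sum_submultisets_complement[where F = "\<lambda>L M. a _ L x * b _ M x"])
      (simp add: mult.commute)
  finally show "pointwise_mult a b k J x = pointwise_mult b a k J x" .
qed

text \<open>Each contraction contributes one antisymmetric factor. Linearity in the second argument
  is reduced to linearity in the first in this way.\<close>

lemma bidiff_swap: "bidiff t a b k J x = (- 1) ^ t * bidiff t b a k J x"
proof (induction t arbitrary: a b)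
  case 0
  then show ?case by (simp add: pointwise_mult_commute)
next
  case (Suc t)
  have "bidiff (Suc t) a b k J x = (\<Sum>j\<in>UNIV. \<Sum>i\<in>UNIV.
      complex_of_real (omega_inv i j) * bidiff t (deriv_y i a) (deriv_y j b) k J x)"
    unfolding bidiff.simps by (rule sum.swap)
  also have "\<dots> = (\<Sum>j\<in>UNIV. \<Sum>i\<in>UNIV.
      (- 1) ^ Suc t * (complex_of_real (omega_inv j i) * bidiff t (deriv_y j b) (deriv_y i a) k J x))"
  proof (intro sum.cong refl)
    fix i j
    show "complex_of_real (omega_inv i j) * bidiff t (deriv_y i a) (deriv_y j b) k J x =
        (- 1) ^ Suc t * (complex_of_real (omega_inv j i) * bidiff t (deriv_y j b) (deriv_y i a) k J x)"
      unfolding Suc.IH[of "deriv_y i a"] omega_inv_antisym[of i j] by simp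
  qed
  also have "\<dots> = (- 1) ^ Suc t * bidiff (Suc t) b a k J x"
    by (simp add: sum_distrib_left)
  finally show ?case .
qed

lemma deriv_y_diff: "deriv_y i (a - b) = deriv_y i a - deriv_y i b"
  and deriv_y_add: "deriv_y i (a + b) = deriv_y i a + deriv_y i b"
  by (simp_all add: deriv_y_def fun_eq_iff algebra_simps)

lemma bidiff_diff_left: "bidiff t (a - a') b = bidiff t a b - bidiff t a' b"
proof (induction t arbitrary: a a' b)
  case 0
  show ?case by (simp add: pointwise_mult_def fun_eq_iff left_diff_distrib sum_subtractf)
qed (simp add: deriv_y_diff fun_eq_iff right_diff_distrib sum_subtractf)

lemma bidiff_add_left: "bidiff t (a + a') b = bidiff t a b + bidiff t a' b"
proof (induction t arbitrary: a a' b)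
  case 0
  show ?case by (simp add: pointwise_mult_def fun_eq_iff distrib_right sum.distrib)
qed (simp add: deriv_y_add fun_eq_iff distrib_left sum.distrib)

lemma bidiff_diff_right: "bidiff t b (a - a') = bidiff t b a - bidiff t b a'"
  by (intro ext) (simp add: bidiff_swap[of t b] bidiff_diff_left right_diff_distrib)

lemma bidiff_add_right: "bidiff t b (a + a') = bidiff t b a + bidiff t b a'"
  by (intro ext) (simp add: bidiff_swap[of t b] bidiff_add_left distrib_left)

lemma weyl_prod_diff_left: "weyl_prod (a - a') b = weyl_prod a b - weyl_prod a' b"
  and weyl_prod_diff_right: "weyl_prod b (a - a') = weyl_prod b a - weyl_prod b a'"
  and weyl_prod_add_left: "weyl_prod (a + a') b = weyl_prod a b + weyl_prod a' b"
  and weyl_prod_add_right: "weyl_prod b (a + a') = weyl_prod b a + weyl_prod b a'"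
  by (simp_all add: weyl_prod_def bidiff_diff_left bidiff_diff_right bidiff_add_left bidiff_add_right
      fun_eq_iff right_diff_distrib distrib_left sum_subtractf sum.distrib)

lemma i_over_hbar_add: "i_over_hbar (a + b) = i_over_hbar a + i_over_hbar b"
  and i_over_hbar_diff: "i_over_hbar (a - b) = i_over_hbar a - i_over_hbar b"
  by (simp_all add: i_over_hbar_def fun_eq_iff algebra_simps)

text \<open>\<open>i_over_hbar\<close> discards the hbar^0 coefficient. In a commutator that
  coefficient is zero by \<open>pointwise_mult_commute\<close>, so nothing is lost.\<close>

definition weyl_comm where "weyl_comm a b = i_over_hbar (weyl_prod a b - weyl_prod b a)"

lemma weyl_comm_add_left: "weyl_comm (a + a') b = weyl_comm a b + weyl_comm a' b"
  and weyl_comm_diff_left: "weyl_comm (a - a') b = weyl_comm a b - weyl_comm a' b"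
  and weyl_comm_diff_right: "weyl_comm b (a - a') = weyl_comm b a - weyl_comm b a'"
  unfolding weyl_comm_def weyl_prod_diff_left weyl_prod_diff_right weyl_prod_add_left
    weyl_prod_add_right i_over_hbar_diff i_over_hbar_add by (simp_all add: algebra_simps)

lemma i_over_hbar_prod11: "i_over_hbar (prod11 A A k l) = weyl_comm (A k) (A l)"
  by (simp add: prod11_def weyl_comm_def)

lemma i_over_hbar_comm11:
  "i_over_hbar (comm11 A B k l) = weyl_comm (A k) (B l) - weyl_comm (A l) (B k)"
  by (simp add: comm11_def prod11_def weyl_comm_def i_over_hbar_add i_over_hbar_diff algebra_simps)

lemma i_over_hbar_comm10: "i_over_hbar (comm10 A a k) = weyl_comm (A k) a"
  by (simp add: comm10_def weyl_comm_def)

subsection \<open>Equality on a domain\<close>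

text \<open>Congruence on a domain is required because \<open>gamma_form\<close> is not cut off: it
  agrees with its classical counterpart on \<open>D\<close> only.\<close>

lemma deriv_y_cong: "weyl_eq_on D a a' \<Longrightarrow> weyl_eq_on D (deriv_y i a) (deriv_y i a')"
  by (simp add: weyl_eq_on_def deriv_y_def)

lemma bidiff_cong:
  "weyl_eq_on D a a' \<Longrightarrow> weyl_eq_on D b b' \<Longrightarrow> weyl_eq_on D (bidiff t a b) (bidiff t a' b')"
proof (induction t arbitrary: a a' b b')
  case 0
  then show ?case by (simp add: weyl_eq_on_def pointwise_mult_def)
next
  case (Suc t)
  have "weyl_eq_on D (bidiff t (deriv_y i a) (deriv_y j b)) (bidiff t (deriv_y i a') (deriv_y j b'))"
    for i j
    by (intro Suc.IH deriv_y_cong Suc.prems)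
  then show ?case by (simp add: weyl_eq_on_def)
qed

lemma weyl_prod_cong:
  assumes "weyl_eq_on D a a'" "weyl_eq_on D b b'"
  shows "weyl_eq_on D (weyl_prod a b) (weyl_prod a' b')"
  using bidiff_cong[OF assms] by (simp add: weyl_eq_on_def weyl_prod_def)

lemma weyl_eq_on_refl: "weyl_eq_on D a a"
  and weyl_eq_on_sym: "weyl_eq_on D a b \<Longrightarrow> weyl_eq_on D b a"
  and weyl_eq_on_trans: "weyl_eq_on D a b \<Longrightarrow> weyl_eq_on D b c \<Longrightarrow> weyl_eq_on D a c"
  and weyl_eq_on_add: "weyl_eq_on D a a' \<Longrightarrow> weyl_eq_on D b b' \<Longrightarrow> weyl_eq_on D (a + b) (a' + b')"
  and weyl_eq_on_diff: "weyl_eq_on D a a' \<Longrightarrow> weyl_eq_on D b b' \<Longrightarrow> weyl_eq_on D (a - b) (a' - b')"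
  by (simp_all add: weyl_eq_on_def)

lemma weyl_comm_cong:
  "weyl_eq_on D a a' \<Longrightarrow> weyl_eq_on D b b' \<Longrightarrow> weyl_eq_on D (weyl_comm a b) (weyl_comm a' b')"
  using weyl_prod_cong[of D a a' b b'] weyl_prod_cong[of D b b' a a']
  by (simp add: weyl_comm_def i_over_hbar_def weyl_eq_on_def)

lemma deriv_x_cong:
  assumes "open D" "weyl_eq_on D a a'" shows "weyl_eq_on D (deriv_x i a) (deriv_x i a')"
  unfolding weyl_eq_on_def deriv_x_def partial_def
proof (intro allI ballI)
  fix k J x assume "x \<in> D"
  then show "frechet_derivative (a k J) (at x) (axis i 1) = frechet_derivative (a' k J) (at x) (axis i 1)"
    using frechet_derivative_cong_open[OF assms(1), of x "a k J" "a' k J"] assms(2)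
    by (simp add: weyl_eq_on_def)
qed

subsection \<open>Degree\<close>

text \<open>Fedosov's degree, with hbar counted twice: each order of the product gains one hbar and
  loses two fibre derivatives.\<close>

definition weyl_low :: "'n::finite phase set \<Rightarrow> nat \<Rightarrow> 'n weyl \<Rightarrow> bool" where
  "weyl_low D d a \<longleftrightarrow> (\<forall>k J. 2 * k + size J < d \<longrightarrow> (\<forall>x\<in>D. a k J x = 0))"

lemma weyl_low_0 [simp]: "weyl_low D 0 a"
  and weyl_low_add: "weyl_low D d a \<Longrightarrow> weyl_low D d b \<Longrightarrow> weyl_low D d (a + b)"
  and weyl_low_diff: "weyl_low D d a \<Longrightarrow> weyl_low D d b \<Longrightarrow> weyl_low D d (a - b)"
  and weyl_low_eq: "weyl_eq_on D a b \<Longrightarrow> weyl_low D d b \<Longrightarrow> weyl_low D d a"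
  by (auto simp: weyl_low_def weyl_eq_on_def)

lemma weyl_low_deriv_y: "weyl_low D d a \<Longrightarrow> weyl_low D (d - 1) (deriv_y i a)"
  by (auto simp: weyl_low_def deriv_y_def)

lemma bidiff_low:
  assumes "weyl_low D d a" "weyl_low D e b" "2 * k + size J + 2 * t < d + e" "x \<in> D"
  shows "bidiff t a b k J x = 0"
  using assms(1,2,3)
proof (induction t arbitrary: a b d e)
  case 0
  have "a m L x * b (k - m) (J - L) x = 0" if "m \<le> k" "L \<subseteq># J" for m L
  proof -
    have "size J = size L + size (J - L)"
      using that by (metis size_union subset_mset.add_diff_inverse)
    then have "2 * m + size L < d \<or> 2 * (k - m) + size (J - L) < e"
      using 0 that by linarith
    then show ?thesis using 0 assms(4) by (auto simp: weyl_low_def)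
  qed
  then show ?case by (auto simp: pointwise_mult_def intro!: sum.neutral)
next
  case (Suc t)
  have "bidiff t (deriv_y i a) (deriv_y j b) k J x = 0" for i j
  proof (rule Suc.IH[OF weyl_low_deriv_y[OF Suc.prems(1)] weyl_low_deriv_y[OF Suc.prems(2)]])
    \<comment> \<open>Truncated subtraction does no harm: \<open>d - 1 + (e - 1)\<close> is at least
      \<open>d + e - 2\<close>.\<close>
    have "2 * k + size J + 2 * t + 2 < d + e" using Suc.prems(3) by simp
    then show "2 * k + size J + 2 * t < d - 1 + (e - 1)" by linarith
  qed
  then show ?case by simp
qed

lemma weyl_low_prod:
  fixes a b :: "'n::finite weyl"
  assumes "weyl_low D d a" "weyl_low D e b" shows "weyl_low D (d + e) (weyl_prod a b)"
  unfolding weyl_low_def weyl_prod_def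
proof (intro allI impI ballI sum.neutral)
  fix k t x and J :: "('n + 'n) multiset"
  assume "2 * k + size J < d + e" "x \<in> D" "t \<in> {..k}"
  then have "bidiff t a b (k - t) J x = 0"
    by (intro bidiff_low[OF assms]) auto
  then show "(- \<i> / 2) ^ t / fact t * bidiff t a b (k - t) J x = 0" by simp
qed

lemma weyl_low_i_over_hbar: "weyl_low D (Suc (Suc d)) a \<Longrightarrow> weyl_low D d (i_over_hbar a)"
  by (simp add: weyl_low_def i_over_hbar_def)

text \<open>Division by hbar costs degree two, which the factor \<open>a\<close> supplies.\<close>

lemma weyl_low_comm:
  assumes "weyl_low D 2 a" "weyl_low D d b"
  shows "weyl_low D d (weyl_comm a b)" "weyl_low D d (weyl_comm b a)"
  unfolding weyl_comm_def
  using weyl_low_prod[OF assms] weyl_low_prod[OF assms(2,1)]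
  by (auto intro!: weyl_low_i_over_hbar weyl_low_diff)

lemma weyl_low_deriv_x:
  fixes a :: "'n::finite weyl"
  assumes "open D" "weyl_low D d a" shows "weyl_low D d (deriv_x i a)"
  unfolding weyl_low_def deriv_x_def partial_def
proof (intro allI impI ballI)
  fix k x and J :: "('n + 'n) multiset"
  assume "2 * k + size J < d" "x \<in> D"
  then show "frechet_derivative (a k J) (at x) (axis i 1) = 0"
    using frechet_derivative_cong_open[OF assms(1), of x "a k J" "\<lambda>_. 0"] assms(2)
    by (simp add: weyl_low_def)
qed

subsection \<open>Commutator with the symplectic form\<close>

lemma deriv_y_omega_form:
  "deriv_y i (omega_form l) = (\<lambda>k J x. if k = 0 \<and> J = {#} then complex_of_real (omega i l) else 0)"
proof (intro ext)
  fix k J x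
  show "deriv_y i (omega_form l) k J x = (if k = 0 \<and> J = {#} then complex_of_real (omega i l) else 0)"
    by (auto simp: deriv_y_def omega_form_def sum.delta if_distrib[of "\<lambda>x. _ * x"] cong: if_cong
        intro!: sum.neutral)
qed

lemma deriv_y_constant: "deriv_y j (\<lambda>k J x. if k = 0 \<and> J = {#} then c else 0) = 0"
  by (simp add: deriv_y_def fun_eq_iff)

lemma bidiff_zero: "bidiff t 0 b = 0"
  using bidiff_diff_left[of t 0 0 b] by simp

lemma pointwise_mult_constant:
  "pointwise_mult (\<lambda>k J x. if k = 0 \<and> J = {#} then c else 0) b k J x = c * b k J x"
proof -
  have "pointwise_mult (\<lambda>k J x. if k = 0 \<and> J = {#} then c else 0) b k J x =
      (\<Sum>m\<le>k. \<Sum>L | L \<subseteq># J. if L = {#} then if m = 0 then c * b k J x else 0 else 0)"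
    unfolding pointwise_mult_def by (intro sum.cong refl) auto
  also have "\<dots> = c * b k J x" by (simp add: sum.delta)
  finally show ?thesis .
qed

text \<open>The form is linear in y and its y-derivatives are constant, so orders from two on
  vanish; order zero is symmetric. In order one \<open>omega_inv\<close> meets \<open>omega\<close>
  and leaves -\<delta>.\<close>

lemma weyl_comm_omega_form: "weyl_comm (omega_form l) a = - deriv_y l (a :: 'n::finite weyl)"
proof (intro ext)
  fix k J x
  let ?w = "omega_form l :: 'n weyl"
  have b1: "bidiff 1 ?w a k J x = - deriv_y l a k J x" for k
  proof -
    have "bidiff 1 ?w a k J x = (\<Sum>i\<in>UNIV. \<Sum>j\<in>UNIV. complex_of_real (omega_inv i j) *
        (complex_of_real (omega i l) * deriv_y j a k J x))"
      unfolding One_nat_def bidiff.simps deriv_y_omega_form pointwise_mult_constant ..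
    also have "\<dots> = - deriv_y l a k J x"
      unfolding sum_omega_inv
      by (cases l) (simp_all add: if_distrib[of complex_of_real] if_distrib[of "\<lambda>x. x * _"]
        sum.delta sum_negf cong: if_cong)
    finally show ?thesis .
  qed
  have b2: "bidiff (Suc (Suc t)) ?w a k J x = 0" for t k
    by (simp add: deriv_y_omega_form deriv_y_constant bidiff_zero)
  have "weyl_comm ?w a k J x = \<i> * (\<Sum>t\<le>Suc k. (- \<i> / 2) ^ t / fact t *
      ((1 - (- 1) ^ t) * bidiff t ?w a (Suc k - t) J x))"
    unfolding weyl_comm_def i_over_hbar_def weyl_prod_def minus_apply sum_subtractf[symmetric]
    by (subst (2) bidiff_swap) (simp add: algebra_simps)
  also have "\<dots> = \<i> * (\<Sum>t\<le>Suc k. if t = 1 then \<i> * deriv_y l a k J x else 0)"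
  proof (intro arg_cong[of _ _ "\<lambda>z. \<i> * z"] sum.cong refl)
    fix t
    show "(- \<i> / 2) ^ t / fact t * ((1 - (- 1) ^ t) * bidiff t ?w a (Suc k - t) J x) =
        (if t = 1 then \<i> * deriv_y l a k J x else 0)"
    proof (cases t)
      case (Suc s)
      then show ?thesis using b1 b2 by (cases s) (simp_all del: bidiff.simps)
    qed simp
  qed
  also have "\<dots> = (- deriv_y l a) k J x"
    by (simp add: sum.delta)
  finally show "weyl_comm ?w a k J x = (- deriv_y l a) k J x" .
qed

subsection \<open>Classical elements of the Weyl bundle\<close>

definition emb :: "('n::finite + 'n, 'n phase \<Rightarrow> complex) mfps \<Rightarrow> 'n weyl" where
  "emb a = (\<lambda>k J x. if k = 0 then coef a J x else 0)"

lemma emb_add: "emb (a + b) = emb a + emb b"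
  and emb_diff: "emb (a - b) = emb a - emb b"
  and emb_zero: "emb 0 = 0"
  by (simp_all add: emb_def fun_eq_iff)

lemma deriv_y_emb: "deriv_y i (emb a) = emb (dy i a)"
  by (simp add: deriv_y_def emb_def coef_dy fun_eq_iff)

lemma pointwise_mult_emb: "pointwise_mult (emb a) (emb b) = emb (a * b)"
proof (intro ext)
  fix k J x
  have "pointwise_mult (emb a) (emb b) k J x =
      (\<Sum>m\<le>k. if m = 0 then if k = 0 then coef (a * b) J x else 0 else 0)"
    unfolding pointwise_mult_def emb_def coef_mult sum_fun_apply
    by (intro sum.cong refl) (auto intro!: sum.cong sum.neutral)
  then show "pointwise_mult (emb a) (emb b) k J x = emb (a * b) k J x"
    by (simp add: emb_def sum.delta)
qed

text \<open>\<open>bidiff\<close> for series without hbar, with the double sum reduced to the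
  nonzero entries of \<open>omega_inv\<close>, the conjugate pairs.\<close>

primrec bid :: "nat \<Rightarrow> ('n::finite + 'n, 'a::comm_ring_1) mfps \<Rightarrow> ('n + 'n, 'a) mfps \<Rightarrow> ('n + 'n, 'a) mfps"
  where
  "bid 0 a b = a * b"
| "bid (Suc t) a b =
    (\<Sum>\<alpha>\<in>UNIV. bid t (dy (Inr \<alpha>) a) (dy (Inl \<alpha>) b) - bid t (dy (Inl \<alpha>) a) (dy (Inr \<alpha>) b))"

lemma bid_1: "bid (Suc 0) a b = poisson a b"
  by (simp add: poisson_def)

lemma bid_zero [simp]: "bid t 0 b = 0" "bid t a 0 = 0"
  by (induction t arbitrary: a b) auto

lemma bid_swap: "bid t a b = (if even t then bid t b a else - bid t b a)"
proof (induction t arbitrary: a b)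
  case (Suc t)
  have "bid t (dy i a) (dy j b) = (if even t then bid t (dy j b) (dy i a) else - bid t (dy j b) (dy i a))"
    for i j by (rule Suc.IH)
  then show ?case
    by (cases "even t") (simp_all add: sum_negf sum_subtractf)
qed (simp add: mult.commute)

lemma coef_fun_sum: "coef (\<Sum>i\<in>I. f i) J x = (\<Sum>i\<in>I. coef (f i) J x)"
  by (simp add: sum_fun_apply)

lemma bidiff_emb: "bidiff t (emb a) (emb b) = emb (bid t a b)"
proof (induction t arbitrary: a b)
  case 0
  show ?case by (simp add: pointwise_mult_emb)
next
  case (Suc t)
  show ?case
  proof (intro ext)
    fix k J x
    show "bidiff (Suc t) (emb a) (emb b) k J x = emb (bid (Suc t) a b) k J x"
      unfolding bidiff.simps sum_omega_inv deriv_y_emb Suc.IH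
      by (simp add: emb_def coef_fun_sum sum_subtractf del: coef_sum)
  qed
qed

text \<open>The factors contain no hbar, so a power of hbar can only come from the order of
  differentiation.\<close>

lemma weyl_prod_emb:
  "weyl_prod (emb a) (emb b) k J x = (- \<i> / 2) ^ k / fact k * coef (bid k a b) J x"
proof -
  have "weyl_prod (emb a) (emb b) k J x =
      (\<Sum>t\<le>k. if t = k then (- \<i> / 2) ^ k / fact k * coef (bid k a b) J x else 0)"
    unfolding weyl_prod_def bidiff_emb unfolding emb_def by (intro sum.cong refl) auto
  then show ?thesis by (simp add: sum.delta)
qed

context phase_domain
begin

text \<open>Each of the \<open>t\<close> contractions applies one momentum derivative to one of the
  factors. Nonzero factors survive at most \<open>m - 1\<close> and \<open>n - 1\<close> of them,
  fewer than \<open>t\<close> in total.\<close>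

lemma bid_vanish:
  "SP a \<Longrightarrow> SP b \<Longrightarrow> fil m a \<Longrightarrow> fil n b \<Longrightarrow> m + n \<le> Suc t \<Longrightarrow> bid t a b = 0"
proof (induction t arbitrary: a b m n)
  case 0
  then have "m = 0 \<or> n = 0" by linarith
  with 0 show ?case by auto
next
  case (Suc t)
  show ?case
  proof (cases "m = 0 \<or> n = 0")
    case False
    then obtain m' n' where mn: "m = Suc m'" "n = Suc n'" by (meson not0_implies_Suc)
    have "bid t (dy (Inr \<alpha>) a) (dy (Inl \<alpha>) b) = 0" for \<alpha>
      using Suc.prems mn fil_dy[OF Suc.prems(2,4)] by (intro Suc.IH[of _ _ m' n] SP_dy) auto
    moreover have "bid t (dy (Inl \<alpha>) a) (dy (Inr \<alpha>) b) = 0" for \<alpha>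
      using Suc.prems mn fil_dy[OF Suc.prems(1,3)] by (intro Suc.IH[of _ _ m n'] SP_dy) auto
    ultimately show ?thesis by simp
  qed (use Suc.prems in auto)
qed

text \<open>The even orders of the product are symmetric, and the orders from 3 on contain more than
  two derivatives in momentum directions; only the Poisson bracket remains.\<close>

lemma commutator_emb:
  assumes "SP a" "SP b" "fil 2 a" "fil 2 b"
  shows "weyl_prod (emb a) (emb b) k J x - weyl_prod (emb b) (emb a) k J x =
    (if k = 1 then - \<i> * coef (poisson a b) J x else 0)"
proof (cases "k \<ge> 3")
  case True
  then have "bid k a b = 0" "bid k b a = 0"
    using assms by (auto intro!: bid_vanish[of _ _ 2 2])
  with True show ?thesis by (simp add: weyl_prod_emb)
next
  case False
  then consider "k = 0" | "k = 1" | "k = 2" by linarith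
  then show ?thesis
  proof cases
    \<comment> \<open>Here k = 1: antisymmetry doubles the coefficient \<open>- \<i> / 2\<close> of
      order one.\<close>
    case 2
    then show ?thesis
      using poisson_antisym[of b a] by (simp add: weyl_prod_emb bid_1 del: bid.simps)
  qed (use bid_swap[of k a b] in \<open>auto simp: weyl_prod_emb simp del: bid.simps\<close>)
qed

lemma weyl_comm_emb:
  assumes "SP a" "SP b" "fil 2 a" "fil 2 b"
  shows "weyl_comm (emb a) (emb b) = emb (poisson a b)"
proof (intro ext)
  fix k J x
  show "weyl_comm (emb a) (emb b) k J x = emb (poisson a b) k J x"
    unfolding weyl_comm_def i_over_hbar_def minus_apply commutator_emb[OF assms]
    by (simp add: emb_def)
qed

lemma deriv_x_emb: "weyl_eq_on D (deriv_x i (emb a)) (emb (dx i a))"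
  unfolding weyl_eq_on_def
proof (intro allI ballI)
  fix k J x assume "x \<in> D"
  then show "deriv_x i (emb a) k J x = emb (dx i a) k J x"
    by (cases "k = 0") (simp_all add: deriv_x_def emb_def cpart_def partial_def)
qed

lemma weyl_section_emb: "SP a \<Longrightarrow> weyl_section D (emb a)"
  unfolding weyl_section_def
proof (intro allI)
  fix k J assume "SP a"
  then show "smooth_on D (emb a k J) \<and> (\<forall>x. x \<notin> D \<longrightarrow> emb a k J x = 0)"
    by (cases "k = 0") (auto simp: emb_def csec_smooth csec_outside SP_coef
        intro: smooth_on_const[OF open_D])
qed

end

section \<open>The Fedosov construction for compatible connections\<close>

context phase_domain
begin

definition cut :: "('n phase \<Rightarrow> complex) \<Rightarrow> 'n phase \<Rightarrow> complex" where
  "cut f = (\<lambda>x. if x \<in> D then f x else 0)"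

lemma cut_csec: "smooth_on D f \<Longrightarrow> cut f \<in> csec"
  by (auto simp: csec_def cut_def intro: smooth_on_cong[OF open_D])

lemma deriv_x_diff:
  assumes "weyl_section D a" "weyl_section D b"
  shows "weyl_eq_on D (deriv_x i (a - b)) (deriv_x i a - deriv_x i b)"
  unfolding weyl_eq_on_def
proof (intro allI ballI)
  fix k J x assume x: "x \<in> D"
  have "a k J \<in> csec" "b k J \<in> csec" using assms by (auto simp: weyl_section_def csec_def)
  from fun_cong[OF cpart_diff[OF this, of i], of x] x
  show "deriv_x i (a - b) k J x = (deriv_x i a - deriv_x i b) k J x"
    by (simp add: deriv_x_def cpart_def)
qed

end

lemma coef_var_var_const:
  "coef (var i * (var j * const f)) J = (if J = {#i, j#} then f else 0)"
proof -
  have "i \<in># J \<and> j \<in># J - {#i#} \<and> J - {#i#} - {#j#} = {#} \<longleftrightarrow> J = {#i, j#}"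
    by (auto dest!: multi_member_split)
  then show ?thesis by (auto simp: coef_var_mult coef_const)
qed

text \<open>\<open>lower_fil\<close> compresses compatibility into a count of position indices:
  three allow an affine function of the momenta, two a function of the positions, at most one only
  zero. With no position index the truncated subtraction also gives \<open>fil 0\<close>.\<close>

locale fedosov_data = phase_domain D for D :: "'n::finite phase set" +
  fixes G :: "'n phase \<Rightarrow> 'n + 'n \<Rightarrow> 'n + 'n \<Rightarrow> 'n + 'n \<Rightarrow> real"
  assumes lower_smooth: "smooth_on D (\<lambda>x. lower G x i j k)"
    and lower_sym: "x \<in> D \<Longrightarrow> lower G x i j k = lower G x j i k"
      "x \<in> D \<Longrightarrow> lower G x i j k = lower G x i k j"
    and lower_fil: "fil (wt i + wt j + wt k - 1) (const (cut (\<lambda>x. complex_of_real (lower G x i j k / 2))))"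
begin

definition h where "h i j k = cut (\<lambda>x. complex_of_real (lower G x i j k / 2))"

definition g where "g l = (\<Sum>i\<in>UNIV. \<Sum>j\<in>UNIV. var i * (var j * const (h i j l)))"

lemma h_csec: "h i j k \<in> csec"
  unfolding h_def
  by (intro cut_csec smooth_on_linear[OF bounded_linear_of_real] open_D
      smooth_on_linear[OF bounded_linear_divide] lower_smooth)

lemma h_sym: "h i j k = h j i k" "h i j k = h i k j"
  using lower_sym by (auto simp: h_def cut_def fun_eq_iff)

lemma SP_g: "SP (g l)"
  unfolding g_def by (intro SP_sum SP_var_mult SP_const h_csec)

lemma eul_g: "eul (g l) = g l + g l"
  by (simp add: g_def eul_sum eul_var_mult distrib_left sum.distrib sum_distrib_left)

lemma dy_g: "dy k (g l) = (\<Sum>j\<in>UNIV. var j * const (h k j l)) + (\<Sum>i\<in>UNIV. var i * const (h i k l))"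
proof -
  have "dy k (g l) = (\<Sum>i\<in>UNIV. \<Sum>j\<in>UNIV. (if k = i then var j * const (h i j l) else 0) +
      (if k = j then var i * const (h i j l) else 0))"
    unfolding g_def dy_sum by (intro sum.cong refl) (auto simp: dy_mult dy_var)
  also have "\<dots> = (\<Sum>j\<in>UNIV. \<Sum>i\<in>UNIV. if k = i then var j * const (h i j l) else 0) +
      (\<Sum>i\<in>UNIV. \<Sum>j\<in>UNIV. if k = j then var i * const (h i j l) else 0)"
    unfolding sum.distrib by (subst sum.swap) simp
  finally show ?thesis by simp
qed

lemma dy_g_sym: "dy l (g k) = dy k (g l)"
proof -
  have "h l j k = h k j l" for j
    using h_sym(1)[of l j] h_sym(2)[of j l] h_sym(1)[of j k] by simp
  moreover have "h i l k = h i k l" for i by (rule h_sym)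
  ultimately show ?thesis unfolding dy_g by simp
qed

lemma fil_g: "fil (Suc (wt l)) (g l)"
  unfolding g_def
proof (intro fil_sum conjI SP_sum SP_var_mult SP_const h_csec)
  fix i j
  show "fil (Suc (wt l)) (var i * (var j * const (h i j l)))"
  proof (rule fil_var_mult)
    show "fil (wt l + wt i) (var j * const (h i j l))"
    proof (cases "wt l + wt i")
      \<comment> \<open>Both \<open>l\<close> and \<open>i\<close> are momentum indices, so at most
        one position index is left and the coefficient vanishes.\<close>
      case 0
      then have "wt i + wt j + wt l - 1 = 0" by (cases j) auto
      then have "const (h i j l) = (0 :: ('n + 'n, 'n phase \<Rightarrow> complex) mfps)"
        using lower_fil[of i j l] by (simp add: h_def)
      then show ?thesis by simp
    next
      case (Suc n)
      then have "wt i + wt j + wt l - 1 = n + wt j" by simp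
      then show ?thesis
        using lower_fil[of i j l] unfolding Suc
        by (intro fil_var_mult SP_const h_csec) (simp add: h_def)
    qed
  qed (intro SP_sum SP_var_mult SP_const h_csec)
qed

lemma lowdeg_g: "lowdeg 2 (g l)"
  unfolding g_def lowdeg_def by (auto simp: coef_var_var_const intro!: sum.neutral)

lemma gamma_form_eq: "weyl_eq_on D (gamma_form G l) (emb (g l))"
proof -
  have "(\<Sum>i\<in>UNIV. \<Sum>j\<in>UNIV. if J = {#i, j#} then complex_of_real (lower G x i j l / 2) else 0) =
      coef (g l) J x" if "x \<in> D" for J x
    unfolding g_def coef_fun_sum coef_var_var_const h_def cut_def using that
    by (intro sum.cong refl) auto
  then show ?thesis
    by (simp add: weyl_eq_on_def gamma_form_def emb_def)
qed

lemma weyl_low_gamma_form: "weyl_low D 2 (gamma_form G l)"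
  by (auto simp: weyl_low_def gamma_form_def intro!: sum.neutral)

subsection \<open>Uniqueness\<close>

lemma cov_d1_eq:
  "cov_d1 G r k l = deriv_x k (r l) - deriv_x l (r k) +
    (weyl_comm (gamma_form G k) (r l) - weyl_comm (gamma_form G l) (r k))"
  by (simp add: cov_d1_def ext_d1_def i_over_hbar_comm11)

text \<open>The difference \<open>s\<close> satisfies \<delta>s = E with \<open>E\<close> linear in
  \<open>s\<close> and not lowering the degree, while \<delta>^-1 s = 0. The homotopy identity
  recovers \<open>s\<close> from \<delta>s one degree higher, so \<open>s\<close> vanishes to every
  order.\<close>

lemma abelian_series_unique:
  assumes r: "is_abelian_series D G r" and r': "is_abelian_series D G r'"
  shows "r = r'"
proof -
  define s where "s l = r l - r' l" for l
  have sec: "weyl_section D (r l)" "weyl_section D (r' l)" for l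
    using r r' by (auto simp: is_abelian_series_def)
  have low: "weyl_low D 2 (r l)" "weyl_low D 2 (r' l)" for l
    using r r' by (auto simp: is_abelian_series_def weyl_low_def)
  have out: "s l \<kappa> J x = 0" if "x \<notin> D" for l \<kappa> J x
    using sec that by (simp add: s_def weyl_section_def)
  \<comment> \<open>The last bracket polarises the difference of the quadratic terms of
    \<open>r\<close> and \<open>r'\<close>.\<close>
  define E where "E k l = deriv_x k (s l) - deriv_x l (s k) +
      (weyl_comm (gamma_form G k) (s l) - weyl_comm (gamma_form G l) (s k)) +
      (weyl_comm (s k) (r l) + weyl_comm (r' k) (s l))" for k l
  have dE: "weyl_eq_on D (delta1 s k l) (E k l)" for k l
    unfolding weyl_eq_on_def
  proof (intro allI ballI)
    fix \<kappa> J x assume x: "x \<in> D"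
    have ds: "deriv_x k (s l) \<kappa> J x = deriv_x k (r l) \<kappa> J x - deriv_x k (r' l) \<kappa> J x" for k l
      using deriv_x_diff[OF sec(1)[of l] sec(2)[of l], of k] x by (simp add: weyl_eq_on_def s_def)
    have "delta1 s k l \<kappa> J x = delta1 r k l \<kappa> J x - delta1 r' k l \<kappa> J x"
      by (simp add: delta1_def s_def deriv_y_diff)
    moreover have "delta1 r k l \<kappa> J x = (curvature_form G k l + cov_d1 G r k l + weyl_comm (r k) (r l)) \<kappa> J x"
      "delta1 r' k l \<kappa> J x = (curvature_form G k l + cov_d1 G r' k l + weyl_comm (r' k) (r' l)) \<kappa> J x"
      using r r' x by (auto simp: is_abelian_series_def weyl_eq_on_def i_over_hbar_prod11)
    ultimately show "delta1 s k l \<kappa> J x = E k l \<kappa> J x"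
      unfolding E_def plus_fun_apply minus_apply ds
      by (simp add: cov_d1_eq s_def weyl_comm_diff_left weyl_comm_diff_right)
  qed
  \<comment> \<open>One ordinary series for each power of hbar, so that \<open>contract_dy\<close>
    applies.\<close>
  define S where "S \<kappa> l = Mfps (s l \<kappa>)" for \<kappa> l
  have cS: "coef (S \<kappa> l) J = s l \<kappa> J" for \<kappa> l J by (simp add: S_def)
  have yS: "(\<Sum>k\<in>UNIV. var k * S \<kappa> k) = 0" for \<kappa>
  proof (rule mfps_eqI, rule ext)
    fix J x
    \<comment> \<open>For empty \<open>J\<close> the quotient in \<open>delta_inv1\<close> is a
      division by zero and carries no information; there the sum is zero because no y^i can be split
      off.\<close>
    have z: "(\<Sum>i\<in>UNIV. mult_y i (q i) \<kappa> J x) = 0" if "is_abelian_series D G q" "x \<in> D" for q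
    proof (cases "J = {#}")
      case True then show ?thesis by (simp add: mult_y_def)
    next
      case False
      then show ?thesis
        using that by (simp add: is_abelian_series_def weyl_eq_on_def delta_inv1_def) blast
    qed
    have "coef (\<Sum>k\<in>UNIV. var k * S \<kappa> k) J x = (\<Sum>k\<in>UNIV. mult_y k (s k) \<kappa> J x)"
      by (auto simp: sum_fun_apply coef_var_mult cS mult_y_def intro!: sum.cong)
    also have "\<dots> = 0"
    proof (cases "x \<in> D")
      case True
      have "(\<Sum>k\<in>UNIV. mult_y k (s k) \<kappa> J x) =
          (\<Sum>k\<in>UNIV. mult_y k (r k) \<kappa> J x) - (\<Sum>k\<in>UNIV. mult_y k (r' k) \<kappa> J x)"
        unfolding sum_subtractf[symmetric] by (intro sum.cong) (auto simp: mult_y_def s_def)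
      then show ?thesis using z[OF r True] z[OF r' True] by simp
    next
      case False
      then show ?thesis by (auto simp: mult_y_def intro!: sum.neutral out)
    qed
    finally show "coef (\<Sum>k\<in>UNIV. var k * S \<kappa> k) J x = coef 0 J x" by simp
  qed
  have "\<forall>l. weyl_low D d (s l)" for d
  proof (induction d)
    case (Suc d)
    have lE: "weyl_low D d (delta1 s k l)" for k l
      using Suc by (intro weyl_low_eq[OF dE], unfold E_def)
        (intro weyl_low_add weyl_low_diff weyl_low_deriv_x open_D weyl_low_comm low
          weyl_low_gamma_form; blast)
    show ?case
      unfolding weyl_low_def
    proof (intro allI impI ballI)
      fix l \<kappa> and J :: "('n + 'n) multiset" and x
      assume J: "2 * \<kappa> + size J < Suc d" and x: "x \<in> D"
      have e: "eul (S \<kappa> l) + S \<kappa> l = (\<Sum>k\<in>UNIV. var k * (dy k (S \<kappa> l) - dy l (S \<kappa> k)))"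
        using contract_dy[of l "S \<kappa>"] unfolding yS
        by (simp add: right_diff_distrib sum_subtractf eul_def)
      have "of_nat (Suc (size J)) * s l \<kappa> J x = coef (eul (S \<kappa> l) + S \<kappa> l) J x"
        by (simp add: coef_eul cS algebra_simps)
      also have "\<dots> = coef (\<Sum>k\<in>UNIV. var k * (dy k (S \<kappa> l) - dy l (S \<kappa> k))) J x"
        by (simp only: e)
      also have "\<dots> = (\<Sum>k\<in>UNIV. if k \<in># J then delta1 s k l \<kappa> (J - {#k#}) x else 0)"
        unfolding coef_fun_sum
        by (intro sum.cong refl) (auto simp: coef_var_mult coef_dy cS delta1_def deriv_y_def)
      also have "\<dots> = 0"
      proof (intro sum.neutral ballI)
        fix k
        show "(if k \<in># J then delta1 s k l \<kappa> (J - {#k#}) x else 0) = 0"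
        proof (cases "k \<in># J")
          case True
          then have "2 * \<kappa> + size (J - {#k#}) < d"
            using J size_Suc_Diff1[OF True] by linarith
          then show ?thesis using lE[of k l] x by (simp add: weyl_low_def)
        qed simp
      qed
      finally show "s l \<kappa> J x = 0" by (simp del: of_nat_Suc)
    qed
  qed simp
  then have "s l \<kappa> J x = 0" if "x \<in> D" for l \<kappa> J x
    using that unfolding weyl_low_def by blast
  with out have "s l \<kappa> J x = 0" for l \<kappa> J x by blast
  then show ?thesis by (intro ext) (simp add: s_def)
qed

lemma abelian_series_eq: "is_abelian_series D G r \<Longrightarrow> abelian_series D G = r"
  unfolding abelian_series_def by (rule the_equality) (auto intro: abelian_series_unique)

lemma flat_equation:
  "ext_d0 a k + i_over_hbar (comm10 (abelian_connection D G) a k) =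
    deriv_x k a - deriv_y k a + weyl_comm (gamma_form G k + abelian_series D G k) a"
  by (simp add: ext_d0_def i_over_hbar_comm10 abelian_connection_def weyl_comm_add_left
      weyl_comm_omega_form add.assoc)

lemma flat_section_unique:
  assumes r: "is_abelian_series D G (abelian_series D G)"
    and a: "flat_section D G a" and a': "flat_section D G a'"
    and sym: "\<And>x. x \<in> D \<Longrightarrow> weyl_symbol a x = weyl_symbol a' x"
  shows "a = a'"
proof -
  define s where "s = a - a'"
  have sec: "weyl_section D a" "weyl_section D a'"
    using a a' by (auto simp: flat_section_def)
  have out: "s \<kappa> J x = 0" if "x \<notin> D" for \<kappa> J x
    using sec that by (simp add: s_def weyl_section_def)
  have s0: "s \<kappa> {#} x = 0" if "x \<in> D" for \<kappa> x
    using sym[OF that] by (auto simp: s_def weyl_symbol_def fps_eq_iff)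
  let ?\<Gamma> = "\<lambda>k. gamma_form G k + abelian_series D G k"
  have low: "weyl_low D 2 (?\<Gamma> k)" for k
    using r weyl_low_gamma_form by (intro weyl_low_add) (auto simp: is_abelian_series_def weyl_low_def)
  have ds: "weyl_eq_on D (deriv_y k s) (deriv_x k s + weyl_comm (?\<Gamma> k) s)" for k
    unfolding weyl_eq_on_def
  proof (intro allI ballI)
    fix \<kappa> J x assume x: "x \<in> D"
    have "(deriv_x k b - deriv_y k b + weyl_comm (?\<Gamma> k) b) \<kappa> J x = 0" if "flat_section D G b" for b
      using that x unfolding flat_section_def flat_equation weyl_eq_on_def by auto
    then have "weyl_comm (?\<Gamma> k) b \<kappa> J x = deriv_y k b \<kappa> J x - deriv_x k b \<kappa> J x"
      if "flat_section D G b" for b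
      using that by (simp add: algebra_simps)
    moreover have "deriv_x k (a - a') \<kappa> J x = deriv_x k a \<kappa> J x - deriv_x k a' \<kappa> J x"
      using deriv_x_diff[OF sec, of k] x by (simp add: weyl_eq_on_def)
    ultimately show "deriv_y k s \<kappa> J x = (deriv_x k s + weyl_comm (?\<Gamma> k) s) \<kappa> J x"
      using a a' by (simp add: s_def weyl_comm_diff_right deriv_y_diff)
  qed
  have "weyl_low D d s" for d
  proof (induction d)
    case (Suc d)
    have l: "weyl_low D d (deriv_y k s)" for k
      by (intro weyl_low_eq[OF ds] weyl_low_add weyl_low_deriv_x weyl_low_comm open_D Suc low)
    show ?case
      unfolding weyl_low_def
    proof (intro allI impI ballI)
      fix \<kappa> x and J :: "('n + 'n) multiset"
      assume J: "2 * \<kappa> + size J < Suc d" and x: "x \<in> D"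
      show "s \<kappa> J x = 0"
      proof (cases J)
        case (add i K)
        then have "deriv_y i s \<kappa> K x = 0"
          using l[of i] J x by (simp add: weyl_low_def)
        then show ?thesis
          using add by (simp add: deriv_y_def del: of_nat_Suc)
      qed (use s0 x in simp)
    qed
  qed simp
  then have "s \<kappa> J x = 0" if "x \<in> D" for \<kappa> J x
    using that unfolding weyl_low_def by blast
  with out have "s \<kappa> J x = 0" for \<kappa> J x by blast
  then show ?thesis by (intro ext) (simp add: s_def)
qed

subsection \<open>Classical solutions\<close>

lemma fil_wt_2: "fil (Suc (wt l)) a \<Longrightarrow> fil 2 a"
  using fil_Suc[of "Suc 0" a] by (cases l) (auto simp: numeral_2_eq_2 simp del: fil.simps)

text \<open>All entries are affine in the momenta, so each commutator is a Poisson bracket. As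
  \<delta>\<gamma> = 0 by \<open>dy_g_sym\<close>, zero curvature of g + r is then the equation for
  r.\<close>

lemma classical_abelian_series:
  assumes A: "weyl_connection D A" and F: "\<And>k l. weyl_connection.curv D A k l = 0"
    and filA: "\<And>l. fil (Suc (wt l)) (A l)" and low: "\<And>l. lowdeg 3 (A l - g l)"
    and y: "(\<Sum>l\<in>UNIV. var l * (A l - g l)) = 0"
  shows "is_abelian_series D G (\<lambda>l. emb (A l - g l))"
proof -
  interpret weyl_connection D A by (rule A)
  define r where "r l = A l - g l" for l
  have SPr: "SP (r l)" for l by (simp add: r_def SP_intros SP_A SP_g)
  have fg: "fil 2 (g l)" and "fil 2 (A l)" for l
    using fil_wt_2 fil_g filA by blast+
  then have fr: "fil 2 (r l)" for l
    unfolding r_def by (intro fil_diff SP_A SP_g)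
  have wc: "weyl_eq_on D (weyl_comm (gamma_form G k) (emb (r l))) (emb (poisson (g k) (r l)))" for k l
    using weyl_comm_cong[OF gamma_form_eq weyl_eq_on_refl, of k "emb (r l)"]
    by (simp add: weyl_comm_emb SP_g SPr fg fr)
  have wg: "weyl_eq_on D (weyl_comm (gamma_form G k) (gamma_form G l)) (emb (poisson (g k) (g l)))" for k l
    using weyl_comm_cong[OF gamma_form_eq gamma_form_eq, of k l]
    by (simp add: weyl_comm_emb SP_g fg)
  have xg: "weyl_eq_on D (deriv_x k (gamma_form G l)) (emb (dx k (g l)))" for k l
    by (rule weyl_eq_on_trans[OF deriv_x_cong[OF open_D gamma_form_eq] deriv_x_emb])
  have Ag: "A l = g l + r l" for l by (simp add: r_def)
  have "dy k (r l) - dy l (r k) =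
      (dx k (g l) - dx l (g k) + poisson (g k) (g l)) +
      (dx k (r l) - dx l (r k) + (poisson (g k) (r l) - poisson (g l) (r k))) + poisson (r k) (r l)" for k l
    using F[of k l] dy_g_sym[of k l] poisson_antisym[of "g l" "r k"]
    unfolding curv_def nab_def Ag
    by (simp add: dx_add SP_g SPr dy_add poisson_add_left poisson_add_right algebra_simps)
  note eq = this
  have "weyl_eq_on D (delta1 (\<lambda>l. emb (r l)) k l)
      (curvature_form G k l + cov_d1 G (\<lambda>l. emb (r l)) k l +
        i_over_hbar (prod11 (\<lambda>l. emb (r l)) (\<lambda>l. emb (r l)) k l))" for k l
  proof (rule weyl_eq_on_sym, rule weyl_eq_on_trans)
    show "weyl_eq_on D (curvature_form G k l + cov_d1 G (\<lambda>l. emb (r l)) k l +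
        i_over_hbar (prod11 (\<lambda>l. emb (r l)) (\<lambda>l. emb (r l)) k l))
      ((emb (dx k (g l)) - emb (dx l (g k)) + emb (poisson (g k) (g l))) +
       (emb (dx k (r l)) - emb (dx l (r k)) + (emb (poisson (g k) (r l)) - emb (poisson (g l) (r k)))) +
       emb (poisson (r k) (r l)))"
      unfolding curvature_form_def ext_d1_def cov_d1_eq i_over_hbar_prod11
        weyl_comm_emb[OF SPr SPr fr fr]
      by (intro weyl_eq_on_add weyl_eq_on_diff wc wg xg deriv_x_emb weyl_eq_on_refl)
    show "weyl_eq_on D \<dots> (delta1 (\<lambda>l. emb (r l)) k l)"
      unfolding delta1_def deriv_y_emb emb_add[symmetric] emb_diff[symmetric] eq
      by (rule weyl_eq_on_refl)
  qed
  moreover have "weyl_eq_on D (delta_inv1 (\<lambda>l. emb (r l))) 0"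
  proof -
    have "(\<Sum>i\<in>UNIV. mult_y i (emb (r i)) \<kappa> J x) = 0" for \<kappa> J x
    proof -
      have "(\<Sum>i\<in>UNIV. mult_y i (emb (r i)) \<kappa> J x) = emb (\<Sum>l\<in>UNIV. var l * r l) \<kappa> J x"
        by (cases "\<kappa> = 0")
          (auto simp: mult_y_def emb_def coef_fun_sum coef_var_mult simp del: coef_sum
            intro!: sum.cong sum.neutral)
      then show ?thesis using y by (simp add: r_def emb_zero)
    qed
    then show ?thesis by (simp add: weyl_eq_on_def delta_inv1_def)
  qed
  moreover have "emb (r l) \<kappa> J x = 0" if "2 * \<kappa> + size J < 3" for l \<kappa> J x
    using lowdegD[OF low[of l], of J] that by (simp add: emb_def r_def)
  ultimately show ?thesis
    unfolding is_abelian_series_def r_def[symmetric]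
    using weyl_section_emb[OF SPr] by blast
qed

lemma classical_flat_lift:
  assumes A: "weyl_connection D A" and r: "is_abelian_series D G (\<lambda>l. emb (A l - g l))"
    and filA: "\<And>l. fil (Suc (wt l)) (A l)"
    and a: "SP a" "fil 2 a" "coef a {#} = cut f" "\<And>k. weyl_connection.cov D A k a = 0"
  shows "flat_lift D G f = emb a"
proof -
  interpret weyl_connection D A by (rule A)
  have ar: "abelian_series D G = (\<lambda>l. emb (A l - g l))"
    by (rule abelian_series_eq[OF r])
  have sy: "weyl_symbol (emb a) x = fps_const (f x)" if "x \<in> D" for x
    using a(3) that by (auto simp: weyl_symbol_def emb_def cut_def fps_eq_iff)
  have fl: "flat_section D G (emb a)"
    unfolding flat_section_def flat_equation ar
  proof (intro conjI allI weyl_section_emb a(1))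
    fix k
    have "weyl_eq_on D (gamma_form G k + emb (A k - g k)) (emb (g k) + emb (A k - g k))"
      by (intro weyl_eq_on_add gamma_form_eq weyl_eq_on_refl)
    then have "weyl_eq_on D (gamma_form G k + emb (A k - g k)) (emb (A k))"
      by (simp add: emb_add[symmetric])
    from weyl_comm_cong[OF this weyl_eq_on_refl]
    have "weyl_eq_on D (weyl_comm (gamma_form G k + emb (A k - g k)) (emb a)) (emb (poisson (A k) a))"
      using weyl_comm_emb[OF SP_A a(1) fil_wt_2[OF filA] a(2)] by metis
    then have "weyl_eq_on D (deriv_x k (emb a) - deriv_y k (emb a) +
        weyl_comm (gamma_form G k + emb (A k - g k)) (emb a))
        (emb (dx k a) - emb (dy k a) + emb (poisson (A k) a))"
      unfolding deriv_y_emb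
      by (intro weyl_eq_on_add weyl_eq_on_diff deriv_x_emb weyl_eq_on_refl)
    moreover have "emb (dx k a) - emb (dy k a) + emb (poisson (A k) a) = emb (cov k a)"
      by (simp add: cov_def nab_def emb_add emb_diff)
    ultimately show "weyl_eq_on D (deriv_x k (emb a) - deriv_y k (emb a) +
        weyl_comm (gamma_form G k + emb (A k - g k)) (emb a)) 0"
      by (simp add: a(4) emb_zero)
  qed
  show ?thesis
    unfolding flat_lift_def
  proof (rule the_equality)
    show "flat_section D G (emb a) \<and> (\<forall>x\<in>D. weyl_symbol (emb a) x = fps_const (f x))"
      using fl sy by blast
    show "b = emb a" if "flat_section D G b \<and> (\<forall>x\<in>D. weyl_symbol b x = fps_const (f x))" for b
      using that fl sy r ar by (intro flat_section_unique) auto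
  qed
qed

text \<open>The Poisson bracket of two lifts at y = 0 depends only on their linear parts. These are
  the differentials of the functions, so the phase-space Poisson bracket appears.\<close>

lemma moyal_bracket_affine_momenta:
  assumes f1: "cut f1 \<in> csec" "fil 2 (const (cut f1))" and f2: "cut f2 \<in> csec" "fil 2 (const (cut f2))"
    and x: "x \<in> D"
  shows "moyal_bracket D G f1 f2 x = fps_const (- \<i> * (\<Sum>\<alpha>\<in>UNIV.
    cpart (Inr \<alpha>) (cut f1) x * cpart (Inl \<alpha>) (cut f2) x -
    cpart (Inl \<alpha>) (cut f1) x * cpart (Inr \<alpha>) (cut f2) x)) * hbar"
proof -
  obtain A where A: "weyl_connection D A" and F: "\<And>k l. weyl_connection.curv D A k l = 0"
    and filA: "\<And>l. fil (Suc (wt l)) (A l)" and low: "\<And>l. lowdeg 3 (A l - g l)"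
    and y: "(\<Sum>l\<in>UNIV. var l * (A l - g l)) = 0"
    using flat_connection_exists[OF SP_g eul_g dy_g_sym fil_g lowdeg_g] by blast
  interpret weyl_connection D A by (rule A)
  have r: "is_abelian_series D G (\<lambda>l. emb (A l - g l))"
    by (rule classical_abelian_series[OF A F filA low y])
  have lift: "\<exists>a. SP a \<and> fil 2 a \<and> flat_lift D G f = emb a \<and>
      (\<forall>k. coef (dy k a) {#} = cpart k (cut f))"
    if f: "cut f \<in> csec" "fil 2 (const (cut f))" for f
  proof -
    have "fil (Suc 1) (const (cut f))"
      using f(2) by (simp only: numeral_2_eq_2 One_nat_def)
    then obtain a where a: "SP a" "fil (Suc 1) a" "coef a {#} = cut f" "\<And>k. cov k a = 0"
      using flat_section_exists[OF F filA f(1)] by blast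
    then have a2: "fil 2 a" by (simp only: numeral_2_eq_2 One_nat_def)
    \<comment> \<open>\<open>A k\<close> starts in order two, so its derivatives vanish at y = 0.
      Flatness at y = 0 then equates the linear part of \<open>a\<close> with the differential of
      \<open>f\<close>.\<close>
    have "coef (poisson (A k) a) {#} = 0" for k
      using lowdegD[OF lowdeg_dy, of 0 "A k" "{#}"] lowdeg_A[of k]
      by (auto simp: poisson_def coef_mult lowdegD[OF lowdeg_A] coef_dy intro!: sum.neutral)
    then have "coef (dy k a) {#} = cpart k (cut f)" for k
      using arg_cong[OF a(4)[of k], of "\<lambda>u. coef u {#}"] by (simp add: cov_def nab_def a(3))
    with a a2 classical_flat_lift[OF A r filA a(1) a2 a(3,4)] show ?thesis by blast
  qed
  obtain a where a: "SP a" "fil 2 a" "flat_lift D G f1 = emb a" "\<And>k. coef (dy k a) {#} = cpart k (cut f1)"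
    using lift[OF f1] by blast
  obtain b where b: "SP b" "fil 2 b" "flat_lift D G f2 = emb b" "\<And>k. coef (dy k b) {#} = cpart k (cut f2)"
    using lift[OF f2] by blast
  have "coef (poisson a b) {#} x = (\<Sum>\<alpha>\<in>UNIV.
      cpart (Inr \<alpha>) (cut f1) x * cpart (Inl \<alpha>) (cut f2) x -
      cpart (Inl \<alpha>) (cut f1) x * cpart (Inr \<alpha>) (cut f2) x)"
    unfolding poisson_def coef_fun_sum by (simp add: coef_mult a(4) b(4))
  moreover have "fps_nth (moyal_bracket D G f1 f2 x) k = (if k = 1 then - \<i> * coef (poisson a b) {#} x else 0)" for k
    using commutator_emb[OF a(1) b(1) a(2) b(2), of k "{#}" x]
    by (simp add: moyal_bracket_def fedosov_star_def weyl_symbol_def a(3) b(3))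
  ultimately show ?thesis
    by (auto simp: fps_eq_iff fps_X_def)
qed

end

section \<open>Canonical commutation relations\<close>

subsection \<open>Functions affine in the momenta\<close>

lemma bounded_linear_qpart: "bounded_linear (qpart :: 'n::finite phase \<Rightarrow> real^'n)"
  by (simp add: linear_conv_bounded_linear[symmetric] linear_iff qpart_def vec_eq_iff)

lemma qpart_axis: "qpart (axis (Inl \<alpha>) 1) = axis \<alpha> 1" "qpart (axis (Inr \<alpha>) 1) = 0"
  by (auto simp: qpart_def axis_def vec_eq_iff)

lemma axis_Inr: "(axis (Inl \<alpha>) 1 :: 'n::finite phase) $ Inr l = 0"
    "(axis (Inr \<alpha>) 1 :: 'n phase) $ Inr l = (if l = \<alpha> then 1 else 0)"
  by (auto simp: axis_def)

lemma partial_chain: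
  fixes f :: "real^'k::finite \<Rightarrow> real" and Q :: "real^'k \<Rightarrow> real^'k"
  assumes f: "f differentiable (at (Q x))" and Q: "Q differentiable (at x)"
  shows "partial i (\<lambda>z. f (Q z)) x = (\<Sum>a\<in>UNIV. partial a f (Q x) * partial i (\<lambda>z. Q z $ a) x)"
proof -
  let ?F = "frechet_derivative f (at (Q x))" and ?v = "frechet_derivative Q (at x) (axis i 1)"
  have lin: "linear ?F" by (rule linear_frechet_derivative[OF f])
  have "partial i (\<lambda>z. f (Q z)) x = ?F ?v"
    using frechet_derivative_compose[OF Q f] by (simp add: partial_def comp_def)
  also have "\<dots> = ?F (\<Sum>a\<in>UNIV. ?v $ a *\<^sub>R axis a 1)"
    using basis_expansion[of ?v] by (simp add: scalar_mult_eq_scaleR)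
  also have "\<dots> = (\<Sum>a\<in>UNIV. ?v $ a * ?F (axis a 1))"
    by (simp add: linear_sum[OF lin] linear_scale[OF lin])
  also have "\<dots> = (\<Sum>a\<in>UNIV. partial a f (Q x) * partial i (\<lambda>z. Q z $ a) x)"
    by (simp add: partial_def frechet_derivative_linear_comp[OF bounded_linear_vec_nth Q] mult.commute)
  finally show ?thesis .
qed

lemma smooth_on_differentiable: "smooth_on S f \<Longrightarrow> x \<in> S \<Longrightarrow> f differentiable (at x)"
  using smooth_on_has_derivative differentiableI by blast

lemma smooth_on_zero_fun: "open S \<Longrightarrow> smooth_on S 0"
  by (simp add: zero_fun_def smooth_on_const)

lemma partial_zero_fun [simp]: "partial i 0 x = 0"
  by (simp add: zero_fun_def partial_def)

lemma const_zero [simp]: "const 0 = 0"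
  by (rule mfps_eqI) (simp add: coef_const)

text \<open>The common form of new positions (\<open>v\<close> zero) and new momenta
  (\<open>u\<close> zero); derivatives along phase space stay in this form.\<close>

definition affine_mom ::
  "(real^'n \<Rightarrow> real) \<Rightarrow> ('n \<Rightarrow> real^'n \<Rightarrow> real) \<Rightarrow> 'n::finite phase \<Rightarrow> complex" where
  "affine_mom u v x = complex_of_real (u (qpart x) + (\<Sum>l\<in>UNIV. v l (qpart x) * x $ Inr l))"

locale darboux_domain =
  fixes V :: "(real^'n::finite) set"
  assumes open_V: "open V"

sublocale darboux_domain \<subseteq> phase_domain "qpart -` V"
  by unfold_locales
    (rule open_vimage[OF open_V linear_continuous_on[OF bounded_linear_qpart]])

context darboux_domain
begin

lemma smooth_qpart: "smooth_on V f \<Longrightarrow> smooth_on (qpart -` V) (\<lambda>x. f (qpart x))"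
  by (rule smooth_on_compose_linear[OF bounded_linear_qpart open_V])

context
  fixes u :: "real^'n \<Rightarrow> real" and v :: "'n \<Rightarrow> real^'n \<Rightarrow> real"
  assumes u: "smooth_on V u" and v: "\<And>l. smooth_on V (v l)"
begin

lemma affine_mom_csec: "cut (affine_mom u v) \<in> csec"
  unfolding affine_mom_def[abs_def]
  by (intro cut_csec smooth_on_linear[OF bounded_linear_of_real] smooth_on_add smooth_on_sum
      smooth_on_mult smooth_qpart u v open_D smooth_on_linear_map[OF bounded_linear_vec_nth])

lemma affine_mom_derivative:
  assumes x: "x \<in> qpart -` V"
  shows "(affine_mom u v has_derivative (\<lambda>w. complex_of_real
    (frechet_derivative u (at (qpart x)) (qpart w) +
     (\<Sum>l\<in>UNIV. v l (qpart x) * w $ Inr l + frechet_derivative (v l) (at (qpart x)) (qpart w) * x $ Inr l))))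
    (at x)"
proof -
  have d: "((\<lambda>x. f (qpart x)) has_derivative (\<lambda>w. frechet_derivative f (at (qpart x)) (qpart w))) (at x)"
    if "smooth_on V f" for f :: "real^'n \<Rightarrow> real"
    using x
    by (intro has_derivative_compose[OF bounded_linear_imp_has_derivative[OF bounded_linear_qpart]]
        smooth_on_has_derivative[OF that]) auto
  show ?thesis
    unfolding affine_mom_def[abs_def]
    by (intro bounded_linear.has_derivative[OF bounded_linear_of_real] has_derivative_add
        has_derivative_sum has_derivative_mult d u v
        bounded_linear_imp_has_derivative[OF bounded_linear_vec_nth])
qed

lemma cpart_affine_mom:
  assumes x: "x \<in> qpart -` V"
  shows "cpart (Inl \<alpha>) (cut (affine_mom u v)) x = affine_mom (partial \<alpha> u) (\<lambda>l. partial \<alpha> (v l)) x"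
    and "cpart (Inr \<alpha>) (cut (affine_mom u v)) x = affine_mom (v \<alpha>) 0 x"
proof -
  have lin: "frechet_derivative f (at (qpart x)) 0 = 0" if "smooth_on V f" for f :: "real^'n \<Rightarrow> real"
    using linear_0[OF linear_frechet_derivative[OF smooth_on_differentiable[OF that]]] x by simp
  have c: "cpart i (cut (affine_mom u v)) x = partial i (affine_mom u v) x" for i
    using frechet_derivative_cong_open[OF open_D x, of "cut (affine_mom u v)" "affine_mom u v"] x
    by (simp add: cpart_def partial_def cut_def)
  note d = frechet_derivative_at[OF affine_mom_derivative[OF x], symmetric]
  show "cpart (Inl \<alpha>) (cut (affine_mom u v)) x = affine_mom (partial \<alpha> u) (\<lambda>l. partial \<alpha> (v l)) x"
    unfolding c partial_def d affine_mom_def by (simp add: qpart_axis axis_Inr)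
  show "cpart (Inr \<alpha>) (cut (affine_mom u v)) x = affine_mom (v \<alpha>) 0 x"
    unfolding c partial_def d affine_mom_def
    by (simp add: qpart_axis lin u v axis_Inr if_distrib[of "\<lambda>z. _ * z"] sum.delta' cong: if_cong)
qed

lemma cpart_Inr_affine_mom: "cpart (Inr \<alpha>) (cut (affine_mom u v)) = cut (affine_mom (v \<alpha>) 0)"
proof
  fix x
  show "cpart (Inr \<alpha>) (cut (affine_mom u v)) x = cut (affine_mom (v \<alpha>) 0) x"
  proof (cases "x \<in> qpart -` V")
    case True
    then show ?thesis using cpart_affine_mom(2)[OF True] by (simp add: cut_def)
  next
    case False
    then show ?thesis by (simp add: cpart_def cut_def)
  qed
qed

end

lemma affine_mom_zero: "cut (affine_mom 0 0) = 0"
  by (auto simp: cut_def affine_mom_def fun_eq_iff)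

lemma fil_affine_mom_1: "smooth_on V u \<Longrightarrow> fil (Suc 0) (const (cut (affine_mom u 0)))"
  using cpart_Inr_affine_mom[of u 0] affine_mom_zero
  by (simp add: dx_const smooth_on_zero_fun open_V)

lemma fil_affine_mom_2:
  "smooth_on V u \<Longrightarrow> (\<And>l. smooth_on V (v l)) \<Longrightarrow> fil 2 (const (cut (affine_mom u v)))"
  using cpart_Inr_affine_mom[of u v] fil_affine_mom_1
  by (simp add: dx_const numeral_2_eq_2)

end

subsection \<open>Point transformations\<close>

lemma omega_antisym: "omega i j = - omega j i"
  by (cases i; cases j) auto

locale point_transformation = darboux_domain V for V :: "(real^'n::finite) set" +
  fixes V' :: "(real^'n) set" and Q R :: "real^'n \<Rightarrow> real^'n"
  assumes diffeo: "diffeo V V' Q R"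
begin

lemma Q_smooth: "smooth_on V Q" and R_smooth: "smooth_on V' R" and open_V': "open V'"
  and Q_in: "q \<in> V \<Longrightarrow> Q q \<in> V'"
  and RQ: "q \<in> V \<Longrightarrow> R (Q q) = q" and QR: "y \<in> V' \<Longrightarrow> Q (R y) = y"
  using diffeo by (auto simp: diffeo_def)

lemma R_comp_smooth: "smooth_on V' (\<lambda>z. R z $ l)"
  by (intro smooth_on_linear[OF bounded_linear_vec_nth] open_V' R_smooth)

lemma Q_comp_smooth: "smooth_on V (\<lambda>z. Q z $ l)"
  by (intro smooth_on_linear[OF bounded_linear_vec_nth] open_V Q_smooth)

definition mom_coeff where
  "mom_coeff \<beta> l q = partial \<beta> (\<lambda>z. R z $ l) (Q q)"

lemma mom_coeff_smooth: "smooth_on V (mom_coeff \<beta> l)"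
  unfolding mom_coeff_def[abs_def]
  by (rule smooth_on_compose[OF open_V' open_V _ Q_smooth])
    (auto simp: Q_in intro: smooth_on_partial R_comp_smooth)

lemma pos_var_eq: "pos_var (point_transf Q R) \<alpha> = affine_mom (\<lambda>q. Q q $ \<alpha>) 0"
  by (simp add: pos_var_def point_transf_def affine_mom_def fun_eq_iff)

lemma mom_var_eq: "mom_var (point_transf Q R) \<beta> = affine_mom 0 (mom_coeff \<beta>)"
  by (simp add: mom_var_def point_transf_def affine_mom_def mom_coeff_def fun_eq_iff)

text \<open>The chain rule for \<open>Q\<close> after \<open>R\<close>, which is the identity near
  \<open>Q q\<close>.\<close>

lemma inverse_jacobian:
  assumes q: "q \<in> V"
  shows "(\<Sum>a\<in>UNIV. partial a (\<lambda>z. Q z $ \<alpha>) q * mom_coeff \<beta> a q) = (if \<alpha> = \<beta> then 1 else 0)"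
proof -
  have "partial \<beta> (\<lambda>y. Q (R y) $ \<alpha>) (Q q) =
      (\<Sum>a\<in>UNIV. partial a (\<lambda>z. Q z $ \<alpha>) (R (Q q)) * partial \<beta> (\<lambda>z. R z $ a) (Q q))"
    using q by (intro partial_chain[where f = "\<lambda>z. Q z $ \<alpha>" and Q = R] smooth_on_differentiable[OF Q_comp_smooth]
        smooth_on_differentiable[OF R_smooth]) (auto simp: Q_in RQ)
  also have "partial \<beta> (\<lambda>y. Q (R y) $ \<alpha>) (Q q) = partial \<beta> (\<lambda>y. y $ \<alpha>) (Q q)"
    unfolding partial_def using frechet_derivative_cong_open[OF open_V' Q_in[OF q],
        of "\<lambda>y. Q (R y) $ \<alpha>" "\<lambda>y. y $ \<alpha>"] by (simp add: QR)
  also have "\<dots> = (if \<alpha> = \<beta> then 1 else 0)"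
    using frechet_derivative_at[OF bounded_linear_imp_has_derivative[OF
        bounded_linear_vec_nth[of \<alpha>]], of "Q q", symmetric]
    by (simp add: partial_def axis_def)
  finally show ?thesis using q by (simp add: RQ mom_coeff_def)
qed

text \<open>The chain rule applied to \<open>mom_coeff \<beta> l\<close> brings in the Jacobian of
  \<open>Q\<close>, which \<open>mom_coeff \<alpha>\<close> inverts. What remains is a second
  derivative of a component of \<open>R\<close>, symmetric in \<alpha> and \<beta>. This is why new
  momenta commute.\<close>

lemma mom_coeff_symmetric:
  assumes q: "q \<in> V"
  shows "(\<Sum>a\<in>UNIV. mom_coeff \<alpha> a q * partial a (mom_coeff \<beta> l) q) =
    (\<Sum>a\<in>UNIV. mom_coeff \<beta> a q * partial a (mom_coeff \<alpha> l) q)"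
proof -
  have e: "(\<Sum>a\<in>UNIV. mom_coeff \<alpha> a q * partial a (mom_coeff \<beta> l) q) =
      partial \<alpha> (partial \<beta> (\<lambda>z. R z $ l)) (Q q)" for \<alpha> \<beta>
  proof -
    have "partial a (mom_coeff \<beta> l) q = (\<Sum>c\<in>UNIV. partial c (partial \<beta> (\<lambda>z. R z $ l)) (Q q) *
        partial a (\<lambda>z. Q z $ c) q)" for a
      unfolding mom_coeff_def[abs_def]
      using q by (intro partial_chain smooth_on_differentiable[OF Q_smooth]
          smooth_on_differentiable[OF smooth_on_partial[OF R_comp_smooth]]) (auto simp: Q_in)
    then have "(\<Sum>a\<in>UNIV. mom_coeff \<alpha> a q * partial a (mom_coeff \<beta> l) q) =
        (\<Sum>a\<in>UNIV. \<Sum>c\<in>UNIV. partial c (partial \<beta> (\<lambda>z. R z $ l)) (Q q) *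
          (partial a (\<lambda>z. Q z $ c) q * mom_coeff \<alpha> a q))"
      by (simp add: sum_distrib_left algebra_simps)
    also have "\<dots> = (\<Sum>c\<in>UNIV. partial c (partial \<beta> (\<lambda>z. R z $ l)) (Q q) *
        (\<Sum>a\<in>UNIV. partial a (\<lambda>z. Q z $ c) q * mom_coeff \<alpha> a q))"
      unfolding sum_distrib_left by (rule sum.swap)
    also have "\<dots> = partial \<alpha> (partial \<beta> (\<lambda>z. R z $ l)) (Q q)"
      unfolding inverse_jacobian[OF q]
      by (simp add: if_distrib[of "\<lambda>z. _ * z"] sum.delta cong: if_cong)
    finally show ?thesis .
  qed
  show ?thesis
    unfolding e using second_derivative_symmetric[OF open_V' R_comp_smooth Q_in[OF q]]
    by (simp add: partial_def[abs_def])
qed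

lemma poisson_relations:
  assumes x: "x \<in> qpart -` V"
  defines "B f g \<equiv> \<Sum>a\<in>UNIV.
    cpart (Inr a) (cut f) x * cpart (Inl a) (cut g) x - cpart (Inl a) (cut f) x * cpart (Inr a) (cut g) x"
  shows "B (pos_var (point_transf Q R) \<alpha>) (pos_var (point_transf Q R) \<beta>) = 0"
    "B (pos_var (point_transf Q R) \<alpha>) (mom_var (point_transf Q R) \<beta>) = (if \<alpha> = \<beta> then - 1 else 0)"
    "B (mom_var (point_transf Q R) \<alpha>) (mom_var (point_transf Q R) \<beta>) = 0"
proof -
  have q: "qpart x \<in> V" using x by simp
  have z: "smooth_on V (0 :: real^'n \<Rightarrow> real)" by (rule smooth_on_zero_fun[OF open_V])
  have z': "smooth_on V ((0 :: 'n \<Rightarrow> real^'n \<Rightarrow> real) l)" for l using z by simp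
  note p = cpart_affine_mom[OF Q_comp_smooth z' x] and m = cpart_affine_mom[OF z mom_coeff_smooth x]
  note eqs = B_def pos_var_eq mom_var_eq p m affine_mom_def
  show "B (pos_var (point_transf Q R) \<alpha>) (pos_var (point_transf Q R) \<beta>) = 0"
    by (simp add: eqs)
  have "B (pos_var (point_transf Q R) \<alpha>) (mom_var (point_transf Q R) \<beta>) =
      - complex_of_real (\<Sum>a\<in>UNIV. partial a (\<lambda>z. Q z $ \<alpha>) (qpart x) * mom_coeff \<beta> a (qpart x))"
    by (simp add: eqs sum_negf)
  then show "B (pos_var (point_transf Q R) \<alpha>) (mom_var (point_transf Q R) \<beta>) = (if \<alpha> = \<beta> then - 1 else 0)"
    unfolding inverse_jacobian[OF q] by simp
  \<comment> \<open>Collected by powers of the old momenta, the coefficient of p_l is the expression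
    of \<open>mom_coeff_symmetric\<close>.\<close>
  have s: "(\<Sum>a\<in>UNIV. mom_coeff \<alpha> a (qpart x) * (\<Sum>l\<in>UNIV. partial a (mom_coeff \<beta> l) (qpart x) * x $ Inr l)) =
      (\<Sum>l\<in>UNIV. (\<Sum>a\<in>UNIV. mom_coeff \<alpha> a (qpart x) * partial a (mom_coeff \<beta> l) (qpart x)) * x $ Inr l)"
    for \<alpha> \<beta>
    unfolding sum_distrib_left sum_distrib_right by (subst sum.swap) (simp add: mult.assoc)
  have "B (mom_var (point_transf Q R) \<alpha>) (mom_var (point_transf Q R) \<beta>) = complex_of_real (
      (\<Sum>a\<in>UNIV. mom_coeff \<alpha> a (qpart x) * (\<Sum>l\<in>UNIV. partial a (mom_coeff \<beta> l) (qpart x) * x $ Inr l)) -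
      (\<Sum>a\<in>UNIV. mom_coeff \<beta> a (qpart x) * (\<Sum>l\<in>UNIV. partial a (mom_coeff \<alpha> l) (qpart x) * x $ Inr l)))"
    by (simp add: eqs sum_subtractf mult.commute)
  then show "B (mom_var (point_transf Q R) \<alpha>) (mom_var (point_transf Q R) \<beta>) = 0"
    unfolding s mom_coeff_symmetric[OF q, of \<alpha> \<beta>] by simp
qed

end

text \<open>Makes the coordinates themselves an instance of transformed variables, so one argument
  serves both halves of the theorem.\<close>

lemma point_transf_id: "point_transf id id = id"
proof (rule ext)
  fix x :: "'n::finite phase"
  have p: "partial \<beta> (\<lambda>z::real^'n. z $ l) y = (if l = \<beta> then 1 else 0)" for \<beta> l y
    using frechet_derivative_at[OF bounded_linear_imp_has_derivative[OF
        bounded_linear_vec_nth[of l]], of y, symmetric]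
    by (simp add: partial_def axis_def)
  show "point_transf id id x = id x"
    by (auto simp: point_transf_def vec_eq_iff qpart_def p if_distrib[of "\<lambda>z. z * _"] sum.delta
        split: sum.split cong: if_cong)
qed

lemma diffeo_id: "open V \<Longrightarrow> diffeo V V id id"
  by (auto simp: diffeo_def id_def intro: smooth_on_linear_map)

subsection \<open>Compatible connections\<close>

text \<open>Total symmetry of the lowered components combines torsion-freeness (last two indices)
  with preservation of \<omega> (first two). It reduces the degree count to the index patterns
  listed in the compatibility conditions.\<close>

lemma fedosov_data_compatible:
  fixes \<A> :: "('m::t2_space, 'n::finite) chart set"
  assumes man: "smooth_manifold \<A>" and \<Gamma>: "symmetric_connection_on \<A> \<Gamma>"
    and \<gamma>: "symplectic_connection \<A> \<gamma>" and comp: "compatible_connection \<A> \<Gamma> \<gamma>" and c: "c \<in> \<A>"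
  shows "darboux_domain (snd c ` fst c)" "fedosov_data (darboux_dom c) (\<gamma> c)"
proof -
  let ?V = "snd c ` fst c"
  have D: "darboux_dom c = qpart -` ?V" by (auto simp: darboux_dom_def)
  have op: "open ?V"
    using man c by (auto simp: smooth_manifold_def smooth_structure_def is_chart_def)
  then show dd: "darboux_domain ?V" by unfold_locales
  interpret darboux_domain ?V by (rule dd)
  have ov: "darboux_overlap c c = darboux_dom c" "overlap c c = ?V"
    by (auto simp: darboux_overlap_def darboux_dom_def overlap_def)
  let ?l = "lower (\<gamma> c)"
  have "smooth_on (darboux_dom c) (\<lambda>x. \<gamma> c x i j k)" for i j k
    using \<gamma> c ov by (auto simp: symplectic_connection_def linear_connection_def)
  then have smooth: "smooth_on (darboux_dom c) (\<lambda>x. ?l x i j k)" for i j k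
    unfolding lower_def using open_D
    by (intro smooth_on_sum smooth_on_mult smooth_on_const) (auto simp: D)
  have \<Gamma>smooth: "smooth_on ?V (\<lambda>q. \<Gamma> c q i j k)" for i j k
    using \<Gamma> c ov by (auto simp: symmetric_connection_on_def linear_connection_def)
  have tf: "\<gamma> c x i j k = \<gamma> c x i k j" if "x \<in> darboux_dom c" for x i j k
    using \<gamma> c that ov by (auto simp: symplectic_connection_def torsion_free_def)
  then have sym2: "?l x i j k = ?l x i k j" if "x \<in> darboux_dom c" for x i j k
    unfolding lower_def using that by simp
  \<comment> \<open>The components of \<omega> are constant, so only the two connection terms
    remain; they are the lowered components with the first two indices in either order.\<close>
  have sym1: "?l x i j k = ?l x j i k" if x: "x \<in> darboux_dom c" for x i j k
  proof -
    have "partial k (\<lambda>z. omega i j) x - (\<Sum>l\<in>UNIV. \<gamma> c x l i k * omega l j)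
          - (\<Sum>l\<in>UNIV. \<gamma> c x l j k * omega i l) = 0"
      using \<gamma> c x by (simp add: symplectic_connection_def)
    moreover have "partial k (\<lambda>z. omega i j) x = 0" by (simp add: partial_def)
    moreover have "(\<Sum>l\<in>UNIV. \<gamma> c x l i k * omega l j) = - ?l x j i k"
      unfolding lower_def sum_negf[symmetric]
      by (rule sum.cong[OF refl], subst omega_antisym) simp
    moreover have "(\<Sum>l\<in>UNIV. \<gamma> c x l j k * omega i l) = ?l x i j k"
      unfolding lower_def by (simp add: mult.commute)
    ultimately show ?thesis by simp
  qed
  obtain f where f': "\<forall>\<epsilon> \<alpha> \<beta> \<delta>. smooth_on ?V (\<lambda>q. f q \<epsilon> \<alpha> \<beta> \<delta>)"
    "\<forall>x\<in>darboux_dom c. \<forall>\<alpha> \<beta> \<delta>. ?l x (Inl \<alpha>) (Inl \<beta>) (Inl \<delta>) =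
      (\<Sum>\<epsilon>\<in>UNIV. x $ Inr \<epsilon> * f (qpart x) \<epsilon> \<alpha> \<beta> \<delta>)"
    using bspec[OF comp[unfolded compatible_connection_def] c] by (elim conjE exE) (rule that)
  then have f: "smooth_on ?V (\<lambda>q. f q \<epsilon> \<alpha> \<beta> \<delta>)"
    "x \<in> darboux_dom c \<Longrightarrow> ?l x (Inl \<alpha>) (Inl \<beta>) (Inl \<delta>) =
      (\<Sum>\<epsilon>\<in>UNIV. x $ Inr \<epsilon> * f (qpart x) \<epsilon> \<alpha> \<beta> \<delta>)" for x \<epsilon> \<alpha> \<beta> \<delta>
    by simp_all
  have l0: "?l x (Inr \<mu>) (Inr \<nu>) j = 0" if "x \<in> darboux_dom c" for x \<mu> \<nu> j
    using comp c that by (cases j) (auto simp: compatible_connection_def)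
  have l1: "?l x (Inr \<mu>) (Inl \<alpha>) (Inl \<beta>) = - \<Gamma> c (qpart x) \<mu> \<alpha> \<beta>" if "x \<in> darboux_dom c" for x \<mu> \<alpha> \<beta>
    using comp c that by (auto simp: compatible_connection_def)
  let ?h = "\<lambda>i j k. cut (\<lambda>x. complex_of_real (?l x i j k / 2))"
  have hs: "?h i j k = ?h j i k" "?h i j k = ?h i k j" for i j k
    using sym1 sym2 by (auto simp: cut_def fun_eq_iff D)
  have h0: "?h (Inr \<mu>) (Inr \<nu>) j = 0" for \<mu> \<nu> j
    using l0 by (auto simp: cut_def fun_eq_iff D)
  \<comment> \<open>The factor joins the minus sign of the compatibility condition with the half in
    the 1-form \<gamma>.\<close>
  have h1: "?h (Inr \<mu>) (Inl \<alpha>) (Inl \<beta>) = cut (affine_mom (\<lambda>q. \<Gamma> c q \<mu> \<alpha> \<beta> * (- 1 / 2)) 0)" for \<mu> \<alpha> \<beta>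
    using l1 by (auto simp: cut_def fun_eq_iff D affine_mom_def)
  have h3: "?h (Inl \<alpha>) (Inl \<beta>) (Inl \<delta>) = cut (affine_mom 0 (\<lambda>\<epsilon> q. f q \<epsilon> \<alpha> \<beta> \<delta> * (1 / 2)))" for \<alpha> \<beta> \<delta>
    using f(2) by (auto simp: cut_def fun_eq_iff D affine_mom_def sum_divide_distrib mult.commute)
  have f1: "fil (Suc 0) (const (?h (Inr \<mu>) (Inl \<alpha>) (Inl \<beta>)))" for \<mu> \<alpha> \<beta>
    unfolding h1 by (intro fil_affine_mom_1 smooth_on_mult smooth_on_const op \<Gamma>smooth)
  have f3: "fil 2 (const (?h (Inl \<alpha>) (Inl \<beta>) (Inl \<delta>)))" for \<alpha> \<beta> \<delta>
    unfolding h3 by (intro fil_affine_mom_2 smooth_on_mult smooth_on_const smooth_on_zero_fun op f(1))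
  have fil: "fil (wt i + wt j + wt k - 1) (const (?h i j k))" for i j k
  proof (cases i; cases j; cases k)
    fix \<alpha> \<beta> \<delta> assume "i = Inl \<alpha>" "j = Inl \<beta>" "k = Inl \<delta>"
    then show ?thesis using f3[of \<alpha> \<beta> \<delta>] by (simp add: numeral_2_eq_2 del: fil.simps)
  next
    fix \<alpha> \<beta> \<delta> assume "i = Inl \<alpha>" "j = Inl \<beta>" "k = Inr \<delta>"
    then show ?thesis using f1[of \<delta> \<alpha> \<beta>] hs(2)[of i j k] hs(1)[of i k j] by (simp del: fil.simps)
  next
    fix \<alpha> \<beta> \<delta> assume "i = Inl \<alpha>" "j = Inr \<beta>" "k = Inl \<delta>"
    then show ?thesis using f1[of \<beta> \<alpha> \<delta>] hs(1)[of i j k] by (simp del: fil.simps)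
  next
    fix \<alpha> \<beta> \<delta> assume "i = Inl \<alpha>" "j = Inr \<beta>" "k = Inr \<delta>"
    then show ?thesis using h0[of \<beta> \<delta> i] hs(1)[of i j k] hs(2)[of j i k] by simp
  next
    fix \<alpha> \<beta> \<delta> assume "i = Inr \<alpha>" "j = Inl \<beta>" "k = Inl \<delta>"
    then show ?thesis using f1[of \<alpha> \<beta> \<delta>] by (simp del: fil.simps)
  next
    fix \<alpha> \<beta> \<delta> assume "i = Inr \<alpha>" "j = Inl \<beta>" "k = Inr \<delta>"
    then show ?thesis using h0[of \<alpha> \<delta> j] hs(2)[of i j k] by simp
  next
    fix \<alpha> \<beta> \<delta> assume "i = Inr \<alpha>" "j = Inr \<beta>"
    then show ?thesis using h0[of \<alpha> \<beta> k] by simp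
  next
    fix \<alpha> \<beta> \<delta> assume "i = Inr \<alpha>" "j = Inr \<beta>"
    then show ?thesis using h0[of \<alpha> \<beta> k] by simp
  qed
  show "fedosov_data (darboux_dom c) (\<gamma> c)"
    unfolding D
    by unfold_locales (use smooth sym1 sym2 fil in \<open>auto simp only: D\<close>)
qed

theorem mainTheorem11:
  fixes \<A> :: "('m::t2_space, 'n::finite) chart set"
    and \<Gamma> :: "('m, 'n) chart \<Rightarrow> real^'n \<Rightarrow> 'n \<Rightarrow> 'n \<Rightarrow> 'n \<Rightarrow> real"
    and \<gamma> :: "('m, 'n) chart \<Rightarrow> 'n phase \<Rightarrow> 'n + 'n \<Rightarrow> 'n + 'n \<Rightarrow> 'n + 'n \<Rightarrow> real"
    and c :: "('m, 'n) chart"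
  assumes "smooth_manifold \<A>"
    and "symmetric_connection_on \<A> \<Gamma>"
    and "symplectic_connection \<A> \<gamma>"
    and "compatible_connection \<A> \<Gamma> \<gamma>"
    and "c \<in> \<A>"
  defines "D \<equiv> darboux_dom c"
  defines "bracket \<equiv> moyal_bracket D (\<gamma> c)"
  shows "(\<forall>\<alpha> \<beta>. \<forall>x\<in>D.
            bracket (pos_var id \<alpha>) (pos_var id \<beta>) x = 0 \<and>
            bracket (pos_var id \<alpha>) (mom_var id \<beta>) x = (if \<alpha> = \<beta> then fps_const \<i> * hbar else 0) \<and>
            bracket (mom_var id \<alpha>) (mom_var id \<beta>) x = 0) \<and>
         (\<forall>V' Q R. diffeo (snd c ` fst c) V' Q R \<longrightarrow>
           (\<forall>\<alpha> \<beta>. \<forall>x\<in>D. let X = point_transf Q R in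
            bracket (pos_var X \<alpha>) (pos_var X \<beta>) x = 0 \<and>
            bracket (pos_var X \<alpha>) (mom_var X \<beta>) x = (if \<alpha> = \<beta> then fps_const \<i> * hbar else 0) \<and>
            bracket (mom_var X \<alpha>) (mom_var X \<beta>) x = 0))"
proof -
  let ?V = "snd c ` fst c"
  have D: "D = qpart -` ?V" by (auto simp: D_def darboux_dom_def)
  note data = fedosov_data_compatible[OF assms(1-5), folded D_def]
  interpret darboux_domain ?V by (rule data(1))
  interpret F: fedosov_data "qpart -` ?V" "\<gamma> c"
    using data(2) unfolding D .
  \<comment> \<open>\<open>X\<close> is a variable with an equation, so that it can be instantiated
    by \<open>id\<close>.\<close>
  have main: "bracket (pos_var X \<alpha>) (pos_var X \<beta>) x = 0 \<and>
      bracket (pos_var X \<alpha>) (mom_var X \<beta>) x = (if \<alpha> = \<beta> then fps_const \<i> * hbar else 0) \<and>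
      bracket (mom_var X \<alpha>) (mom_var X \<beta>) x = 0"
    if diff: "diffeo ?V V' Q R" and x: "x \<in> D" and X: "X = point_transf Q R" for V' Q R \<alpha> \<beta> x X
  proof -
    interpret point_transformation ?V V' Q R by unfold_locales (rule diff)
    have z: "smooth_on ?V (0 :: real^'n \<Rightarrow> real)" by (rule smooth_on_zero_fun[OF open_V])
    have z': "smooth_on ?V ((0 :: 'n \<Rightarrow> real^'n \<Rightarrow> real) l)" for l using z by simp
    have pos: "cut (pos_var X \<alpha>) \<in> csec" "fil 2 (const (cut (pos_var X \<alpha>)))" for \<alpha>
      unfolding X pos_var_eq by (intro affine_mom_csec fil_affine_mom_2 Q_comp_smooth z')+
    have mom: "cut (mom_var X \<alpha>) \<in> csec" "fil 2 (const (cut (mom_var X \<alpha>)))" for \<alpha>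
      unfolding X mom_var_eq by (intro affine_mom_csec fil_affine_mom_2 mom_coeff_smooth z)+
    have x': "x \<in> qpart -` ?V" using x D by simp
    note br = F.moyal_bracket_affine_momenta[OF _ _ _ _ x']
    \<comment> \<open>For a conjugate pair the bracket sum is -1, and \<open>- \<i>\<close> times it
      yields \<open>fps_const \<i> * hbar\<close>.\<close>
    show ?thesis
      unfolding bracket_def D br[OF pos pos] br[OF pos mom] br[OF mom mom]
        poisson_relations[OF x', folded X]
      by simp
  qed
  have "diffeo ?V ?V id id" by (rule diffeo_id[OF open_V])
  from main[OF this _ point_transf_id[symmetric]] main show ?thesis
    unfolding Let_def by blast
qed

end
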